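(* Let $f:\mathbb T\to\mathbb R$ be piecewise H\"older and $\omega\in\mathbb R\setminus\mathbb Q$. Suppose that the Lyapunov exponent $\mathcal L$ is continuous in $E$ and $\mathcal L(E)>0$ for every $E\in\mathbb R$. Then: 1. $\beta^-_{(\omega,\theta)}(p)=0$ for all $\theta\in\mathbb T$ and $p>0$; 2. if $\omega$ is Diophantine, then $\beta^+_{(\omega,\theta)}(p)=0$ for all $\theta\in\mathbb T$ and $p>0$.
   Context: $\mathbb T=\mathbb R/\mathbb Z$. For $f:\mathbb T\to\mathbb R$, $\omega\in\mathbb R\setminus\mathbb Q$ and $\theta$, let $\mathfrak h_\theta$ be the Schr\"odinger operator on $\ell^2(\mathbb Z)$, $(\mathfrak h_\theta u)(n)=u(n-1)+u(n+1)+f(n\omega+\theta)u(n)$. Piecewise H\"older: $f$ has a finite set of discontinuities $J_f$ and there is $\gamma>0$ such that $\|f\|_{PL_\gamma}=\|f\|_\infty+\sup_{h>0}\sup_{t\in\mathbb T;\,\mathrm{dist}(t,J_f)>|h|}\frac{|f(t+h)-f(t)|}{|h|^\gamma}<\infty$, where $\|f\|_\infty=\sup|f|$ (if $J_f=\emptyset$ the distance condition is void). Lyapunov exponent: for $z\in\mathbb C$ let $A^{f,z}(\theta)=\begin{pmatrix}z-f(\theta)&-1\\1&0\end{pmatrix}$, $A^{f,z}_k(\theta)=A^{f,z}(\theta+(k-1)\omega)\cdots A^{f,z}(\theta+\omega)A^{f,z}(\theta)$ for $k\ge1$, and $\mathcal L(z)=\lim_{k\to\infty}\frac1k\int_{\mathbb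 T}\ln\|A^{f,z}_k(\theta)\|\,d\theta$. Diophantine: let $p_n/q_n$ be the continued fraction approximants of $\omega$; $\omega$ is Diophantine if for some $\kappa>0$, $q_{n+1}<q_n^{1+\kappa}$ for all large $n$. Transport exponents: $a(n,t)=\frac12\left(|\langle e^{-it\mathfrak h_\theta}\delta_0,\delta_n\rangle|^2+|\langle e^{-it\mathfrak h_\theta}\delta_1,\delta_n\rangle|^2\right)$, $a_T(n)=\frac2T\int_0^\infty e^{-2t/T}a(n,t)\,dt$, $\langle|X|^p(T)\rangle=\sum_n(1+|n|)^pa(n,T)$ (no time averaging), $\langle|X|_T^p\rangle=\sum_n(1+|n|)^pa_T(n)$ (time averaged), and for $p>0$ $$\beta^+_{(\omega,\theta)}(p)=\limsup_{t\to\infty}\frac{\ln\langle|X|^p(t)\rangle}{p\ln t},\qquad \beta^-_{(\omega,\theta)}(p)=\liminf_{t\to\infty}\frac{\ln\langle|X|_t^p\rangle}{p\ln t}.$$ *)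

theory Defs
  imports "HOL-Analysis.Analysis"
begin

section \<open>The Hilbert space of square-summable families\<close>

typedef 'a ell2 = "{u :: 'a \<Rightarrow> complex. (\<lambda>i. (cmod (u i))\<^sup>2) summable_on UNIV}"
  morphisms coord Abs_ell2
  by (intro exI[of _ "\<lambda>_. 0"]) simp

setup_lifting type_definition_ell2

lemma summable_coord: "(\<lambda>i. (cmod (coord u i))\<^sup>2) summable_on UNIV"
  using coord[of u] by simp

lemma square_summable_add:
  fixes u v :: "'a \<Rightarrow> complex"
  assumes "(\<lambda>i. (cmod (u i))\<^sup>2) summable_on UNIV" "(\<lambda>i. (cmod (v i))\<^sup>2) summable_on UNIV"
  shows "(\<lambda>i. (cmod (u i + v i))\<^sup>2) summable_on UNIV"
proof (rule summable_on_comparison_test)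
  show "(\<lambda>i. 2 * (cmod (u i))\<^sup>2 + 2 * (cmod (v i))\<^sup>2) summable_on UNIV"
    by (intro summable_on_add summable_on_cmult_right assms)
  fix i
  have "(cmod (u i + v i))\<^sup>2 \<le> (cmod (u i) + cmod (v i))\<^sup>2"
    by (intro power_mono norm_triangle_ineq) auto
  also have "\<dots> \<le> 2 * (cmod (u i))\<^sup>2 + 2 * (cmod (v i))\<^sup>2"
    using sum_squares_bound[of "cmod (u i)" "cmod (v i)"] by (simp add: power2_sum)
  finally show "(cmod (u i + v i))\<^sup>2 \<le> 2 * (cmod (u i))\<^sup>2 + 2 * (cmod (v i))\<^sup>2" .
qed auto

lemma square_summable_cmult:
  fixes u :: "'a \<Rightarrow> complex"
  assumes "(\<lambda>i. (cmod (u i))\<^sup>2) summable_on UNIV"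
  shows "(\<lambda>i. (cmod (c * u i))\<^sup>2) summable_on UNIV"
  using summable_on_cmult_right[OF assms, of "(cmod c)\<^sup>2"]
  by (simp add: norm_mult power_mult_distrib)

lemma summable_coord_prod: "(\<lambda>i. coord u i * cnj (coord v i)) summable_on UNIV"
proof (rule abs_summable_summable, rule summable_on_comparison_test)
  show "(\<lambda>i. (cmod (coord u i))\<^sup>2 + (cmod (coord v i))\<^sup>2) summable_on UNIV"
    by (intro summable_on_add summable_coord)
  fix i
  show "cmod (coord u i * cnj (coord v i)) \<le> (cmod (coord u i))\<^sup>2 + (cmod (coord v i))\<^sup>2"
    using sum_squares_bound[of "cmod (coord u i)" "cmod (coord v i)"]
      mult_nonneg_nonneg[OF norm_ge_zero norm_ge_zero, of "coord u i" "coord v i"]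
    unfolding norm_mult complex_mod_cnj by linarith
qed auto

definition cinner :: "'a ell2 \<Rightarrow> 'a ell2 \<Rightarrow> complex" where
  "cinner u v = (\<Sum>\<^sub>\<infinity>i. coord u i * cnj (coord v i))"

instantiation ell2 :: (type) ab_group_add
begin
lift_definition zero_ell2 :: "'a ell2" is "\<lambda>_. 0" by simp
lift_definition plus_ell2 :: "'a ell2 \<Rightarrow> 'a ell2 \<Rightarrow> 'a ell2" is "\<lambda>u v i. u i + v i"
  by (rule square_summable_add)
lift_definition uminus_ell2 :: "'a ell2 \<Rightarrow> 'a ell2" is "\<lambda>u i. - u i" by simp
lift_definition minus_ell2 :: "'a ell2 \<Rightarrow> 'a ell2 \<Rightarrow> 'a ell2" is "\<lambda>u v i. u i - v i"
  subgoal for u v using square_summable_add[of u "\<lambda>i. - v i"] by simp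
  done
instance by standard (transfer; simp add: fun_eq_iff algebra_simps)+
end

lift_definition cscale :: "complex \<Rightarrow> 'a ell2 \<Rightarrow> 'a ell2" is "\<lambda>c u i. c * u i"
  by (rule square_summable_cmult)

text \<open>Only the real scalar multiplication and the real part of the inner product are available as
  type class operations; they give the usual norm and topology of the complex Hilbert space.\<close>

instantiation ell2 :: (type) real_inner
begin
definition scaleR_ell2 :: "real \<Rightarrow> 'a ell2 \<Rightarrow> 'a ell2" where
  "scaleR_ell2 r u = cscale (complex_of_real r) u"
definition inner_ell2 :: "'a ell2 \<Rightarrow> 'a ell2 \<Rightarrow> real" where
  "inner_ell2 u v = Re (cinner u v)"
definition norm_ell2 :: "'a ell2 \<Rightarrow> real" where
  "norm_ell2 u = sqrt (inner u u)"
definition sgn_ell2 :: "'a ell2 \<Rightarrow> 'a ell2" where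
  "sgn_ell2 u = inverse (norm u) *\<^sub>R u"
definition dist_ell2 :: "'a ell2 \<Rightarrow> 'a ell2 \<Rightarrow> real" where
  "dist_ell2 u v = norm (u - v)"
definition uniformity_ell2 :: "('a ell2 \<times> 'a ell2) filter" where
  "uniformity_ell2 = (INF e\<in>{0<..}. principal {(u, v). dist u v < e})"
definition open_ell2 :: "'a ell2 set \<Rightarrow> bool" where
  "open_ell2 U \<longleftrightarrow> (\<forall>u\<in>U. \<forall>\<^sub>F (u', v) in uniformity. u' = u \<longrightarrow> v \<in> U)"
instance
proof
  fix u v w :: "'a ell2" and a b :: real
  show "a *\<^sub>R (u + v) = a *\<^sub>R u + a *\<^sub>R v" "(a + b) *\<^sub>R u = a *\<^sub>R u + b *\<^sub>R u"
    "a *\<^sub>R b *\<^sub>R u = (a * b) *\<^sub>R u" "1 *\<^sub>R u = u"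
    unfolding scaleR_ell2_def by (transfer; simp add: fun_eq_iff algebra_simps)+
  show "sgn u = inverse (norm u) *\<^sub>R u" by (rule sgn_ell2_def)
  show "dist u v = norm (u - v)" by (rule dist_ell2_def)
  show "uniformity = (INF e\<in>{0<..}. principal {(u, v :: 'a ell2). dist u v < e})"
    by (rule uniformity_ell2_def)
  show "open U \<longleftrightarrow> (\<forall>u\<in>U. \<forall>\<^sub>F (u', v) in uniformity. u' = u \<longrightarrow> v \<in> U)"
    for U :: "'a ell2 set" by (rule open_ell2_def)
  show "norm u = sqrt (inner u u)" by (rule norm_ell2_def)
  have "cinner v u = cnj (cinner u v)"
    by (simp add: cinner_def mult.commute flip: infsum_cnj)
  then show "inner u v = inner v u" by (simp add: inner_ell2_def)
  have "cinner (u + v) w = cinner u w + cinner v w"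
    unfolding cinner_def plus_ell2.rep_eq distrib_right
    by (intro infsum_add summable_coord_prod)
  then show "inner (u + v) w = inner u w + inner v w" by (simp add: inner_ell2_def)
  have "cinner (a *\<^sub>R u) v = of_real a * cinner u v"
    unfolding cinner_def scaleR_ell2_def cscale.rep_eq mult.assoc
    by (intro infsum_cmult_right summable_coord_prod)
  then show "inner (a *\<^sub>R u) v = a * inner u v" by (simp add: inner_ell2_def)
  have *: "inner u u = (\<Sum>\<^sub>\<infinity>i. (cmod (coord u i))\<^sup>2)"
    unfolding inner_ell2_def cinner_def
    by (subst infsum_Re[OF summable_coord_prod, symmetric])
      (simp add: complex_norm_square[symmetric] cmod_power2 power2_eq_square)
  show "0 \<le> inner u u" unfolding * by (intro infsum_nonneg) auto
  show "inner u u = 0 \<longleftrightarrow> u = 0"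
  proof
    assume "inner u u = 0"
    then have "(cmod (coord u i))\<^sup>2 = 0" for i
      using nonneg_infsum_le_0D[OF _ summable_coord[of u]] unfolding * by auto
    then show "u = 0" by (transfer; simp add: fun_eq_iff)
  next
    assume "u = 0"
    then show "inner u u = 0" unfolding * by (simp add: zero_ell2.rep_eq)
  qed
qed
end

lemma norm_ell2_square: "(norm u)\<^sup>2 = (\<Sum>\<^sub>\<infinity>i. (cmod (coord u i))\<^sup>2)"
proof -
  have "(norm u)\<^sup>2 = inner u u" by (simp add: power2_norm_eq_inner)
  also have "\<dots> = (\<Sum>\<^sub>\<infinity>i. (cmod (coord u i))\<^sup>2)"
    unfolding inner_ell2_def cinner_def
    by (subst infsum_Re[OF summable_coord_prod, symmetric])
      (simp add: complex_norm_square[symmetric] cmod_power2 power2_eq_square)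
  finally show ?thesis .
qed

lemma sum_coord_le_norm: "finite F \<Longrightarrow> (\<Sum>i\<in>F. (cmod (coord u i))\<^sup>2) \<le> (norm u)\<^sup>2"
  unfolding norm_ell2_square by (intro finite_sum_le_infsum summable_coord) auto

lemma norm_coord_le: "cmod (coord u i) \<le> norm u"
  using sum_coord_le_norm[of "{i}" u] by (simp add: power2_le_iff_abs_le)

lemma norm_cscale: "norm (cscale c u) = cmod c * norm u"
proof -
  have "(norm (cscale c u))\<^sup>2 = (cmod c * norm u)\<^sup>2"
    unfolding norm_ell2_square power_mult_distrib cscale.rep_eq norm_mult
    by (intro infsum_cmult_right summable_coord)
  then show ?thesis by simp
qed

instance ell2 :: (type) banach
proof
  fix X :: "nat \<Rightarrow> 'a ell2"
  assume X: "Cauchy X"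
  have "Cauchy (\<lambda>n. coord (X n) i)" for i
  proof (rule metric_CauchyI)
    fix e :: real assume "0 < e"
    then obtain M where M: "\<And>m n. m \<ge> M \<Longrightarrow> n \<ge> M \<Longrightarrow> dist (X m) (X n) < e"
      using metric_CauchyD[OF X] by metis
    show "\<exists>M. \<forall>m\<ge>M. \<forall>n\<ge>M. dist (coord (X m) i) (coord (X n) i) < e"
    proof (intro exI allI impI)
      fix m n assume "m \<ge> M" "n \<ge> M"
      then show "dist (coord (X m) i) (coord (X n) i) < e"
        using M[of m n] norm_coord_le[of "X m - X n" i] by (simp add: dist_norm minus_ell2.rep_eq)
    qed
  qed
  then obtain l where l: "\<And>i. (\<lambda>n. coord (X n) i) \<longlonglongrightarrow> l i"
    unfolding Cauchy_convergent_iff convergent_def by metis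
  have tail: "\<exists>M. \<forall>m\<ge>M. \<forall>F. finite F \<longrightarrow> (\<Sum>i\<in>F. (cmod (coord (X m) i - l i))\<^sup>2) \<le> e\<^sup>2"
    if "0 < e" for e :: real
  proof -
    obtain M where M: "\<And>m n. m \<ge> M \<Longrightarrow> n \<ge> M \<Longrightarrow> dist (X m) (X n) < e"
      using metric_CauchyD[OF X \<open>0 < e\<close>] by metis
    show ?thesis
    proof (intro exI allI impI)
      fix m and F :: "'a set" assume m: "m \<ge> M" and F: "finite F"
      show "(\<Sum>i\<in>F. (cmod (coord (X m) i - l i))\<^sup>2) \<le> e\<^sup>2"
      proof (rule LIMSEQ_le_const2)
        show "(\<lambda>n. \<Sum>i\<in>F. (cmod (coord (X m) i - coord (X n) i))\<^sup>2)
            \<longlonglongrightarrow> (\<Sum>i\<in>F. (cmod (coord (X m) i - l i))\<^sup>2)"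
          by (intro tendsto_intros l)
        show "\<exists>N. \<forall>n\<ge>N. (\<Sum>i\<in>F. (cmod (coord (X m) i - coord (X n) i))\<^sup>2) \<le> e\<^sup>2"
        proof (intro exI allI impI)
          fix n assume n: "n \<ge> M"
          have "(\<Sum>i\<in>F. (cmod (coord (X m) i - coord (X n) i))\<^sup>2) \<le> (norm (X m - X n))\<^sup>2"
            using sum_coord_le_norm[OF F, of "X m - X n"] by (simp add: minus_ell2.rep_eq)
          also have "\<dots> \<le> e\<^sup>2"
            using M[OF m n] by (intro power_mono) (auto simp: dist_norm)
          finally show "(\<Sum>i\<in>F. (cmod (coord (X m) i - coord (X n) i))\<^sup>2) \<le> e\<^sup>2" .
        qed
      qed
    qed
  qed
  have summable: "(\<lambda>i. (cmod (v i))\<^sup>2) summable_on UNIV"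
    if "\<And>F. finite F \<Longrightarrow> (\<Sum>i\<in>F. (cmod (v i))\<^sup>2) \<le> C" for v :: "'a \<Rightarrow> complex" and C
    using that by (intro nonneg_bdd_above_summable_on) (auto intro!: bdd_aboveI)
  obtain M where "\<And>F. finite F \<Longrightarrow> (\<Sum>i\<in>F. (cmod (coord (X M) i - l i))\<^sup>2) \<le> 1\<^sup>2"
    using tail[of 1] by auto
  then have "(\<lambda>i. (cmod (coord (X M) i - l i))\<^sup>2) summable_on UNIV" by (rule summable)
  then have "(\<lambda>i. (cmod (coord (X M) i + (-1) * (coord (X M) i - l i)))\<^sup>2) summable_on UNIV"
    by (intro square_summable_add square_summable_cmult summable_coord)
  then have "(\<lambda>i. (cmod (l i))\<^sup>2) summable_on UNIV" by simp
  then have cl: "coord (Abs_ell2 l) = l" by (intro Abs_ell2_inverse) simp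
  have "X \<longlonglongrightarrow> Abs_ell2 l"
  proof (rule metric_LIMSEQ_I)
    fix r :: real assume "0 < r"
    then obtain M where
      M: "\<And>m F. m \<ge> M \<Longrightarrow> finite F \<Longrightarrow> (\<Sum>i\<in>F. (cmod (coord (X m) i - l i))\<^sup>2) \<le> (r/2)\<^sup>2"
      using tail[of "r/2"] by auto
    show "\<exists>no. \<forall>n\<ge>no. dist (X n) (Abs_ell2 l) < r"
    proof (intro exI allI impI)
      fix m assume m: "m \<ge> M"
      have "(norm (X m - Abs_ell2 l))\<^sup>2 \<le> (r/2)\<^sup>2"
        unfolding norm_ell2_square minus_ell2.rep_eq cl
        using summable_coord[of "X m - Abs_ell2 l"] M[OF m]
        by (intro infsum_le_finite_sums) (auto simp: minus_ell2.rep_eq cl)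
      then have "norm (X m - Abs_ell2 l) \<le> r/2"
        using \<open>0 < r\<close> by (simp add: power2_le_iff_abs_le)
      then show "dist (X m) (Abs_ell2 l) < r" using \<open>0 < r\<close> by (simp add: dist_norm)
    qed
  qed
  then show "convergent X" by (auto simp: convergent_def)
qed

lemma square_summable_delta: "(\<lambda>i. (cmod (if i = j then 1 else 0))\<^sup>2) summable_on UNIV"
proof -
  have "(\<lambda>i. (cmod (if i = j then 1 else 0))\<^sup>2) summable_on {j}"
    by (rule summable_on_finite) simp
  then show ?thesis
    by (rule summable_on_cong_neutral[THEN iffD1, rotated -1]) auto
qed

lift_definition delta :: "'a \<Rightarrow> 'a ell2" is "\<lambda>j i. if i = j then 1 else 0"
  by (rule square_summable_delta)


section \<open>The operator and its unitary group\<close>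

text \<open>Functions on the torus are 1-periodic functions on the reals.  For unbounded \<open>f\<close> the
  right-hand side below need not be square summable and the operator is unspecified.\<close>

definition schroedinger :: "(real \<Rightarrow> real) \<Rightarrow> real \<Rightarrow> real \<Rightarrow> int ell2 \<Rightarrow> int ell2" where
  "schroedinger f \<omega> \<theta> u = Abs_ell2 (\<lambda>n. coord u (n - 1) + coord u (n + 1)
     + complex_of_real (f (of_int n * \<omega> + \<theta>)) * coord u n)"

text \<open>For bounded linear \<open>A\<close> the series converges absolutely, see \<open>summable_op_exp\<close>
  and \<open>bounded_linear_schroedinger\<close> below.\<close>

definition op_exp :: "('v \<Rightarrow> 'v) \<Rightarrow> 'v \<Rightarrow> 'v::real_normed_vector" where
  "op_exp A u = (\<Sum>k. (A ^^ k) u /\<^sub>R fact k)"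

definition propagator :: "(real \<Rightarrow> real) \<Rightarrow> real \<Rightarrow> real \<Rightarrow> real \<Rightarrow> int ell2 \<Rightarrow> int ell2" where
  "propagator f \<omega> \<theta> t = op_exp (\<lambda>u. cscale (- \<i> * complex_of_real t) (schroedinger f \<omega> \<theta> u))"

lemma summable_op_exp:
  fixes A :: "'v \<Rightarrow> 'v::banach"
  assumes "bounded_linear A"
  shows "summable (\<lambda>k. (A ^^ k) u /\<^sub>R fact k)"
proof -
  obtain K where K: "0 \<le> K" "\<And>x. norm (A x) \<le> norm x * K"
    using bounded_linear.nonneg_bounded[OF assms] by auto
  have "norm ((A ^^ k) u) \<le> K ^ k * norm u" for k
  proof (induction k)
    case (Suc k)
    have "norm ((A ^^ Suc k) u) \<le> norm ((A ^^ k) u) * K" using K by simp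
    also have "\<dots> \<le> (K ^ k * norm u) * K" using Suc K by (intro mult_right_mono)
    finally show ?case by (simp add: mult_ac)
  qed simp
  then have "norm ((A ^^ k) u /\<^sub>R fact k) \<le> inverse (fact k) * (K ^ k * norm u)" for k
    by (simp add: mult_left_mono)
  moreover have "summable (\<lambda>k. inverse (fact k) * (K ^ k * norm u))"
    using summable_mult2[OF summable_exp, of K "norm u"] by (simp only: mult.assoc)
  ultimately show ?thesis
    by (rule summable_comparison_test'[of _ 0, rotated])
qed

lemma square_summable_shift:
  "(\<lambda>n. (cmod (coord u (n + k)))\<^sup>2) summable_on UNIV" for u :: "int ell2" and k :: int
  using summable_on_reindex_bij_betw[of "\<lambda>n. n + k" UNIV UNIV "\<lambda>n. (cmod (coord u n))\<^sup>2"]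
    summable_coord[of u] by (simp add: bij_betw_def surj_plus_right)

lemma norm_shift: "norm (Abs_ell2 (\<lambda>n. coord u (n + k))) = norm u"
  for u :: "int ell2" and k :: int
proof -
  have "(norm (Abs_ell2 (\<lambda>n. coord u (n + k))))\<^sup>2 = (norm u)\<^sup>2"
    unfolding norm_ell2_square
    using infsum_reindex_bij_betw[of "\<lambda>n. n + k" UNIV UNIV "\<lambda>n. (cmod (coord u n))\<^sup>2"]
    by (simp add: Abs_ell2_inverse square_summable_shift bij_betw_def surj_plus_right)
  then show ?thesis by simp
qed

context
  fixes g :: "'a \<Rightarrow> real" and M :: real
  assumes g: "\<And>i. \<bar>g i\<bar> \<le> M"
begin

lemma cmod_mult_le: "(cmod (of_real (g i) * c))\<^sup>2 \<le> M\<^sup>2 * (cmod c)\<^sup>2"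
  using g[of i] unfolding norm_mult power_mult_distrib
  by (intro mult_right_mono) (auto intro: power2_le_iff_abs_le[THEN iffD2])

lemma square_summable_mult: "(\<lambda>i. (cmod (of_real (g i) * coord u i))\<^sup>2) summable_on UNIV"
  by (rule summable_on_comparison_test[OF summable_on_cmult_right[OF summable_coord[of u], of "M\<^sup>2"]])
    (auto simp only: cmod_mult_le zero_le_power2)

lemma norm_mult_le: "norm (Abs_ell2 (\<lambda>i. of_real (g i) * coord u i)) \<le> M * norm u"
proof -
  have M: "0 \<le> M" using g[of undefined] by linarith
  have "(norm (Abs_ell2 (\<lambda>i. of_real (g i) * coord u i)))\<^sup>2
      = (\<Sum>\<^sub>\<infinity>i. (cmod (of_real (g i) * coord u i))\<^sup>2)"
    unfolding norm_ell2_square by (subst Abs_ell2_inverse) (auto intro: square_summable_mult)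
  also have "\<dots> \<le> (\<Sum>\<^sub>\<infinity>i. M\<^sup>2 * (cmod (coord u i))\<^sup>2)"
    by (intro infsum_mono square_summable_mult summable_on_cmult_right summable_coord cmod_mult_le)
  also have "\<dots> = (M * norm u)\<^sup>2"
    unfolding norm_ell2_square power_mult_distrib
    by (intro infsum_cmult_right summable_coord)
  finally show ?thesis using M by (simp add: power2_le_iff_abs_le)
qed

end

lemma coord_schroedinger:
  assumes "bounded (range f)"
  shows "coord (schroedinger f \<omega> \<theta> u) n = coord u (n - 1) + coord u (n + 1)
    + complex_of_real (f (of_int n * \<omega> + \<theta>)) * coord u n"
proof -
  obtain M where "\<And>x. \<bar>f x\<bar> \<le> M" using assms by (auto simp: bounded_iff)
  then have "(\<lambda>n. (cmod (coord u (n + -1) + coord u (n + 1)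
      + complex_of_real (f (of_int n * \<omega> + \<theta>)) * coord u n))\<^sup>2) summable_on UNIV"
    by (intro square_summable_add square_summable_shift square_summable_mult[where M = M])
  then show ?thesis unfolding schroedinger_def by (subst Abs_ell2_inverse) auto
qed

lemma bounded_linear_schroedinger:
  assumes "bounded (range f)"
  shows "bounded_linear (\<lambda>u. cscale c (schroedinger f \<omega> \<theta> u))"
proof -
  obtain M where M: "\<And>x. \<bar>f x\<bar> \<le> M" using assms by (auto simp: bounded_iff)
  let ?S = "\<lambda>k u. Abs_ell2 (\<lambda>n. coord u (n + k)) :: int ell2"
  let ?V = "\<lambda>u. Abs_ell2 (\<lambda>n. of_real (f (of_int n * \<omega> + \<theta>)) * coord u n) :: int ell2"
  show ?thesis
  proof (rule bounded_linear_intro)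
    fix u v :: "int ell2" and r :: real
    show "cscale c (schroedinger f \<omega> \<theta> (u + v))
        = cscale c (schroedinger f \<omega> \<theta> u) + cscale c (schroedinger f \<omega> \<theta> v)"
      by (simp add: coord_inject[symmetric] fun_eq_iff cscale.rep_eq plus_ell2.rep_eq
          coord_schroedinger[OF assms] algebra_simps)
    show "cscale c (schroedinger f \<omega> \<theta> (r *\<^sub>R u)) = r *\<^sub>R cscale c (schroedinger f \<omega> \<theta> u)"
      by (simp add: coord_inject[symmetric] fun_eq_iff cscale.rep_eq scaleR_ell2_def
          coord_schroedinger[OF assms] algebra_simps)
    have S: "coord (?S k u) = (\<lambda>n. coord u (n + k))" for k
      by (rule Abs_ell2_inverse) (simp add: square_summable_shift)
    have V: "coord (?V u) = (\<lambda>n. of_real (f (of_int n * \<omega> + \<theta>)) * coord u n)"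
      by (rule Abs_ell2_inverse, rule CollectI, rule square_summable_mult, rule M)
    have dec: "schroedinger f \<omega> \<theta> u = ?S (-1) u + ?S 1 u + ?V u"
      by (rule coord_inject[THEN iffD1], rule ext)
        (simp add: plus_ell2.rep_eq coord_schroedinger[OF assms] S S[of "-1", simplified] V)
    have "norm (schroedinger f \<omega> \<theta> u) \<le> norm (?S (-1) u) + norm (?S 1 u) + norm (?V u)"
      unfolding dec using norm_triangle_ineq[of "?S (-1) u + ?S 1 u" "?V u"]
        norm_triangle_ineq[of "?S (-1) u" "?S 1 u"] by linarith
    also have "\<dots> \<le> norm u + norm u + M * norm u"
      unfolding norm_shift using norm_mult_le[of "\<lambda>n. f (of_int n * \<omega> + \<theta>)" M u] M by simp
    finally have "cmod c * norm (schroedinger f \<omega> \<theta> u) \<le> cmod c * (norm u + norm u + M * norm u)"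
      by (intro mult_left_mono) auto
    then show "norm (cscale c (schroedinger f \<omega> \<theta> u)) \<le> norm u * (cmod c * (2 + M))"
      by (simp add: norm_cscale algebra_simps)
  qed
qed


section \<open>Piecewise Hoelder functions on the torus\<close>

definition periodic1 :: "(real \<Rightarrow> real) \<Rightarrow> bool" where
  "periodic1 f \<longleftrightarrow> (\<forall>x. f (x + 1) = f x)"

text \<open>The full periodic preimage of the discontinuity set of \<open>f\<close> on the torus, so that
  the distance to it in the reals is the distance in the torus.\<close>

definition jumps :: "(real \<Rightarrow> real) \<Rightarrow> real set" where
  "jumps f = {t. \<not> isCont f t}"

text \<open>The case distinction is needed because \<^const>\<open>infdist\<close> to the empty set is \<open>0\<close>.\<close>

definition PL_norm :: "real \<Rightarrow> (real \<Rightarrow> real) \<Rightarrow> ennreal" where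
  "PL_norm \<gamma> f = (SUP t. ennreal \<bar>f t\<bar>)
     + (SUP h\<in>{0<..}. SUP t\<in>{t. jumps f = {} \<or> infdist t (jumps f) > \<bar>h\<bar>}.
          ennreal (\<bar>f (t + h) - f t\<bar> / \<bar>h\<bar> powr \<gamma>))"

definition piecewise_hoelder :: "(real \<Rightarrow> real) \<Rightarrow> bool" where
  "piecewise_hoelder f \<longleftrightarrow> finite (jumps f \<inter> {0..<1}) \<and> (\<exists>\<gamma>>0. PL_norm \<gamma> f < \<infinity>)"


section \<open>Lyapunov exponent\<close>

definition transfer_matrix :: "(real \<Rightarrow> real) \<Rightarrow> complex \<Rightarrow> real \<Rightarrow> complex^2^2" where
  "transfer_matrix f z \<theta> =
     vector [vector [z - complex_of_real (f \<theta>), - 1], vector [1, 0]]"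

primrec cocycle :: "(real \<Rightarrow> real) \<Rightarrow> real \<Rightarrow> complex \<Rightarrow> nat \<Rightarrow> real \<Rightarrow> complex^2^2" where
  "cocycle f \<omega> z 0 \<theta> = mat 1"
| "cocycle f \<omega> z (Suc k) \<theta> = transfer_matrix f z (\<theta> + real k * \<omega>) ** cocycle f \<omega> z k \<theta>"

definition lyapunov :: "(real \<Rightarrow> real) \<Rightarrow> real \<Rightarrow> complex \<Rightarrow> real" where
  "lyapunov f \<omega> z =
     lim (\<lambda>k. (LBINT \<theta>:{0..1}. ln (onorm ((*v) (cocycle f \<omega> z k \<theta>)))) / real k)"


section \<open>Diophantine frequencies\<close>

primrec cf_remainder :: "real \<Rightarrow> nat \<Rightarrow> real" where
  "cf_remainder \<omega> 0 = \<omega>"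
| "cf_remainder \<omega> (Suc n) = 1 / frac (cf_remainder \<omega> n)"

definition cf_digit :: "real \<Rightarrow> nat \<Rightarrow> int" where
  "cf_digit \<omega> n = \<lfloor>cf_remainder \<omega> n\<rfloor>"

text \<open>The denominators \<open>q\<^sub>n\<close> of the convergents
  \<open>p\<^sub>n / q\<^sub>n = [a\<^sub>0; a\<^sub>1, \<dots>, a\<^sub>n]\<close> in lowest terms.\<close>

fun cf_denom :: "real \<Rightarrow> nat \<Rightarrow> int" where
  "cf_denom \<omega> 0 = 1"
| "cf_denom \<omega> (Suc 0) = cf_digit \<omega> 1"
| "cf_denom \<omega> (Suc (Suc n)) = cf_digit \<omega> (Suc (Suc n)) * cf_denom \<omega> (Suc n) + cf_denom \<omega> n"

definition diophantine :: "real \<Rightarrow> bool" where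
  "diophantine \<omega> \<longleftrightarrow> (\<exists>\<kappa>>0. \<forall>\<^sub>F n in sequentially.
     real_of_int (cf_denom \<omega> (Suc n)) < real_of_int (cf_denom \<omega> n) powr (1 + \<kappa>))"


section \<open>Transport exponents\<close>

definition prob :: "(real \<Rightarrow> real) \<Rightarrow> real \<Rightarrow> real \<Rightarrow> int \<Rightarrow> real \<Rightarrow> real" where
  "prob f \<omega> \<theta> n t =
     ((cmod (cinner (propagator f \<omega> \<theta> t (delta 0)) (delta n)))\<^sup>2
      + (cmod (cinner (propagator f \<omega> \<theta> t (delta 1)) (delta n)))\<^sup>2) / 2"

definition prob_avg :: "(real \<Rightarrow> real) \<Rightarrow> real \<Rightarrow> real \<Rightarrow> int \<Rightarrow> real \<Rightarrow> real" where
  "prob_avg f \<omega> \<theta> n T = 2 / T * (LBINT t:{0..}. exp (- 2 * t / T) * prob f \<omega> \<theta> n t)"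

definition moment :: "(real \<Rightarrow> real) \<Rightarrow> real \<Rightarrow> real \<Rightarrow> real \<Rightarrow> real \<Rightarrow> real" where
  "moment f \<omega> \<theta> p t = (\<Sum>\<^sub>\<infinity>n. (1 + \<bar>real_of_int n\<bar>) powr p * prob f \<omega> \<theta> n t)"

definition moment_avg :: "(real \<Rightarrow> real) \<Rightarrow> real \<Rightarrow> real \<Rightarrow> real \<Rightarrow> real \<Rightarrow> real" where
  "moment_avg f \<omega> \<theta> p T = (\<Sum>\<^sub>\<infinity>n. (1 + \<bar>real_of_int n\<bar>) powr p * prob_avg f \<omega> \<theta> n T)"

definition beta_plus :: "(real \<Rightarrow> real) \<Rightarrow> real \<Rightarrow> real \<Rightarrow> real \<Rightarrow> ereal" where
  "beta_plus f \<omega> \<theta> p = Limsup at_top (\<lambda>t. ereal (ln (moment f \<omega> \<theta> p t) / (p * ln t)))"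

definition beta_minus :: "(real \<Rightarrow> real) \<Rightarrow> real \<Rightarrow> real \<Rightarrow> real \<Rightarrow> ereal" where
  "beta_minus f \<omega> \<theta> p = Liminf at_top (\<lambda>t. ereal (ln (moment_avg f \<omega> \<theta> p t) / (p * ln t)))"

end

theory Submission
  imports Defs "HOL-Complex_Analysis.Complex_Analysis" "HOL-Real_Asymp.Real_Asymp"
begin

text \<open>
  If the transfer matrices over a block of sites between the source \<open>m\<close> and a site \<open>e\<close> are
  large at \<open>z = E \<plusminus> i/T\<close>, then the resolvent entry at \<open>(m, e)\<close> is small: the current
  \<open>Im (cnj (u j) * u (j + 1))\<close> of a square summable solution is monotone and dominates
  \<open>|u j|\<^sup>2 / T\<close>, which keeps the solution away from the direction contracted by the block.
  A contour integral of the resolvent along \<open>Im z = \<plusminus>1/T\<close> turns this into a bound on the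
  evolution up to time \<open>T\<close>.

  Large blocks are found near every phase as follows. Let \<open>q\<close> be a denominator of a convergent
  of \<open>\<omega>\<close> and \<open>n\<close> a small multiple of \<open>ln q\<close>. The function \<open>ln |A\<^sub>n|\<close> is nearly constant
  on intervals of length \<open>1/q\<close> that avoid about \<open>n\<close> jumps, so its average over an orbit of length
  \<open>q\<close> is close to its mean, which is at least \<open>n L(E)\<close>. Since \<open>ln |A\<^sub>n| \<le> n (L(E) + \<epsilon>)\<close>
  uniformly in the phase, \<open>A\<^sub>n\<close> and \<open>A\<^sub>2\<^sub>n\<close> are close to maximal at most points of the orbit,
  hence along some run of \<open>R\<close> consecutive blocks of length \<open>n\<close>, where \<open>R\<close> is as large as we
  please. Successive blocks then do not cancel, and the product over the run has norm at least
  \<open>exp (n R L / 2)\<close>, an arbitrarily large power of \<open>q\<close>. Every large \<open>q\<close> serves a time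
  \<open>T = q\<^bsup>1/\<delta>\<^esup>\<close>; for Diophantine \<open>\<omega>\<close> every large time is served.
\<close>

section \<open>Continued fractions and orbits of rotations\<close>

text \<open>Jumps and mere Hoelder continuity of \<open>f\<close> limit the block length: a
  displacement of order 1 / q may change ln |A_n| by about \<Lambda>^n q^(-\<gamma>), which is
  negligible only while n is at most ln q / c for a fixed c. A single block thus has at most a fixed
  power of q as its norm, whereas T^(P + 6) is wanted with T as large as q^(1 / d) and d arbitrarily
  small. Chaining R blocks overcomes this because c does not depend on R. The bound that a block
  yields does not decay with the distance to the source, so by itself it cannot be summed against (1
  + |n|)^p. It is multiplied with a bound that decays like exp (- const |n| / T) for every
  potential; the geometric mean of the two is both summable and small. The summation costs P + 1
  powers of T with P \<ge> p, paid for by the norm of the block. Continuity of the Lyapunov exponent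
  makes the upper bound on ln |A_n| uniform over compact energy intervals and provides a positive
  minimum there. All phases are reached because Birkhoff sums over q sites are compared for
  arbitrary starting points.\<close>

lemma orbit_matching:
  fixes p :: int and q :: nat and \<omega> :: real
  assumes q: "q > 0" and cop: "coprime p (int q)" and appr: "\<bar>\<omega> - p / q\<bar> \<le> 1 / q^2"
  shows "\<exists>\<sigma>. bij_betw \<sigma> {..<q} {..<q} \<and>
    (\<forall>i<q. \<exists>m::int. \<bar>\<theta> + real (\<sigma> i) * \<omega> - (y + real i * \<omega>) - m\<bar> \<le> 3 / q)"
proof -
  define l where "l = \<lfloor>q * (y - \<theta>)\<rfloor>"
  obtain u v where uv: "u * p + v * int q = 1"
    using bezout_int[of p "int q"] cop by auto
  \<comment> \<open>u inverts p modulo q, so k p = l modulo q, where l / q is y - \<theta> rounded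
    down to a multiple of 1 / q. Hence k steps of the rational rotation by p / q move \<theta> to
    within 1 / q of y.\<close>
  define k where "k = u * l"
  define s where "s i = nat ((int i + k) mod int q)" for i
  have s_lt: "s i < q" for i
    using q by (simp add: s_def nat_less_iff)
  have inj: "inj_on s {..<q}"
  proof (rule inj_onI)
    fix i j assume "i \<in> {..<q}" "j \<in> {..<q}" "s i = s j"
    then have "(int i + k) mod int q = (int j + k) mod int q"
      using q unfolding s_def by (simp add: eq_nat_nat_iff)
    then have "int q dvd int i - int j"
      by (metis add_diff_cancel_right mod_eq_dvd_iff)
    then show "i = j" using \<open>i \<in> {..<q}\<close> \<open>j \<in> {..<q}\<close>
      by (metis int_ops(9) lessThan_iff mod_eq_dvd_iff mod_less of_nat_eq_iff)
  qed
  then have bij: "bij_betw s {..<q} {..<q}"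
    unfolding bij_betw_def using s_lt
    by (metis endo_inj_surj finite_lessThan image_subsetI lessThan_iff)
  have small: "\<bar>real i * (\<omega> - p / q)\<bar> \<le> 1 / q" if "i < q" for i
  proof -
    have "\<bar>real i * (\<omega> - p / q)\<bar> \<le> real q * (1 / q^2)"
      unfolding abs_mult using that appr by (intro mult_mono) auto
    also have "\<dots> = 1 / q" using q by (simp add: power2_eq_square)
    finally show ?thesis .
  qed
  have "\<exists>m::int. \<bar>\<theta> + real (s i) * \<omega> - (y + real i * \<omega>) - m\<bar> \<le> 3 / q" if i: "i < q" for i
  proof -
    define r where "r = (int i + k) div int q"
    have "int (s i) = (int i + k) mod int q"
      using q by (simp add: s_def)
    also have "\<dots> = int i + k - int q * r"
      by (simp add: r_def minus_mult_div_eq_mod)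
    finally have si: "int (s i) = int i + k - int q * r" .
    have kp: "k * p = l - v * l * int q"
    proof -
      have "k * p = l * (u * p)" by (simp add: k_def)
      also have "u * p = 1 - v * int q" using uv by simp
      finally show ?thesis by (simp add: algebra_simps)
    qed
    have "int (s i) * p = int i * p + l + int q * (- v * l - r * p)"
      unfolding si using kp by (simp add: algebra_simps)
    then have "real_of_int (int (s i) * p) = real_of_int (int i * p + l + int q * (- v * l - r * p))"
      by simp
    then have sp: "real (s i) * p / q = real i * p / q + l / q + real_of_int (- v * l - r * p)"
      using q by (simp add: field_simps)
    have l1: "l / q \<le> y - \<theta>" "y - \<theta> \<le> l / q + 1 / q"
    proof -
      have "l \<le> q * (y - \<theta>)" "q * (y - \<theta>) \<le> l + 1"
        unfolding l_def by linarith+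
      then show "l / q \<le> y - \<theta>" "y - \<theta> \<le> l / q + 1 / q"
        using q by (simp_all add: field_simps)
    qed
    have "\<theta> + real (s i) * \<omega> - (y + real i * \<omega>) - real_of_int (- v * l - r * p)
      = real (s i) * (\<omega> - p / q) - real i * (\<omega> - p / q) - (y - \<theta> - l / q)"
      using sp by (simp add: algebra_simps)
    \<comment> \<open>Three errors of size 1 / q: each of the two indices is below q and accumulates
      at most q times 1 / q^2 when \<omega> is replaced by p / q, and the rounding of y - \<theta>
      contributes the third.\<close>
    moreover have "\<bar>\<dots>\<bar> \<le> 3 / q"
    proof -
      have "3 / q = 1 / q + 1 / q + 1 / real q" by simp
      then show ?thesis using small[OF s_lt[of i]] small[OF i] l1 unfolding abs_le_iff by linarith
    qed
    ultimately show ?thesis by metis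
  qed
  then show ?thesis using bij by blast
qed

text \<open>Up to an error 1 / q the orbit visits points with numerators i p modulo q, which are
  distinct because p is invertible. Those within c / q of a have distinct integer representatives in
  an interval of half-width c + 1 around q (a - y), whence 2 c + 3.\<close>

lemma orbit_count:
  fixes p :: int and q c :: nat and \<omega> y a :: real
  assumes q: "q > 0" and cop: "coprime p (int q)" and appr: "\<bar>\<omega> - p / q\<bar> \<le> 1 / q^2"
  shows "card {i. i < q \<and> (\<exists>m::int. \<bar>y + real i * \<omega> - a - m\<bar> \<le> c / q)} \<le> 2 * c + 3"
proof -
  let ?D = "{i. i < q \<and> (\<exists>m::int. \<bar>y + real i * \<omega> - a - m\<bar> \<le> c / q)}"
  let ?I = "{\<lceil>q * (a - y)\<rceil> - int c - 1 .. \<lfloor>q * (a - y)\<rfloor> + int c + 1}"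
  have "\<exists>t. t \<in> ?I \<and> int q dvd t - int i * p" if "i \<in> ?D" for i
  proof -
    from that obtain m :: int where i: "i < q" and m: "\<bar>y + real i * \<omega> - a - m\<bar> \<le> c / q" by auto
    have "\<bar>real q * (y + real i * \<omega> - a - m)\<bar> \<le> q * (c / q)"
      unfolding abs_mult using m by (intro mult_mono) auto
    then have 1: "\<bar>real q * (y + real i * \<omega> - a - m)\<bar> \<le> c" using q by simp
    have "\<bar>real q * (real i * (\<omega> - p / q))\<bar> \<le> q * (q * (1 / q^2))"
      unfolding abs_mult using appr i by (intro mult_mono) auto
    then have 2: "\<bar>real q * (real i * (\<omega> - p / q))\<bar> \<le> 1" using q by (simp add: power2_eq_square)
    have "real i * p - q * m - q * (a - y)
      = real q * (y + real i * \<omega> - a - m) - real q * (real i * (\<omega> - p / q))"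
      using q by (simp add: field_simps)
    then have 3: "\<bar>real_of_int (int i * p - int q * m) - q * (a - y)\<bar> \<le> c + 1"
      using 1 2 by auto
    show ?thesis
    proof (intro exI conjI)
      show "int i * p - int q * m \<in> ?I"
      proof -
        have "real_of_int (int i * p - int q * m) - real c - 1 \<le> q * (a - y)"
          "q * (a - y) \<le> real_of_int (int i * p - int q * m) + real c + 1"
          using 3 by (auto simp only: abs_le_iff)
        then have "\<lceil>q * (a - y)\<rceil> \<le> int i * p - int q * m + int c + 1"
          "int i * p - int q * m - int c - 1 \<le> \<lfloor>q * (a - y)\<rfloor>"
          by (simp_all add: ceiling_le_iff le_floor_iff)
        then show ?thesis by simp
      qed
      show "int q dvd int i * p - int q * m - int i * p" by simp
    qed
  qed
  then have "\<forall>i\<in>?D. \<exists>t. t \<in> ?I \<and> int q dvd t - int i * p" by blast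
  from bchoice[OF this] obtain t where
    t: "\<And>i. i \<in> ?D \<Longrightarrow> t i \<in> ?I \<and> int q dvd t i - int i * p" by blast
  have "inj_on t ?D"
  proof (rule inj_onI)
    fix i j assume ij: "i \<in> ?D" "j \<in> ?D" "t i = t j"
    have "int q dvd (t i - int j * p) - (t i - int i * p)"
      using t[OF ij(1)] t[OF ij(2)] ij(3) by (intro dvd_diff[of _ "t i - int j * p" "t i - int i * p"]) metis+
    then have "int q dvd (int i - int j) * p" by (simp add: algebra_simps)
    then have "int q dvd int i - int j" using cop
      by (metis coprime_commute coprime_dvd_mult_left_iff)
    then show "i = j" using ij
      by (metis (mono_tags, lifting) int_ops(9) mem_Collect_eq mod_eq_dvd_iff mod_less of_nat_eq_iff)
  qed
  moreover have "t ` ?D \<subseteq> ?I" using t by blast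
  ultimately have "card ?D \<le> card ?I" by (intro card_inj_on_le[of t]) simp_all
  also have "\<dots> \<le> 2 * c + 3"
    by simp linarith
  finally show ?thesis .
qed

lemma periodic_add_of_int:
  fixes g :: "real \<Rightarrow> 'a"
  assumes "\<And>x. g (x + 1) = g x"
  shows "g (x + of_int m) = g x"
proof (induction m)
  case (nonneg n)
  then show ?case by (induction n) (use assms in \<open>auto simp flip: add.assoc simp: add.commute[of 1]\<close>)
next
  case (neg n)
  have *: "g (x - of_nat n) = g x" for n
  proof (induction n)
    case (Suc n)
    then show ?case using assms[of "x - of_nat (Suc n)"] by (simp add: algebra_simps)
  qed simp
  from *[of "Suc n"] show ?case by (simp add: algebra_simps)
qed

text \<open>Denjoy-Koksma inequality with bounded variation replaced by an oscillation bound at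
  scale 1 / q away from J. Matched orbit points contribute e each; those within 7 / q of J number at
  most 17 = 2 * 7 + 3 per element of J and contribute at most 2 C each, whence 34.\<close>

lemma denjoy_koksma:
  fixes p :: int and q :: nat and \<omega> C e :: real and g :: "real \<Rightarrow> real" and J :: "real set"
  assumes q: "q > 0" and cop: "coprime p (int q)" and appr: "\<bar>\<omega> - p / q\<bar> \<le> 1 / q^2"
    and per: "\<And>x. g (x + 1) = g x" and bound: "\<And>x. \<bar>g x\<bar> \<le> C" and J: "finite J"
    and osc: "\<And>x x'. \<bar>x - x'\<bar> \<le> 3 / q \<Longrightarrow> (\<And>a m. a \<in> J \<Longrightarrow> \<bar>x - a - of_int m\<bar> > 7 / q) \<Longrightarrow> \<bar>g x - g x'\<bar> \<le> e"
    and e: "e \<ge> 0"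
  shows "\<bar>(\<Sum>i<q. g (\<theta> + real i * \<omega>)) - (\<Sum>i<q. g (y + real i * \<omega>))\<bar> \<le> q * e + 34 * C * card J"
proof -
  have C: "C \<ge> 0" using bound[of 0] by linarith
  obtain s where s: "bij_betw s {..<q} {..<q}"
    and sm: "\<And>i. i < q \<Longrightarrow> \<exists>m::int. \<bar>\<theta> + real (s i) * \<omega> - (y + real i * \<omega>) - m\<bar> \<le> 3 / q"
    using orbit_matching[OF assms(1-3)] by meson
  define D where "D a = {i. i < q \<and> (\<exists>m::int. \<bar>y + real i * \<omega> - a - m\<bar> \<le> real 7 / q)}" for a
  define U where "U = (\<Union>a\<in>J. D a)"
  have each: "\<bar>g (\<theta> + real (s i) * \<omega>) - g (y + real i * \<omega>)\<bar> \<le> e + 2 * C * (of_bool (i \<in> U) :: real)"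
    if i: "i < q" for i
  proof (cases "i \<in> U")
    case True
    then show ?thesis
      using bound[of "\<theta> + real (s i) * \<omega>"] bound[of "y + real i * \<omega>"] e by auto
  next
    case False
    obtain m :: int where m: "\<bar>\<theta> + real (s i) * \<omega> - (y + real i * \<omega>) - m\<bar> \<le> 3 / q" using sm[OF i] by auto
    have "\<bar>g (y + real i * \<omega>) - g (\<theta> + real (s i) * \<omega> + of_int (- m))\<bar> \<le> e"
    proof (rule osc)
      show "\<bar>y + real i * \<omega> - (\<theta> + real (s i) * \<omega> + of_int (- m))\<bar> \<le> 3 / q" using m by simp
      fix a and k :: int assume a: "a \<in> J"
      show "7 / q < \<bar>y + real i * \<omega> - a - k\<bar>"
        using False a i by (auto simp: D_def U_def not_le)
    qed
    then show ?thesis using False periodic_add_of_int[of g _ "-m", OF per] by (simp add: abs_minus_commute)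
  qed
  have "(\<Sum>i<q. g (\<theta> + real i * \<omega>)) = (\<Sum>i<q. g (\<theta> + real (s i) * \<omega>))"
    by (rule sum.reindex_bij_betw[OF s, symmetric])
  then have "\<bar>(\<Sum>i<q. g (\<theta> + real i * \<omega>)) - (\<Sum>i<q. g (y + real i * \<omega>))\<bar>
    \<le> (\<Sum>i<q. \<bar>g (\<theta> + real (s i) * \<omega>) - g (y + real i * \<omega>)\<bar>)"
    by (simp add: sum_subtractf[symmetric] sum_abs)
  also have "\<dots> \<le> (\<Sum>i<q. e + 2 * C * (of_bool (i \<in> U) :: real))"
    by (intro sum_mono each) auto
  also have "\<dots> = q * e + 2 * C * card U"
  proof -
    have "{..<q} \<inter> {i. i \<in> U} = U" by (auto simp: D_def U_def)
    then have "(\<Sum>i<q. of_bool (i \<in> U) :: real) = card U" by simp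
    then show ?thesis unfolding sum.distrib sum_distrib_left[symmetric] by simp
  qed
  also have "\<dots> \<le> q * e + 2 * C * (17 * card J)"
  proof -
    have "card U \<le> (\<Sum>a\<in>J. card (D a))" unfolding U_def by (rule card_UN_le[OF J])
    also have "\<dots> \<le> (\<Sum>a\<in>J. 17)"
      using orbit_count[OF assms(1-3), of y _ 7] by (intro sum_mono) (simp add: D_def)
    finally have "real (card U) \<le> real (17 * card J)" by (simp add: mult.commute)
    then show ?thesis using C by (intro add_left_mono mult_left_mono) auto
  qed
  finally show ?thesis by simp
qed

section \<open>Convergents of an irrational number\<close>

fun cf_numer :: "real \<Rightarrow> nat \<Rightarrow> int" where
  "cf_numer \<omega> 0 = cf_digit \<omega> 0"
| "cf_numer \<omega> (Suc 0) = cf_digit \<omega> 1 * cf_digit \<omega> 0 + 1"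
| "cf_numer \<omega> (Suc (Suc n)) = cf_digit \<omega> (Suc (Suc n)) * cf_numer \<omega> (Suc n) + cf_numer \<omega> n"

context
  fixes \<omega> :: real
  assumes irrational: "\<omega> \<notin> \<rat>"
begin

lemma cf_remainder_irrational: "cf_remainder \<omega> n \<notin> \<rat>"
proof (induction n)
  case 0
  show ?case using irrational by simp
next
  case (Suc n)
  show ?case
  proof
    assume "cf_remainder \<omega> (Suc n) \<in> \<rat>"
    then have "inverse (cf_remainder \<omega> (Suc n)) \<in> \<rat>" by (rule Rats_inverse)
    then have "frac (cf_remainder \<omega> n) \<in> \<rat>" by simp
    then have "frac (cf_remainder \<omega> n) + of_int \<lfloor>cf_remainder \<omega> n\<rfloor> \<in> \<rat>"
      by (intro Rats_add Rats_of_int)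
    then show False using Suc by (simp add: frac_def)
  qed
qed

lemma frac_cf_remainder: "0 < frac (cf_remainder \<omega> n)" "frac (cf_remainder \<omega> n) < 1"
proof -
  have "cf_remainder \<omega> n \<notin> \<int>" using cf_remainder_irrational Ints_subset_Rats by blast
  then show "0 < frac (cf_remainder \<omega> n)" "frac (cf_remainder \<omega> n) < 1" by (auto simp: frac_lt_1)
qed

lemma cf_digit_pos: "cf_digit \<omega> (Suc n) \<ge> 1"
  using frac_cf_remainder[of n] by (simp add: cf_digit_def le_floor_iff)

lemma cf_denom_pos: "cf_denom \<omega> n \<ge> 1 \<and> cf_denom \<omega> n \<le> cf_denom \<omega> (Suc n)"
proof (induction n)
  case 0
  show ?case using cf_digit_pos[of 0] by simp
next
  case (Suc n)
  have "1 * cf_denom \<omega> (Suc n) \<le> cf_digit \<omega> (Suc (Suc n)) * cf_denom \<omega> (Suc n)"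
    using cf_digit_pos[of "Suc n"] Suc by (intro mult_right_mono) auto
  then show ?case using Suc unfolding cf_denom.simps by linarith
qed

lemma cf_denom_ge: "cf_denom \<omega> n \<ge> int n"
proof (induction n rule: induct_nat_012)
  case 1
  show ?case using cf_denom_pos[of "Suc 0"] by simp
next
  case (ge2 n)
  have "1 * cf_denom \<omega> (Suc n) \<le> cf_digit \<omega> (Suc (Suc n)) * cf_denom \<omega> (Suc n)"
    using cf_digit_pos[of "Suc n"] cf_denom_pos[of "Suc n"] by (intro mult_right_mono) auto
  then show ?case using ge2 cf_denom_pos[of n] unfolding cf_denom.simps by linarith
qed simp

lemma cf_determinant:
  "cf_denom \<omega> (Suc n) * cf_numer \<omega> n - cf_denom \<omega> n * cf_numer \<omega> (Suc n) = (-1) ^ (Suc n)"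
  by (induction n) (auto simp: algebra_simps)

lemma cf_coprime: "coprime (cf_numer \<omega> n) (cf_denom \<omega> n)"
proof (rule coprimeI)
  fix c assume "c dvd cf_numer \<omega> n" "c dvd cf_denom \<omega> n"
  then have "c dvd cf_denom \<omega> (Suc n) * cf_numer \<omega> n - cf_denom \<omega> n * cf_numer \<omega> (Suc n)"
    by (intro dvd_diff dvd_mult dvd_mult2)
  then have "c dvd (-1) ^ Suc n" unfolding cf_determinant .
  then show "is_unit c" by (simp add: minus_one_power_iff split: if_splits)
qed

text \<open>The remainder of index n + 2 is minus the quotient of the errors q \<omega> - p at n and
  n + 1. Splitting off its integer part, the digit, leaves the fractional part as the factor by
  which the error shrinks while changing sign.\<close>

lemma cf_error_rec:
  "cf_denom \<omega> (Suc n) * \<omega> - cf_numer \<omega> (Suc n)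
    = - (cf_denom \<omega> n * \<omega> - cf_numer \<omega> n) * frac (cf_remainder \<omega> (Suc n))"
proof (induction n)
  case 0
  have "frac \<omega> > 0" using frac_cf_remainder[of 0] by simp
  then show ?case
    by (simp add: cf_digit_def frac_def[of "1 / frac \<omega>"] field_simps) (simp add: frac_def algebra_simps)
next
  case (Suc n)
  define d where "d n = cf_denom \<omega> n * \<omega> - cf_numer \<omega> n" for n
  have pos: "frac (cf_remainder \<omega> (Suc n)) > 0" using frac_cf_remainder by blast
  have IH: "d (Suc n) = - d n * frac (cf_remainder \<omega> (Suc n))" using Suc by (simp add: d_def)
  have "d n = - d (Suc n) * cf_remainder \<omega> (Suc (Suc n))" using IH pos by simp
  moreover have "d (Suc (Suc n)) = cf_digit \<omega> (Suc (Suc n)) * d (Suc n) + d n"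
    by (simp add: d_def algebra_simps)
  ultimately have "d (Suc (Suc n)) = - d (Suc n) * frac (cf_remainder \<omega> (Suc (Suc n)))"
    unfolding cf_digit_def frac_def by (simp add: algebra_simps)
  then show ?case by (simp only: d_def)
qed

text \<open>By the recursion for the errors d, the determinant identity q_(n+1) d_n - q_n d_(n+1) =
  +-1 becomes |d_n| (q_(n+1) + q_n x) = 1 with a fractional part x, and the bracket is at least
  q_n.\<close>

lemma cf_error: "\<bar>\<omega> - cf_numer \<omega> n / cf_denom \<omega> n\<bar> \<le> 1 / (cf_denom \<omega> n)^2"
proof -
  define d where "d n = cf_denom \<omega> n * \<omega> - cf_numer \<omega> n" for n
  have rec: "d (Suc n) = - d n * frac (cf_remainder \<omega> (Suc n))"
    using cf_error_rec by (simp add: d_def)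
  have q: "cf_denom \<omega> n \<ge> 1" "cf_denom \<omega> n \<le> cf_denom \<omega> (Suc n)" using cf_denom_pos by auto
  have "real_of_int (cf_denom \<omega> (Suc n)) * d n - cf_denom \<omega> n * d (Suc n)
    = - real_of_int (cf_denom \<omega> (Suc n) * cf_numer \<omega> n - cf_denom \<omega> n * cf_numer \<omega> (Suc n))"
    by (simp add: d_def algebra_simps)
  then have "\<bar>real_of_int (cf_denom \<omega> (Suc n)) * d n - cf_denom \<omega> n * d (Suc n)\<bar> = 1"
    unfolding cf_determinant by simp
  then have "\<bar>d n * (cf_denom \<omega> (Suc n) + cf_denom \<omega> n * frac (cf_remainder \<omega> (Suc n)))\<bar> = 1"
    by (simp add: rec algebra_simps)
  then have "\<bar>d n\<bar> * \<bar>cf_denom \<omega> (Suc n) + cf_denom \<omega> n * frac (cf_remainder \<omega> (Suc n))\<bar> = 1"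
    by (simp only: abs_mult)
  moreover have "real_of_int (cf_denom \<omega> n) \<le> \<bar>cf_denom \<omega> (Suc n) + cf_denom \<omega> n * frac (cf_remainder \<omega> (Suc n))\<bar>"
  proof -
    have "0 \<le> real_of_int (cf_denom \<omega> n) * frac (cf_remainder \<omega> (Suc n))"
      using q frac_cf_remainder[of "Suc n"] by (intro mult_nonneg_nonneg) auto
    then show ?thesis using q by linarith
  qed
  ultimately have "\<bar>d n\<bar> * cf_denom \<omega> n \<le> 1"
    by (metis abs_ge_zero mult_left_mono)
  moreover have "\<omega> - cf_numer \<omega> n / cf_denom \<omega> n = d n / cf_denom \<omega> n"
    using q by (simp add: d_def field_simps)
  ultimately show ?thesis
    using q by (simp add: power2_eq_square field_simps)
qed

end


section \<open>Products of unimodular matrices\<close>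

definition wedge :: "complex^2 \<Rightarrow> complex^2 \<Rightarrow> complex" where
  "wedge x y = x $ 1 * y $ 2 - x $ 2 * y $ 1"

definition opnorm :: "complex^2^2 \<Rightarrow> real" where
  "opnorm A = onorm ((*v) A)"

lemma norm2_sq: "(norm (v :: complex^2))\<^sup>2 = (cmod (v $ 1))\<^sup>2 + (cmod (v $ 2))\<^sup>2"
  by (simp add: norm_vec_def L2_set_def sum_2)

lemma norm_axis_complex: "norm (axis i 1 :: complex^2) = 1"
proof -
  have "(norm (axis i 1 :: complex^2))\<^sup>2 = 1\<^sup>2"
    unfolding norm2_sq using exhaust_2[of i] by (auto simp: axis_def)
  then show ?thesis by simp
qed

lemma matrix_vector_2:
  "((A :: complex^2^2) *v v) $ 1 = A $ 1 $ 1 * v $ 1 + A $ 1 $ 2 * v $ 2"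
  "(A *v v) $ 2 = A $ 2 $ 1 * v $ 1 + A $ 2 $ 2 * v $ 2"
  by (simp_all add: matrix_vector_mult_def sum_2)

lemma wedge_mult: "wedge (A *v x) (A *v y) = det A * wedge x y"
  by (simp add: wedge_def matrix_vector_2 det_2 algebra_simps)

lemma wedge_le: "cmod (wedge x y) \<le> norm x * norm y"
proof (rule power2_le_imp_le)
  have "cmod (wedge x y) \<le> cmod (x $ 1) * cmod (y $ 2) + cmod (x $ 2) * cmod (y $ 1)"
    unfolding wedge_def by (rule order_trans[OF norm_triangle_ineq4]) (simp add: norm_mult)
  then have "(cmod (wedge x y))\<^sup>2 \<le> (cmod (x $ 1) * cmod (y $ 2) + cmod (x $ 2) * cmod (y $ 1))\<^sup>2"
    by (intro power_mono) auto
  also have "\<dots> = ((cmod (x $ 1))\<^sup>2 + (cmod (x $ 2))\<^sup>2) * ((cmod (y $ 1))\<^sup>2 + (cmod (y $ 2))\<^sup>2)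
      - (cmod (x $ 1) * cmod (y $ 1) - cmod (x $ 2) * cmod (y $ 2))\<^sup>2"
    by (simp add: power2_eq_square algebra_simps)
  also have "\<dots> \<le> (norm x * norm y)\<^sup>2" by (simp add: norm2_sq power_mult_distrib)
  finally show "(cmod (wedge x y))\<^sup>2 \<le> (norm x * norm y)\<^sup>2" .
qed auto

lemma norm_smult2: "norm (c *s (v :: complex^2)) = cmod c * norm v"
proof -
  have "(norm (c *s v))\<^sup>2 = (cmod c * norm v)\<^sup>2"
    by (simp add: norm2_sq power_mult_distrib norm_mult algebra_simps)
  then show ?thesis by simp
qed

lemma opnorm_le: "norm (A *v v) \<le> opnorm A * norm v"
  unfolding opnorm_def by (rule onorm) auto

lemma opnorm_nonneg: "0 \<le> opnorm A"
  unfolding opnorm_def by (rule onorm_pos_le) auto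

lemma opnorm_mult: "opnorm (A ** B) \<le> opnorm A * opnorm B"
  unfolding opnorm_def
  using onorm_compose[of "(*v) A" "(*v) B"] by (simp add: o_def matrix_vector_mul_assoc)

lemma opnorm_attained: "\<exists>v. norm v = 1 \<and> norm (A *v v) = opnorm A"
proof -
  have "\<exists>v\<in>sphere 0 1. \<forall>w\<in>sphere (0 :: complex^2) 1. norm (A *v w) \<le> norm (A *v v)"
  proof (intro continuous_attains_sup compact_sphere)
    have "axis 1 1 \<in> sphere (0 :: complex^2) 1" by (simp add: norm_axis_complex)
    then show "sphere (0 :: complex^2) 1 \<noteq> {}" by blast
    show "continuous_on (sphere 0 1) (\<lambda>w. norm (A *v w))"
      by (intro continuous_on_norm linear_continuous_on matrix_vector_mul_bounded_linear)
  qed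
  then obtain v where v: "norm v = 1" "\<And>w. norm w = 1 \<Longrightarrow> norm (A *v w) \<le> norm (A *v v)" by auto
  have "opnorm A \<le> norm (A *v v)"
    unfolding opnorm_def
  proof (rule onorm_le)
    fix w
    show "norm (A *v w) \<le> norm (A *v v) * norm w"
    proof (cases "w = 0")
      case False
      have "norm (A *v (inverse (norm w) *\<^sub>R w)) \<le> norm (A *v v)" using False by (intro v(2)) simp
      moreover have "A *v (inverse (norm w) *\<^sub>R w) = inverse (norm w) *\<^sub>R (A *v w)"
        using linear_scale[OF bounded_linear.linear[OF matrix_vector_mul_bounded_linear]] .
      ultimately show ?thesis using False by (simp add: field_simps)
    qed simp
  qed
  then show ?thesis using v(1) opnorm_le[of A v] by (intro exI[of _ v]) simp
qed

lemma opnorm_ge_1: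
  assumes "det A = 1"
  shows "1 \<le> opnorm A"
proof -
  have "1 = cmod (wedge (axis 1 1) (axis 2 1))" by (simp add: wedge_def axis_def)
  also have "\<dots> = cmod (wedge (A *v axis 1 1) (A *v axis 2 1))" by (simp add: wedge_mult assms)
  also have "\<dots> \<le> norm (A *v axis 1 1) * norm (A *v axis 2 1)" by (rule wedge_le)
  also have "\<dots> \<le> (opnorm A * norm (axis 1 1 :: complex^2)) * (opnorm A * norm (axis 2 1 :: complex^2))"
    by (intro mult_mono opnorm_le mult_nonneg_nonneg opnorm_nonneg) auto
  also have "\<dots> = (opnorm A)\<^sup>2" by (simp add: norm_axis_complex power2_eq_square)
  finally show ?thesis using opnorm_nonneg[of A] power2_le_imp_le[of 1 "opnorm A"] by simp
qed

lemma opnorm_mat_1: "opnorm (mat 1) = 1"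
proof (rule antisym)
  show "opnorm (mat 1) \<le> 1" unfolding opnorm_def by (rule onorm_le) simp
  show "1 \<le> opnorm (mat 1)" by (rule opnorm_ge_1) simp
qed

lemma opnorm_triangle: "opnorm (A + B) \<le> opnorm A + opnorm B"
proof -
  have "(*v) (A + B) = (\<lambda>x. A *v x + B *v x)"
    by (simp add: fun_eq_iff matrix_vector_mult_add_rdistrib)
  then show ?thesis unfolding opnorm_def using onorm_triangle[of "(*v) A" "(*v) B"] by simp
qed

lemma opnorm_diff_triangle: "\<bar>opnorm A - opnorm B\<bar> \<le> opnorm (A - B)"
proof -
  have "(*v) (B - A) = (\<lambda>x. - ((A - B) *v x))"
    by (simp add: fun_eq_iff matrix_vector_mult_diff_rdistrib)
  then have "opnorm (B - A) = opnorm (A - B)"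
    unfolding opnorm_def using onorm_neg[of "(*v) (A - B)"] by simp
  then show ?thesis using opnorm_triangle[of "A - B" B] opnorm_triangle[of "B - A" A] by simp
qed

lemma orthogonal_vector2:
  fixes w :: "complex^2"
  defines "r \<equiv> vector [- cnj (w $ 2), cnj (w $ 1)]"
  shows "norm r = norm w" "wedge w r = of_real ((norm w)\<^sup>2)"
proof -
  have "(norm r)\<^sup>2 = (norm w)\<^sup>2" unfolding norm2_sq by (simp add: r_def vector_2)
  then show "norm r = norm w" by simp
  show "wedge w r = of_real ((norm w)\<^sup>2)"
    unfolding norm2_sq of_real_add complex_norm_square by (simp add: r_def wedge_def vector_2)
qed

text \<open>Stands in for the singular value decomposition. For u realizing the norm take r
  orthogonal to A u with |r| = |A u|, and let x be its preimage. Determinant one gives |wedge u x| =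
  |wedge (A u) r| = |A|^2, so x has length at least |A|^2 while its image has length |A|.\<close>

lemma contracted_vector:
  assumes det: "det A = 1"
  shows "\<exists>v. norm v = 1 \<and> norm (A *v v) \<le> 1 / opnorm A"
proof -
  obtain u where u: "norm u = 1" "norm (A *v u) = opnorm A" using opnorm_attained by blast
  define w where "w = A *v u"
  define r where "r = (vector [- cnj (w $ 2), cnj (w $ 1)] :: complex^2)"
  \<comment> \<open>The adjugate of A applied to r, which is the preimage of r since the determinant
    is one.\<close>
  define x where "x = (vector [A $ 2 $ 2 * r $ 1 - A $ 1 $ 2 * r $ 2, A $ 1 $ 1 * r $ 2 - A $ 2 $ 1 * r $ 1] :: complex^2)"
  have A1: "opnorm A \<ge> 1" using opnorm_ge_1[OF det] .
  have D: "A $ 1 $ 1 * A $ 2 $ 2 = 1 + A $ 1 $ 2 * A $ 2 $ 1" using det unfolding det_2 by (simp add: diff_eq_eq)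
  have Ax: "A *v x = r"
  proof -
    have "(A *v x) $ 1 = (A $ 1 $ 1 * A $ 2 $ 2) * r $ 1 - A $ 1 $ 2 * A $ 2 $ 1 * r $ 1"
      "(A *v x) $ 2 = (A $ 1 $ 1 * A $ 2 $ 2) * r $ 2 - A $ 1 $ 2 * A $ 2 $ 1 * r $ 2"
      by (simp_all add: matrix_vector_2 x_def vector_2 algebra_simps)
    then show ?thesis unfolding D by (simp add: vec_eq_iff forall_2 algebra_simps)
  qed
  have "wedge u x = of_real ((opnorm A)\<^sup>2)"
    using wedge_mult[of A u x] orthogonal_vector2(2)[of w] u by (simp add: det Ax w_def[symmetric] r_def)
  then have "(opnorm A)\<^sup>2 \<le> norm x" using wedge_le[of u x] u by (simp add: norm_power)
  then have x: "opnorm A * opnorm A \<le> norm x" by (simp add: power2_eq_square)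
  have "norm x > 0" using x A1 mult_mono[of 1 "opnorm A" 1 "opnorm A"] by linarith
  have "A *v (inverse (norm x) *\<^sub>R x) = inverse (norm x) *\<^sub>R r"
    unfolding Ax[symmetric] using linear_scale[OF bounded_linear.linear[OF matrix_vector_mul_bounded_linear]] .
  then have "norm (A *v (inverse (norm x) *\<^sub>R x)) = opnorm A / norm x"
    using orthogonal_vector2(1)[of w] u by (simp add: r_def w_def divide_inverse mult.commute)
  also have "\<dots> \<le> 1 / opnorm A" using x A1 \<open>norm x > 0\<close> by (simp add: field_simps)
  finally show ?thesis using \<open>norm x > 0\<close> by (intro exI[of _ "inverse (norm x) *\<^sub>R x"]) simp
qed

text \<open>Read from right to left, unit data at the far end shrink by the factor |A|. This serves
  the sites to the right of the source, where the block is crossed backwards.\<close>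

lemma expanded_vector:
  assumes det: "det A = 1"
  shows "\<exists>v. norm v = 1 / opnorm A \<and> norm (A *v v) = 1"
proof -
  obtain u where u: "norm u = 1" "norm (A *v u) = opnorm A" using opnorm_attained by blast
  have A1: "opnorm A \<ge> 1" using opnorm_ge_1[OF det] .
  have "A *v (inverse (opnorm A) *\<^sub>R u) = inverse (opnorm A) *\<^sub>R (A *v u)"
    using linear_scale[OF bounded_linear.linear[OF matrix_vector_mul_bounded_linear]] .
  then show ?thesis using u A1
    by (intro exI[of _ "inverse (opnorm A) *\<^sub>R u"]) (simp add: divide_inverse)
qed

text \<open>A cone is mapped into the cone of the next factor. Since B A loses at most the factor
  \<eta>, some a = A u satisfies |B a| \<ge> \<eta> |B| |a|. The part of A v off the line of a is
  controlled by the invariant area wedge (A v) (A u), of size at most |v|, and is tiny next to A v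
  because A expands v. So B expands A v almost as well as a.\<close>

lemma avalanche_step:
  assumes det: "det A = 1" and \<eta>: "\<eta> > 0"
    and BA: "opnorm (B ** A) \<ge> \<eta> * opnorm B * opnorm A"
    and large: "(opnorm A)\<^sup>2 \<ge> 8 / \<eta> ^ 3"
    and v: "norm (A *v v) \<ge> \<eta> / 2 * opnorm A * norm v"
  shows "norm (B *v (A *v v)) \<ge> \<eta> / 2 * opnorm B * norm (A *v v)"
proof (cases "opnorm B = 0")
  case False
  define nB where "nB = opnorm B"
  define nA where "nA = opnorm A"
  have nB: "nB > 0" using False opnorm_nonneg[of B] by (simp add: nB_def)
  have nA: "nA \<ge> 1" unfolding nA_def by (rule opnorm_ge_1[OF det])
  have "\<eta> * (nB * nA) \<le> 1 * (nB * nA)"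
    using BA opnorm_mult[of B A] by (simp add: nA_def nB_def mult_ac)
  then have \<eta>1: "\<eta> \<le> 1" using nA nB by (simp add: mult_le_cancel_right)
  obtain u where u: "norm u = 1" "norm ((B ** A) *v u) = opnorm (B ** A)"
    using opnorm_attained by blast
  define a where "a = A *v u"
  define b where "b = A *v v"
  have Ba: "norm (B *v a) \<ge> \<eta> * nB * nA"
    using u BA by (simp add: a_def matrix_vector_mul_assoc nA_def nB_def)
  have "norm a \<le> nA" using opnorm_le[of A u] u by (simp add: a_def nA_def)
  then have Ba': "norm (B *v a) \<ge> \<eta> * nB * norm a"
    using Ba \<eta> nB by (elim order_trans[rotated]) (intro mult_left_mono; simp)
  have "\<eta> * nB * nA \<le> nB * norm a"
    using Ba opnorm_le[of B a] by (simp add: nB_def)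
  then have a: "\<eta> * nA \<le> norm a" using nB by (simp add: mult.assoc mult.left_commute[of \<eta>])
  have a0: "norm a > 0" using a \<eta> nA mult_pos_pos[of \<eta> nA] by linarith
  define W where "W = wedge b a"
  \<comment> \<open>b is split along a and along the orthogonal vector c; the coefficient of c is
    the area W divided by |a|^2.\<close>
  define l where "l = (b $ 1 * cnj (a $ 1) + b $ 2 * cnj (a $ 2)) / of_real ((norm a)\<^sup>2)"
  define c where "c = (vector [cnj (a $ 2), - cnj (a $ 1)] :: complex^2)"
  define r where "r = (W / of_real ((norm a)\<^sup>2)) *s c"
  have W: "cmod W \<le> norm v"
    unfolding W_def a_def b_def wedge_mult det using wedge_le[of v u] u by simp
  have sq: "complex_of_real ((norm a)\<^sup>2) = a $ 1 * cnj (a $ 1) + a $ 2 * cnj (a $ 2)"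
    unfolding norm2_sq of_real_add complex_norm_square by simp
  have dec: "b = l *s a + r"
  proof -
    have nz: "complex_of_real ((norm a)\<^sup>2) \<noteq> 0" using a0 by simp
    have "b $ i = l * a $ i + (W / of_real ((norm a)\<^sup>2)) * c $ i" for i
    proof -
      have "complex_of_real ((norm a)\<^sup>2) * b $ i = (b $ 1 * cnj (a $ 1) + b $ 2 * cnj (a $ 2)) * a $ i + W * c $ i"
        unfolding sq using exhaust_2[of i]
        by (auto simp: W_def wedge_def c_def vector_2 algebra_simps)
      then show ?thesis using nz unfolding l_def by (simp add: field_simps)
    qed
    then show ?thesis by (simp add: vec_eq_iff r_def)
  qed
  have "norm c = norm a"
  proof -
    have "(norm c)\<^sup>2 = (norm a)\<^sup>2" unfolding norm2_sq by (simp add: c_def vector_2)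
    then show ?thesis by simp
  qed
  then have r: "norm r = cmod W / norm a"
    using a0 by (simp add: r_def norm_smult2 norm_divide norm_mult power2_eq_square)
  have "norm r * (\<eta> * nA) \<le> norm r * norm a" using a by (intro mult_left_mono) auto
  also have "\<dots> = cmod W" using r a0 by simp
  finally have r1: "norm r * (\<eta> * nA) \<le> norm v" using W by simp
  have "norm r * (\<eta> * nA) * (\<eta> / 2 * nA) \<le> norm v * (\<eta> / 2 * nA)"
    using r1 \<eta> nA by (intro mult_right_mono) auto
  also have "\<dots> \<le> norm b" using v by (simp add: b_def nA_def mult_ac)
  finally have r2: "norm r * (\<eta>\<^sup>2 / 2 * nA\<^sup>2) \<le> norm b" by (simp add: power2_eq_square mult_ac)
  \<comment> \<open>The assumed 8 / \<eta>^3 makes the off-line part r at most \<eta> / 4 of b. It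
    is lost once with the factor \<eta> nB and once with nB, and \<eta> - 2 (\<eta> / 4) = \<eta> /
    2 remains.\<close>
  have "\<eta>\<^sup>2 / 2 * (8 / \<eta> ^ 3) \<le> \<eta>\<^sup>2 / 2 * nA\<^sup>2"
    using large by (intro mult_left_mono) (auto simp: nA_def)
  then have "4 / \<eta> \<le> \<eta>\<^sup>2 / 2 * nA\<^sup>2" using \<eta> by (simp add: power2_eq_square power3_eq_cube field_simps)
  then have "norm r * (4 / \<eta>) \<le> norm r * (\<eta>\<^sup>2 / 2 * nA\<^sup>2)" by (intro mult_left_mono) auto
  then have "norm r * (4 / \<eta>) \<le> norm b" using r2 by linarith
  then have r3: "norm r \<le> \<eta> / 4 * norm b" using \<eta> by (simp add: field_simps)
  have "norm (l *s a) \<ge> norm b - norm r" using norm_triangle_ineq[of "l *s a" r] dec by simp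
  then have "\<eta> * nB * (norm b - norm r) \<le> \<eta> * nB * norm (l *s a)"
    using \<eta> nB by (intro mult_left_mono) auto
  also have "\<dots> = cmod l * (\<eta> * nB * norm a)" by (simp add: norm_smult2)
  also have "\<dots> \<le> cmod l * norm (B *v a)" using Ba' by (intro mult_left_mono) auto
  also have "\<dots> = norm (B *v (l *s a))" by (simp add: vector_scalar_commute norm_smult2)
  also have "\<dots> \<le> norm (B *v b) + norm (B *v r)"
  proof -
    have "B *v (l *s a) = B *v b - B *v r" by (simp add: dec matrix_vector_right_distrib)
    then show ?thesis using norm_triangle_ineq4 by metis
  qed
  also have "norm (B *v r) \<le> nB * norm r" unfolding nB_def by (rule opnorm_le)
  finally have 1: "\<eta> * nB * norm b - \<eta> * nB * norm r - nB * norm r \<le> norm (B *v b)"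
    by (simp add: algebra_simps)
  have "\<eta> * (nB * norm r) \<le> 1 * (nB * norm r)" using \<eta>1 nB by (intro mult_right_mono) auto
  moreover have "nB * norm r \<le> nB * (\<eta> / 4 * norm b)" using r3 nB by (intro mult_left_mono) auto
  ultimately have "\<eta> / 2 * nB * norm b \<le> norm (B *v b)" using 1 by (simp add: algebra_simps)
  then show ?thesis by (simp add: nB_def b_def)
qed simp

primrec matrix_chain :: "(nat \<Rightarrow> complex^2^2) \<Rightarrow> nat \<Rightarrow> complex^2^2" where
  "matrix_chain A 0 = mat 1"
| "matrix_chain A (Suc k) = A k ** matrix_chain A k"

text \<open>The expansion rate \<eta> / 2 is reproduced by each step, so the loss per factor is the
  same for every R. The orbit starts at a vector realizing the norm of \<open>A 0\<close>.\<close>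

lemma avalanche:
  fixes A :: "nat \<Rightarrow> complex^2^2"
  assumes det: "\<And>j. j < R \<Longrightarrow> det (A j) = 1" and \<eta>: "0 < \<eta>" "\<eta> \<le> 1"
    and pair: "\<And>j. Suc j < R \<Longrightarrow> opnorm (A (Suc j) ** A j) \<ge> \<eta> * opnorm (A (Suc j)) * opnorm (A j)"
    and large: "\<And>j. j < R \<Longrightarrow> (opnorm (A j))\<^sup>2 \<ge> 8 / \<eta> ^ 3"
    and \<mu>: "\<mu> \<ge> 0" "\<And>j. j < R \<Longrightarrow> \<mu> \<le> \<eta> / 2 * opnorm (A j)"
  shows "opnorm (matrix_chain A R) \<ge> \<mu> ^ R"
proof -
  obtain v where v: "norm v = 1" "norm (A 0 *v v) = opnorm (A 0)" using opnorm_attained by blast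
  have step: "norm (A k *v (matrix_chain A k *v v)) \<ge> \<eta> / 2 * opnorm (A k) * norm (matrix_chain A k *v v)"
    if "k < R" for k
    using that
  proof (induction k)
    case 0
    have "\<eta> / 2 * opnorm (A 0) \<le> 1 * opnorm (A 0)"
      using \<eta> by (intro mult_right_mono opnorm_nonneg) auto
    then show ?case using v by simp
  next
    case (Suc k)
    then show ?case
      using avalanche_step[of "A k" \<eta> "A (Suc k)" "matrix_chain A k *v v"] det[of k] \<eta> pair[of k] large[of k]
      by (simp add: matrix_vector_mul_assoc)
  qed
  have "norm (matrix_chain A k *v v) \<ge> \<mu> ^ k" if "k \<le> R" for k
    using that
  proof (induction k)
    case 0
    then show ?case using v by simp
  next
    case (Suc k)
    have "\<mu> ^ Suc k \<le> \<eta> / 2 * opnorm (A k) * norm (matrix_chain A k *v v)"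
      unfolding power_Suc using Suc \<mu> \<eta> opnorm_nonneg[of "A k"] by (intro mult_mono) auto
    also have "\<dots> \<le> norm (matrix_chain A (Suc k) *v v)"
      using step[of k] Suc by (simp add: matrix_vector_mul_assoc)
    finally show ?case .
  qed
  then show ?thesis using opnorm_le[of "matrix_chain A R" v] v(1) by (metis mult.right_neutral order_refl order_trans)
qed

text \<open>Unimodular matrices have norm at least 1, and ln is 1-Lipschitz there.\<close>

lemma ln_opnorm_diff:
  assumes "det A = 1" "det B = 1"
  shows "\<bar>ln (opnorm A) - ln (opnorm B)\<bar> \<le> opnorm (A - B)"
proof -
  have *: "ln x - ln y \<le> \<bar>x - y\<bar>" if "1 \<le> x" "1 \<le> y" for x y :: real
  proof -
    have "ln x - ln y = ln (x / y)" using that by (simp add: ln_div)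
    also have "\<dots> \<le> x / y - 1" using that by (intro ln_le_minus_one) auto
    also have "\<dots> = (x - y) / y" using that by (simp add: field_simps)
    also have "\<dots> \<le> \<bar>x - y\<bar> / 1" using that by (intro frac_le) auto
    finally show ?thesis by simp
  qed
  show ?thesis
    using *[OF opnorm_ge_1[OF assms(1)] opnorm_ge_1[OF assms(2)]]
      *[OF opnorm_ge_1[OF assms(2)] opnorm_ge_1[OF assms(1)]] opnorm_diff_triangle[of A B] by linarith
qed


section \<open>Transfer matrices\<close>

lemma det_transfer_matrix: "det (transfer_matrix f z \<theta>) = 1"
  by (simp add: transfer_matrix_def det_2)

lemma det_cocycle: "det (cocycle f \<omega> z k \<theta>) = 1"
  by (induction k) (simp_all add: det_mul det_transfer_matrix)

lemma cocycle_add: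
  "cocycle f \<omega> z (m + k) \<theta> = cocycle f \<omega> z k (\<theta> + real m * \<omega>) ** cocycle f \<omega> z m \<theta>"
proof (induction k)
  case (Suc k)
  have eq: "\<theta> + real (m + k) * \<omega> = \<theta> + real m * \<omega> + real k * \<omega>" by (simp add: algebra_simps)
  show ?case unfolding add_Suc_right cocycle.simps Suc.IH matrix_mul_assoc eq ..
qed simp

lemma opnorm_transfer_matrix_le: "opnorm (transfer_matrix f z \<theta>) \<le> cmod z + \<bar>f \<theta>\<bar> + 2"
  unfolding opnorm_def
proof (rule onorm_le)
  fix v :: "complex^2"
  let ?w = "transfer_matrix f z \<theta> *v v"
  have c: "cmod (v $ i) \<le> norm v" for i by (rule Finite_Cartesian_Product.norm_nth_le)
  have "(norm ?w)\<^sup>2 \<le> (cmod (?w $ 1) + cmod (?w $ 2))\<^sup>2"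
    unfolding norm2_sq by (simp add: power2_sum)
  then have "norm ?w \<le> cmod (?w $ 1) + cmod (?w $ 2)"
    by (rule power2_le_imp_le) auto
  also have "\<dots> = cmod ((z - of_real (f \<theta>)) * v $ 1 - v $ 2) + cmod (v $ 1)"
    by (simp add: matrix_vector_2 transfer_matrix_def)
  also have "\<dots> \<le> (cmod z + \<bar>f \<theta>\<bar>) * cmod (v $ 1) + cmod (v $ 2) + cmod (v $ 1)"
  proof -
    have "cmod (z - of_real (f \<theta>)) \<le> cmod z + \<bar>f \<theta>\<bar>" by (rule order_trans[OF norm_triangle_ineq4]) simp
    then have "cmod ((z - of_real (f \<theta>)) * v $ 1) \<le> (cmod z + \<bar>f \<theta>\<bar>) * cmod (v $ 1)"
      unfolding norm_mult by (intro mult_right_mono) auto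
    then show ?thesis using norm_triangle_ineq4[of "(z - of_real (f \<theta>)) * v $ 1" "v $ 2"] by linarith
  qed
  also have "\<dots> \<le> (cmod z + \<bar>f \<theta>\<bar>) * norm v + norm v + norm v"
    by (intro add_mono mult_left_mono c) auto
  finally show "norm ?w \<le> (cmod z + \<bar>f \<theta>\<bar> + 2) * norm v" by (simp add: algebra_simps)
qed

lemma opnorm_transfer_matrix_diff_le:
  "opnorm (transfer_matrix f z \<theta> - transfer_matrix f z' \<theta>') \<le> cmod (z - z') + \<bar>f \<theta> - f \<theta>'\<bar>"
  unfolding opnorm_def
proof (rule onorm_le)
  fix v :: "complex^2"
  let ?w = "(transfer_matrix f z \<theta> - transfer_matrix f z' \<theta>') *v v"
  have "?w $ 1 = (z - z' - of_real (f \<theta> - f \<theta>')) * v $ 1" "?w $ 2 = 0"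
    by (simp_all add: matrix_vector_2 transfer_matrix_def algebra_simps)
  then have "(norm ?w)\<^sup>2 = (cmod (z - z' - of_real (f \<theta> - f \<theta>')) * cmod (v $ 1))\<^sup>2"
    unfolding norm2_sq by (simp add: norm_mult)
  then have "norm ?w = cmod (z - z' - of_real (f \<theta> - f \<theta>')) * cmod (v $ 1)" by simp
  also have "\<dots> \<le> (cmod (z - z') + \<bar>f \<theta> - f \<theta>'\<bar>) * norm v"
  proof (rule mult_mono)
    show "cmod (z - z' - of_real (f \<theta> - f \<theta>')) \<le> cmod (z - z') + \<bar>f \<theta> - f \<theta>'\<bar>"
      by (rule order_trans[OF norm_triangle_ineq4]) (simp del: of_real_diff)
  qed (auto intro: Finite_Cartesian_Product.norm_nth_le)
  finally show "norm ?w \<le> (cmod (z - z') + \<bar>f \<theta> - f \<theta>'\<bar>) * norm v" .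
qed

definition log_norm :: "(real \<Rightarrow> real) \<Rightarrow> real \<Rightarrow> complex \<Rightarrow> nat \<Rightarrow> real \<Rightarrow> real" where
  "log_norm f \<omega> z k \<theta> = ln (opnorm (cocycle f \<omega> z k \<theta>))"

lemma opnorm_cocycle: "opnorm (cocycle f \<omega> z k \<theta>) = exp (log_norm f \<omega> z k \<theta>)"
  using opnorm_ge_1[OF det_cocycle, of f \<omega> z k \<theta>] by (simp add: log_norm_def)

lemma log_norm_nonneg: "0 \<le> log_norm f \<omega> z k \<theta>"
  using opnorm_ge_1[OF det_cocycle, of f \<omega> z k \<theta>] by (simp add: log_norm_def)

lemma log_norm_0 [simp]: "log_norm f \<omega> z 0 \<theta> = 0"
  by (simp add: log_norm_def opnorm_mat_1)

lemma log_norm_add_le: "log_norm f \<omega> z (m + k) \<theta> \<le> log_norm f \<omega> z m \<theta> + log_norm f \<omega> z k (\<theta> + real m * \<omega>)"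
proof -
  have "exp (log_norm f \<omega> z (m + k) \<theta>) \<le> exp (log_norm f \<omega> z k (\<theta> + real m * \<omega>)) * exp (log_norm f \<omega> z m \<theta>)"
    unfolding opnorm_cocycle[symmetric] cocycle_add by (rule opnorm_mult)
  then show ?thesis by (simp flip: exp_add)
qed

locale bounded_potential =
  fixes f :: "real \<Rightarrow> real" and F :: real
  assumes f_bound: "\<bar>f x\<bar> \<le> F"
begin

lemma F_nonneg: "0 \<le> F" using f_bound[of 0] by linarith

lemma opnorm_cocycle_le:
  assumes "cmod z + F + 2 \<le> \<Lambda>"
  shows "opnorm (cocycle f \<omega> z k \<theta>) \<le> \<Lambda> ^ k"
proof (induction k)
  case 0
  show ?case by (simp add: opnorm_mat_1)
next
  case (Suc k)
  have "opnorm (cocycle f \<omega> z (Suc k) \<theta>) \<le> opnorm (transfer_matrix f z (\<theta> + real k * \<omega>)) * opnorm (cocycle f \<omega> z k \<theta>)"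
    by (simp add: opnorm_mult)
  also have "\<dots> \<le> \<Lambda> * \<Lambda> ^ k"
  proof (intro mult_mono)
    show "opnorm (transfer_matrix f z (\<theta> + real k * \<omega>)) \<le> \<Lambda>"
      using opnorm_transfer_matrix_le[of f z "\<theta> + real k * \<omega>"] f_bound[of "\<theta> + real k * \<omega>"] assms by linarith
    show "0 \<le> \<Lambda>" using F_nonneg norm_ge_zero[of z] assms by linarith
  qed (use Suc opnorm_nonneg in auto)
  finally show ?case by simp
qed

lemma log_norm_le:
  assumes "cmod z + F + 2 \<le> \<Lambda>"
  shows "log_norm f \<omega> z k \<theta> \<le> k * ln \<Lambda>"
proof -
  have "\<Lambda> > 0" using assms F_nonneg norm_ge_zero[of z] by linarith
  then have "ln (opnorm (cocycle f \<omega> z k \<theta>)) \<le> ln (\<Lambda> ^ k)"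
    using opnorm_cocycle_le[OF assms] opnorm_ge_1[OF det_cocycle, of f \<omega> z k \<theta>] by (subst ln_le_cancel_iff) (auto intro: less_le_trans)
  then show ?thesis using \<open>\<Lambda> > 0\<close> by (simp add: log_norm_def ln_realpow)
qed

text \<open>Telescoping over the factors: each term changes one transfer matrix and is multiplied by
  at most \<Lambda> for each of the others. The energies vary for the passage to nearby real or
  complex energies, the phases for the comparison of orbits.\<close>

lemma cocycle_diff_le:
  assumes z: "cmod z + F + 2 \<le> \<Lambda>" "cmod z' + F + 2 \<le> \<Lambda>"
  shows "opnorm (cocycle f \<omega> z k \<theta> - cocycle f \<omega> z' k \<theta>')
    \<le> \<Lambda> ^ k * (\<Sum>j<k. cmod (z - z') + \<bar>f (\<theta> + real j * \<omega>) - f (\<theta>' + real j * \<omega>)\<bar>)"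
proof (induction k)
  case 0
  have "(*v) (0 :: complex^2^2) = (\<lambda>v. 0)" by (simp add: fun_eq_iff)
  then have "opnorm 0 = 0" by (simp add: opnorm_def onorm_zero)
  then show ?case by simp
next
  case (Suc k)
  define T T' A A' where "T = transfer_matrix f z (\<theta> + real k * \<omega>)" and "T' = transfer_matrix f z' (\<theta>' + real k * \<omega>)"
    and "A = cocycle f \<omega> z k \<theta>" and "A' = cocycle f \<omega> z' k \<theta>'"
  define d where "d j = cmod (z - z') + \<bar>f (\<theta> + real j * \<omega>) - f (\<theta>' + real j * \<omega>)\<bar>" for j
  have L: "\<Lambda> \<ge> 1" using z F_nonneg norm_ge_zero[of z] by linarith
  have d: "0 \<le> d j" for j by (simp add: d_def)
  have "T ** A - T' ** A' = T ** (A - A') + (T - T') ** A'"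
  proof -
    have "((T ** A - T' ** A') *v v) = ((T ** (A - A') + (T - T') ** A') *v v)" for v
      by (simp add: matrix_vector_mult_add_rdistrib matrix_vector_mult_diff_rdistrib
          matrix_vector_mult_diff_distrib flip: matrix_vector_mul_assoc)
    then show ?thesis by (simp add: matrix_eq)
  qed
  then have "opnorm (T ** A - T' ** A') \<le> opnorm T * opnorm (A - A') + opnorm (T - T') * opnorm A'"
    using opnorm_triangle[of "T ** (A - A')" "(T - T') ** A'"] opnorm_mult[of T "A - A'"] opnorm_mult[of "T - T'" A']
    by simp
  also have "opnorm T * opnorm (A - A') \<le> \<Lambda> * (\<Lambda> ^ k * (\<Sum>j<k. d j))"
  proof (rule mult_mono)
    show "opnorm T \<le> \<Lambda>"
      using opnorm_transfer_matrix_le[of f z "\<theta> + real k * \<omega>"] f_bound[of "\<theta> + real k * \<omega>"] z(1)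
      unfolding T_def by linarith
    show "opnorm (A - A') \<le> \<Lambda> ^ k * (\<Sum>j<k. d j)" using Suc by (simp add: A_def A'_def d_def)
  qed (use L opnorm_nonneg in auto)
  also have "opnorm (T - T') * opnorm A' \<le> d k * \<Lambda> ^ k"
    using opnorm_transfer_matrix_diff_le[of f z "\<theta> + real k * \<omega>" z' "\<theta>' + real k * \<omega>"]
      opnorm_cocycle_le[OF z(2), of \<omega> k \<theta>'] d opnorm_nonneg
    by (intro mult_mono) (auto simp: T_def T'_def A'_def d_def)
  also have "d k * \<Lambda> ^ k \<le> d k * \<Lambda> ^ Suc k"
    using L d by (intro mult_left_mono power_increasing) auto
  finally show ?case by (simp add: T_def T'_def A_def A'_def d_def algebra_simps)
qed

lemma log_norm_diff_le:
  assumes z: "cmod z + F + 2 \<le> \<Lambda>" "cmod z' + F + 2 \<le> \<Lambda>"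
  shows "\<bar>log_norm f \<omega> z k \<theta> - log_norm f \<omega> z' k \<theta>'\<bar>
    \<le> \<Lambda> ^ k * (\<Sum>j<k. cmod (z - z') + \<bar>f (\<theta> + real j * \<omega>) - f (\<theta>' + real j * \<omega>)\<bar>)"
  unfolding log_norm_def using ln_opnorm_diff[OF det_cocycle det_cocycle] cocycle_diff_le[OF z] by (rule order_trans)

end


section \<open>Lyapunov exponents of piecewise Hoelder potentials\<close>

lemma fekete:
  fixes a :: "nat \<Rightarrow> real"
  assumes sub: "\<And>m n. a (m + n) \<le> a m + a n" and nonneg: "\<And>n. 0 \<le> a n"
  shows "\<exists>L. (\<lambda>n. a n / n) \<longlonglongrightarrow> L \<and> (\<forall>n\<ge>1. L \<le> a n / n)"
proof -
  define S where "S = (\<lambda>n. a n / real n) ` {1..}"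
  have bdd: "bdd_below S" using nonneg by (auto simp: S_def intro!: bdd_belowI[of _ 0])
  have le: "Inf S \<le> a n / n" if "n \<ge> 1" for n
    using bdd that by (intro cInf_lower) (auto simp: S_def)
  have mult: "a (q * m + r) \<le> q * a m + a r" for q m r
  proof (induction q)
    case (Suc q)
    have "a (Suc q * m + r) \<le> a m + a (q * m + r)" using sub[of m "q * m + r"] by (simp add: add.assoc)
    also have "\<dots> \<le> Suc q * a m + a r" using Suc by (simp add: algebra_simps)
    finally show ?case .
  qed simp
  have "(\<lambda>n. a n / n) \<longlonglongrightarrow> Inf S"
  proof (rule LIMSEQ_I)
    fix e :: real assume e: "e > 0"
    have "S \<noteq> {}" by (auto simp: S_def)
    then obtain m where m: "m \<ge> 1" "a m / m < Inf S + e / 2"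
      using cInf_lessD[of S "Inf S + e / 2"] e by (auto simp: S_def)
    define M where "M = (\<Sum>r<m. a r)"
    obtain N where N: "2 * M / e < real N" using reals_Archimedean2 by blast
    show "\<exists>no. \<forall>n\<ge>no. norm (a n / n - Inf S) < e"
    proof (intro exI[of _ "Suc N"] allI impI)
      fix n assume n: "Suc N \<le> n"
      have "a (n mod m) \<le> M"
        unfolding M_def using m nonneg by (intro member_le_sum) auto
      then have "a n \<le> (n div m) * a m + M" using mult[of "n div m" m "n mod m"] by simp
      moreover have "real (n div m) * a m \<le> real n / real m * a m"
        using nonneg by (intro mult_right_mono of_nat_div_le_of_nat) auto
      ultimately have "a n / n \<le> (real n * (a m / m) + M) / n"
        using n by (intro divide_right_mono) auto
      also have "\<dots> = a m / m + M / n" using n by (simp add: add_divide_distrib)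
      also have "M / n < e / 2"
      proof -
        have "2 * M < e * N" using N e by (simp add: field_simps)
        also have "\<dots> \<le> e * n" using n e by (intro mult_left_mono) auto
        finally show ?thesis using n by (simp add: field_simps)
      qed
      finally have "a n / n < Inf S + e" using m by linarith
      moreover have "Inf S \<le> a n / n" using n by (intro le) simp
      ultimately show "norm (a n / n - Inf S) < e" by simp
    qed
  qed
  then show ?thesis using le by blast
qed

lemma periodic_integral_shift:
  fixes g :: "real \<Rightarrow> real"
  assumes per: "\<And>x. g (x + 1) = g x" and int: "\<And>a b. g integrable_on {a..b}"
  shows "integral {0..1} (\<lambda>y. g (y + c)) = integral {0..1} g"
proof -
  have shift: "integral {a..b} (\<lambda>y. g (y + d)) = integral {a + d..b + d} g" for a b d
  proof -
    have "(g has_integral integral {a + d..b + d} g) (cbox (a + d) (b + d))"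
      using int[of "a + d" "b + d"] by (simp add: integrable_integral)
    from has_integral_affinity[OF this, of 1 d]
    have "((\<lambda>y. g (y + d)) has_integral integral {a + d..b + d} g) {a..b}"
      by (simp add: image_diff_atLeastAtMost[of d, simplified diff_conv_add_uminus])
    then show ?thesis by (rule integral_unique)
  qed
  define d where "d = frac c"
  have d: "0 \<le> d" "d \<le> 1" unfolding d_def using frac_lt_1[of c] by (auto intro: less_imp_le)
  have "integral {0..1} (\<lambda>y. g (y + c)) = integral {0..1} (\<lambda>y. g (y + d))"
  proof (intro integral_cong)
    fix y
    have "g (y + d + of_int \<lfloor>c\<rfloor>) = g (y + d)" by (rule periodic_add_of_int[of g, OF per])
    then show "g (y + c) = g (y + d)" by (simp add: d_def frac_def)
  qed
  also have "\<dots> = integral {d..1 + d} g" using shift[of 0 1 d] by simp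
  also have "\<dots> = integral {d..1} g + integral {1..1 + d} g"
    using d by (intro Henstock_Kurzweil_Integration.integral_combine[symmetric] int) auto
  also have "integral {1..1 + d} g = integral {0..d} (\<lambda>y. g (y + 1))" using shift[of 0 d 1] by (simp add: add.commute)
  also have "\<dots> = integral {0..d} g" by (simp add: per)
  also have "integral {d..1} g + integral {0..d} g = integral {0..1} g"
    using Henstock_Kurzweil_Integration.integral_combine[of 0 d 1 g] d int by simp
  finally show ?thesis .
qed


text \<open>Stated for an arbitrary irrational number because it is applied to m \<omega>, the step
  of an orbit sampled at every m-th site.\<close>

lemma approximants:
  assumes "\<alpha> \<notin> \<rat>"
  shows "\<exists>q p. N \<le> q \<and> 0 < q \<and> coprime p (int q) \<and> \<bar>\<alpha> - real_of_int p / real q\<bar> \<le> 1 / real (q\<^sup>2)"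
proof -
  define q where "q = nat (cf_denom \<alpha> N)"
  have "cf_denom \<alpha> N \<ge> 1" "cf_denom \<alpha> N \<ge> int N" using cf_denom_pos[OF assms] cf_denom_ge[OF assms] by auto
  then have q: "int q = cf_denom \<alpha> N" "real q = real_of_int (cf_denom \<alpha> N)" "N \<le> q" "q > 0" by (auto simp: q_def)
  show ?thesis
  proof (intro exI conjI)
    show "coprime (cf_numer \<alpha> N) (int q)" unfolding q(1) by (rule cf_coprime[OF assms])
    show "\<bar>\<alpha> - real_of_int (cf_numer \<alpha> N) / real q\<bar> \<le> 1 / real (q\<^sup>2)"
      using cf_error[OF assms, of N] q(2) by simp
  qed (use q in auto)
qed

text \<open>The form of Hoelder continuity suited to orbit comparison; s stands for 1 / q. J is
  meant to hold representatives of the jumps modulo 1, hence the integer translates. The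
  displacement 3 s is the error of matched orbits; if x is 7 s away from the jumps, the lower of the
  two points is still more than 3 s away.\<close>

locale piecewise_potential = bounded_potential +
  fixes J :: "real set" and \<gamma> C :: real
  assumes periodic: "f (x + 1) = f x" and finite_J: "finite J" and gamma_pos: "\<gamma> > 0" and C_nonneg: "C \<ge> 0"
    and countable_jumps: "countable (jumps f)"
    and hoelder: "s > 0 \<Longrightarrow> \<bar>x - x'\<bar> \<le> 3 * s \<Longrightarrow> (\<And>a m. a \<in> J \<Longrightarrow> \<bar>x - a - of_int m\<bar> > 7 * s)
      \<Longrightarrow> \<bar>f x - f x'\<bar> \<le> C * (3 * s) powr \<gamma>"
begin

section \<open>Means and Birkhoff sums of the log norms\<close>

lemma cocycle_periodic: "cocycle f \<omega> z k (x + 1) = cocycle f \<omega> z k x"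
proof (induction k)
  case (Suc k)
  have "f (x + 1 + real k * \<omega>) = f (x + real k * \<omega>)" using periodic[of "x + real k * \<omega>"] by (simp add: add_ac)
  then show ?case using Suc by (simp add: transfer_matrix_def)
qed simp

lemma log_norm_periodic: "log_norm f \<omega> z k (x + 1) = log_norm f \<omega> z k x"
  by (simp add: log_norm_def cocycle_periodic)

text \<open>Each factor jumps only at a translate of a jump of \<open>f\<close>, so the function is
  continuous off a countable set.\<close>

lemma log_norm_measurable: "log_norm f \<omega> z k \<in> borel_measurable borel"
proof (rule borel_measurable_continuous_countable_exceptions)
  define X where "X = (\<Union>j<k. (\<lambda>x. x - real j * \<omega>) ` jumps f)"
  show "countable X" unfolding X_def using countable_jumps by auto
  define \<Lambda> where "\<Lambda> = cmod z + F + 2"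
  have "isCont (log_norm f \<omega> z k) x" if x: "x \<notin> X" for x
  proof -
    have cont: "isCont f (x + real j * \<omega>)" if "j < k" for j
    proof (rule ccontr)
      assume "\<not> isCont f (x + real j * \<omega>)"
      then have "x \<in> (\<lambda>x. x - real j * \<omega>) ` jumps f"
        by (intro image_eqI[of _ _ "x + real j * \<omega>"]) (auto simp: jumps_def)
      then show False using x that by (auto simp: X_def)
    qed
    have tend: "((\<lambda>x'. \<Lambda> ^ k * (\<Sum>j<k. cmod (z - z) + \<bar>f (x' + real j * \<omega>) - f (x + real j * \<omega>)\<bar>))
        \<longlongrightarrow> \<Lambda> ^ k * (\<Sum>j<k. cmod (z - z) + \<bar>f (x + real j * \<omega>) - f (x + real j * \<omega>)\<bar>)) (at x)"
    proof (intro tendsto_intros)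
      fix j assume "j \<in> {..<k}"
      then have "isCont f (x + real j * \<omega>)" using cont by simp
      then have "isCont (\<lambda>x'. f (x' + real j * \<omega>)) x" by (intro isCont_o2[of x "\<lambda>x. x + real j * \<omega>" f]) auto
      then show "((\<lambda>x'. f (x' + real j * \<omega>)) \<longlongrightarrow> f (x + real j * \<omega>)) (at x)" by (simp add: isCont_def)
    qed
    have "((\<lambda>x'. log_norm f \<omega> z k x' - log_norm f \<omega> z k x) \<longlongrightarrow> 0) (at x)"
    proof (rule Lim_null_comparison)
      show "\<forall>\<^sub>F x' in at x. norm (log_norm f \<omega> z k x' - log_norm f \<omega> z k x)
        \<le> \<Lambda> ^ k * (\<Sum>j<k. cmod (z - z) + \<bar>f (x' + real j * \<omega>) - f (x + real j * \<omega>)\<bar>)"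
        using log_norm_diff_le[of z \<Lambda> z \<omega> k _ x] by (intro always_eventually) (auto simp: \<Lambda>_def)
    qed (use tend in simp)
    then show ?thesis by (simp add: isCont_def LIM_zero_iff)
  qed
  then show "continuous_on (- X) (log_norm f \<omega> z k)"
    by (intro continuous_at_imp_continuous_on) auto
qed

definition mean_log :: "real \<Rightarrow> complex \<Rightarrow> nat \<Rightarrow> real" where
  "mean_log \<omega> z k = integral {0..1} (log_norm f \<omega> z k)"

lemma log_norm_set_integrable: "set_integrable lborel {a..b} (log_norm f \<omega> z k)"
proof (rule set_integrable_bound[of lborel "{a..b}" "\<lambda>_. k * ln (cmod z + F + 2)"])
  show "set_integrable lborel {a..b} (\<lambda>_. k * ln (cmod z + F + 2))"
    by (intro borel_integrable_atLeastAtMost' continuous_intros)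
  show "set_borel_measurable lborel {a..b} (log_norm f \<omega> z k)"
    unfolding set_borel_measurable_def using log_norm_measurable[of \<omega> z k] by measurable
  show "AE x in lborel. x \<in> {a..b} \<longrightarrow> norm (log_norm f \<omega> z k x) \<le> norm (k * ln (cmod z + F + 2))"
    using log_norm_le[of z "cmod z + F + 2" \<omega> k] log_norm_nonneg[of f \<omega> z k] by (intro AE_I2) (auto simp: abs_of_nonneg intro: order_trans[OF _ abs_ge_self])
qed

lemma log_norm_integrable: "log_norm f \<omega> z k integrable_on {a..b}"
  using set_borel_integral_eq_integral(1)[OF log_norm_set_integrable] .

lemma mean_log_shift: "integral {0..1} (\<lambda>y. log_norm f \<omega> z k (y + c)) = mean_log \<omega> z k"
  unfolding mean_log_def by (rule periodic_integral_shift[OF log_norm_periodic log_norm_integrable])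

lemma log_norm_shift_integrable: "(\<lambda>y. log_norm f \<omega> z k (y + c)) integrable_on {0..1}"
proof -
  have "(log_norm f \<omega> z k has_integral integral {c..1 + c} (log_norm f \<omega> z k)) (cbox c (1 + c))"
    using log_norm_integrable[of \<omega> z k c "1 + c"] by (simp add: integrable_integral)
  from has_integral_affinity[OF this, of 1 c]
  have "((\<lambda>y. log_norm f \<omega> z k (y + c)) has_integral integral {c..1 + c} (log_norm f \<omega> z k)) {0..1}"
    by (simp add: image_diff_atLeastAtMost[of c, simplified diff_conv_add_uminus])
  then show ?thesis by blast
qed

lemma mean_log_nonneg: "0 \<le> mean_log \<omega> z k"
  unfolding mean_log_def by (intro integral_nonneg log_norm_integrable log_norm_nonneg)

lemma mean_log_add_le: "mean_log \<omega> z (m + k) \<le> mean_log \<omega> z m + mean_log \<omega> z k"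
proof -
  have "mean_log \<omega> z (m + k) \<le> integral {0..1} (\<lambda>y. log_norm f \<omega> z m y + log_norm f \<omega> z k (y + real m * \<omega>))"
    unfolding mean_log_def
    by (intro integral_le integrable_add log_norm_integrable log_norm_shift_integrable log_norm_add_le)
  also have "\<dots> = mean_log \<omega> z m + integral {0..1} (\<lambda>y. log_norm f \<omega> z k (y + real m * \<omega>))"
    unfolding mean_log_def by (intro integral_add log_norm_integrable log_norm_shift_integrable)
  finally show ?thesis by (simp add: mean_log_shift)
qed

text \<open>Subadditivity gives the limit and also that the limit bounds every mean from below; all
  lower bounds on log norms come from the latter.\<close>

lemma lyapunov_limit: "(\<lambda>k. mean_log \<omega> z k / k) \<longlonglongrightarrow> lyapunov f \<omega> z"
  and lyapunov_le: "k * lyapunov f \<omega> z \<le> mean_log \<omega> z k"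
proof -
  obtain L where L: "(\<lambda>k. mean_log \<omega> z k / k) \<longlonglongrightarrow> L" "\<And>k. k \<ge> 1 \<Longrightarrow> L \<le> mean_log \<omega> z k / k"
    using fekete[of "mean_log \<omega> z"] mean_log_add_le mean_log_nonneg by blast
  have "(LBINT \<theta>:{0..1}. ln (onorm ((*v) (cocycle f \<omega> z k \<theta>)))) = mean_log \<omega> z k" for k
    unfolding mean_log_def using set_borel_integral_eq_integral(2)[OF log_norm_set_integrable[of 0 1 \<omega> z k]]
    by (simp add: log_norm_def[abs_def] opnorm_def)
  then have "lyapunov f \<omega> z = lim (\<lambda>k. mean_log \<omega> z k / k)" by (simp add: lyapunov_def)
  then have eq: "lyapunov f \<omega> z = L" using limI[OF L(1)] by simp
  show "(\<lambda>k. mean_log \<omega> z k / k) \<longlonglongrightarrow> lyapunov f \<omega> z" using L(1) by (simp add: eq)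
  show "k * lyapunov f \<omega> z \<le> mean_log \<omega> z k"
  proof (cases "k = 0")
    case True
    then show ?thesis using mean_log_nonneg[of \<omega> z 0] by simp
  next
    case False
    then show ?thesis using L(2)[of k] by (simp add: eq field_simps)
  qed
qed

lemma lyapunov_approx:
  assumes "e > 0"
  shows "\<exists>m\<ge>1. mean_log \<omega> z m \<le> m * (lyapunov f \<omega> z + e)"
proof -
  have "\<forall>\<^sub>F k in sequentially. mean_log \<omega> z k / k < lyapunov f \<omega> z + e"
    using lyapunov_limit assms by (intro order_tendstoD) auto
  then have "\<forall>\<^sub>F k in sequentially. mean_log \<omega> z k / k < lyapunov f \<omega> z + e \<and> k \<ge> 1"
    using eventually_ge_at_top by (rule eventually_conj)
  then obtain m where "mean_log \<omega> z m / m < lyapunov f \<omega> z + e" "m \<ge> 1"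
    using eventually_happens by force
  then show ?thesis by (intro exI[of _ m]) (simp add: field_simps)
qed

lemma log_norm_oscillation:
  assumes z: "cmod z + F + 2 \<le> \<Lambda>" and s: "s > 0" "\<bar>x - x'\<bar> \<le> 3 * s"
    and away: "\<And>a m. a \<in> (\<Union>j<k. (\<lambda>a. a - real j * \<omega>) ` J) \<Longrightarrow> \<bar>x - a - of_int m\<bar> > 7 * s"
  shows "\<bar>log_norm f \<omega> z k x - log_norm f \<omega> z k x'\<bar> \<le> \<Lambda> ^ k * (k * (C * (3 * s) powr \<gamma>))"
proof -
  have L: "\<Lambda> \<ge> 0" using z F_nonneg norm_ge_zero[of z] by linarith
  have "\<bar>f (x + real j * \<omega>) - f (x' + real j * \<omega>)\<bar> \<le> C * (3 * s) powr \<gamma>" if j: "j < k" for j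
  proof (rule hoelder[OF s(1)])
    show "\<bar>x + real j * \<omega> - (x' + real j * \<omega>)\<bar> \<le> 3 * s" using s(2) by simp
    fix a m assume "a \<in> J"
    then have "a - real j * \<omega> \<in> (\<Union>j<k. (\<lambda>a. a - real j * \<omega>) ` J)" using j by blast
    from away[OF this, of m] show "7 * s < \<bar>x + real j * \<omega> - a - of_int m\<bar>" by (simp add: algebra_simps)
  qed
  then have "(\<Sum>j<k. cmod (z - z) + \<bar>f (x + real j * \<omega>) - f (x' + real j * \<omega>)\<bar>) \<le> (\<Sum>j<k. C * (3 * s) powr \<gamma>)"
    by (intro sum_mono) simp
  then have "\<Lambda> ^ k * (\<Sum>j<k. cmod (z - z) + \<bar>f (x + real j * \<omega>) - f (x' + real j * \<omega>)\<bar>) \<le> \<Lambda> ^ k * (k * (C * (3 * s) powr \<gamma>))"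
    using L by (intro mult_left_mono) auto
  then show ?thesis using log_norm_diff_le[OF z z, of \<omega> k x x'] by linarith
qed

text \<open>Integrating the comparison of two orbits over the second starting point turns its sum
  into q times the mean. The orbit step \<alpha> is kept apart from the frequency \<omega> of the
  cocycle: \<alpha> = m \<omega> serves consecutive blocks of length m, \<alpha> = \<omega>
  consecutive sites. The k translates of J produce the factor k card J.\<close>

lemma birkhoff_sum_approx:
  assumes q: "q > 0" "coprime p (int q)" "\<bar>\<alpha> - real_of_int p / real q\<bar> \<le> 1 / real (q\<^sup>2)"
    and z: "cmod z + F + 2 \<le> \<Lambda>"
  shows "\<bar>(\<Sum>i<q. log_norm f \<omega> z k (\<theta> + real i * \<alpha>)) - q * mean_log \<omega> z k\<bar>
    \<le> q * (\<Lambda> ^ k * (k * (C * (3 / q) powr \<gamma>))) + 34 * (k * ln \<Lambda>) * (k * card J)"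
proof -
  define R where "R = q * (\<Lambda> ^ k * (k * (C * (3 / q) powr \<gamma>))) + 34 * (k * ln \<Lambda>) * (k * card J)"
  define S where "S = (\<Sum>i<q. log_norm f \<omega> z k (\<theta> + real i * \<alpha>))"
  have L: "\<Lambda> \<ge> 1" using z F_nonneg norm_ge_zero[of z] by linarith
  have pointwise: "\<bar>S - (\<Sum>i<q. log_norm f \<omega> z k (y + real i * \<alpha>))\<bar> \<le> R" for y
  proof -
    let ?J = "\<Union>j<k. (\<lambda>a. a - real j * \<omega>) ` J"
    have "\<bar>S - (\<Sum>i<q. log_norm f \<omega> z k (y + real i * \<alpha>))\<bar>
      \<le> q * (\<Lambda> ^ k * (k * (C * (3 / q) powr \<gamma>))) + 34 * (k * ln \<Lambda>) * card ?J"
      unfolding S_def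
    proof (rule denjoy_koksma[OF q])
      show "\<bar>log_norm f \<omega> z k x\<bar> \<le> k * ln \<Lambda>" for x
        using log_norm_le[OF z, of \<omega> k x] log_norm_nonneg[of f \<omega> z k x] by simp
      show "finite ?J" using finite_J by auto
      show "\<bar>log_norm f \<omega> z k x - log_norm f \<omega> z k x'\<bar> \<le> \<Lambda> ^ k * (k * (C * (3 / q) powr \<gamma>))"
        if "\<bar>x - x'\<bar> \<le> 3 / q" "\<And>a m. a \<in> ?J \<Longrightarrow> 7 / q < \<bar>x - a - of_int m\<bar>" for x x'
        using log_norm_oscillation[where s = "1 / real q" and x = x and x' = x' and k = k and \<omega> = \<omega>, OF z] that q(1) by simp
      show "0 \<le> \<Lambda> ^ k * (k * (C * (3 / q) powr \<gamma>))" using L C_nonneg by simp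
    qed (rule log_norm_periodic)
    also have "\<dots> \<le> R"
    proof -
      have "card ?J \<le> (\<Sum>j<k. card ((\<lambda>a. a - real j * \<omega>) ` J))" by (rule card_UN_le) simp
      also have "\<dots> \<le> (\<Sum>j<k. card J)" by (intro sum_mono card_image_le finite_J)
      finally have "real (card ?J) \<le> real (k * card J)" by (simp only: sum_constant card_lessThan of_nat_le_iff) simp
      then show ?thesis unfolding R_def using L by (intro add_left_mono mult_left_mono) auto
    qed
    finally show ?thesis .
  qed
  have int: "(\<lambda>y. \<Sum>i<q. log_norm f \<omega> z k (y + real i * \<alpha>)) integrable_on {0..1}"
    by (intro integrable_sum log_norm_shift_integrable) auto
  have eq: "integral {0..1} (\<lambda>y. S - (\<Sum>i<q. log_norm f \<omega> z k (y + real i * \<alpha>))) = S - q * mean_log \<omega> z k"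
    using int by (subst Henstock_Kurzweil_Integration.integral_diff)
      (auto simp: Henstock_Kurzweil_Integration.integral_sum log_norm_shift_integrable mean_log_shift)
  have "norm (integral {0..1} (\<lambda>y. S - (\<Sum>i<q. log_norm f \<omega> z k (y + real i * \<alpha>)))) \<le> integral {0..1} (\<lambda>y::real. R)"
    using pointwise by (intro integral_norm_bound_integral integrable_diff int) auto
  then show ?thesis unfolding eq by (simp add: S_def R_def)
qed

end


section \<open>Growth of the cocycle along short orbits\<close>

text \<open>Markov inequality for the nonnegative deviations U - X i.\<close>

lemma card_deviation_le:
  fixes X :: "nat \<Rightarrow> real" and U d t :: real
  assumes upper: "\<And>i. i < q \<Longrightarrow> X i \<le> U" and sum: "q * (U - d) \<le> (\<Sum>i<q. X i)"
  shows "card {i. i < q \<and> X i < U - t} * t \<le> q * d"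
proof -
  let ?D = "{i. i < q \<and> X i < U - t}"
  have "card ?D * t = (\<Sum>i\<in>?D. t)" by simp
  also have "\<dots> \<le> (\<Sum>i\<in>?D. U - X i)" by (intro sum_mono) auto
  also have "\<dots> \<le> (\<Sum>i<q. U - X i)" using upper by (intro sum_mono2) auto
  also have "\<dots> \<le> q * d" using sum by (simp add: sum_subtractf algebra_simps)
  finally show ?thesis .
qed

text \<open>If every admissible run met Bad, its starting points would be covered by R translates of
  Bad, of total size at most q / 2; but there are more than q / 2 starting points.\<close>

lemma run_avoiding:
  fixes Bad :: "nat set"
  assumes fin: "finite Bad" and card: "card Bad * (2 * R) \<le> q" and q: "2 * R * n < q"
  shows "\<exists>i. i + R * n \<le> q \<and> (\<forall>j<R. i + j * n \<notin> Bad)"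
proof (rule ccontr)
  assume none: "\<not> ?thesis"
  have "{..q - R * n} \<subseteq> (\<Union>j<R. (\<lambda>b. b - j * n) ` Bad)"
  proof
    fix i assume "i \<in> {..q - R * n}"
    then have "i + R * n \<le> q" using q by auto
    then obtain j where "j < R" "i + j * n \<in> Bad" using none by blast
    then show "i \<in> (\<Union>j<R. (\<lambda>b. b - j * n) ` Bad)" by force
  qed
  then have "card {..q - R * n} \<le> card (\<Union>j<R. (\<lambda>b. b - j * n) ` Bad)"
    using fin by (intro card_mono) auto
  also have "\<dots> \<le> (\<Sum>j<R. card ((\<lambda>b. b - j * n) ` Bad))" by (rule card_UN_le) simp
  also have "\<dots> \<le> (\<Sum>j<R. card Bad)" by (intro sum_mono card_image_le fin)
  finally have "q - R * n + 1 \<le> R * card Bad" by simp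
  then show False using card q by (simp add: mult_ac)
qed

section \<open>Upper and lower bounds on log norms, uniform in the phase\<close>

context piecewise_potential
begin

lemma lyapunov_nonneg: "0 \<le> lyapunov f \<omega> z"
  using lyapunov_limit by (rule LIMSEQ_le_const) (auto intro!: divide_nonneg_nonneg mean_log_nonneg)

lemma error_small:
  fixes c1 c2 e :: real
  assumes e: "e > 0"
  shows "\<exists>N. \<forall>q\<ge>N. c1 * (3 / real q) powr \<gamma> + c2 / real q \<le> e"
proof -
  have "(\<lambda>q. 3 / real q) \<longlonglongrightarrow> 0" by real_asymp
  then have "(\<lambda>q. (3 / real q) powr \<gamma>) \<longlonglongrightarrow> 0"
    using gamma_pos by (intro tendsto_zero_powrI[where b = \<gamma>]) auto
  moreover have "(\<lambda>q. c2 / real q) \<longlonglongrightarrow> 0" by real_asymp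
  ultimately have "(\<lambda>q. c1 * (3 / real q) powr \<gamma> + c2 / real q) \<longlonglongrightarrow> c1 * 0 + 0"
    by (intro tendsto_intros)
  then have "\<forall>\<^sub>F q in sequentially. c1 * (3 / real q) powr \<gamma> + c2 / real q < e"
    using e by (intro order_tendstoD) auto
  then show ?thesis unfolding eventually_sequentially by (meson less_imp_le)
qed

lemma log_norm_block_le: "log_norm f \<omega> z (q * m) \<theta> \<le> (\<Sum>i<q. log_norm f \<omega> z m (\<theta> + real i * (real m * \<omega>)))"
proof (induction q)
  case (Suc q)
  have "log_norm f \<omega> z (q * m + m) \<theta> \<le> log_norm f \<omega> z (q * m) \<theta> + log_norm f \<omega> z m (\<theta> + real (q * m) * \<omega>)"
    by (rule log_norm_add_le)
  then show ?case using Suc by (simp add: add.commute mult_ac)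
qed simp

text \<open>A version with jumps of the uniform upper bound for subadditive cocycles over uniquely
  ergodic maps. One block length m has its mean near the exponent; along orbits of step m \<omega>
  and suitable length q the sum of its log norms is then bounded for every phase, and subadditivity
  passes from the length q m to all large lengths. As m is fixed, a small change of energy costs
  little.\<close>

lemma log_norm_upper:
  assumes irr: "\<omega> \<notin> \<rat>" and e: "e > 0"
  shows "\<exists>n0 d. d > 0 \<and> (\<forall>n\<ge>n0. \<forall>E. \<bar>E - E0\<bar> < d \<longrightarrow>
    (\<forall>\<theta>. log_norm f \<omega> (complex_of_real E) n \<theta> \<le> n * (lyapunov f \<omega> (complex_of_real E0) + e)))"
proof -
  define L where "L = lyapunov f \<omega> (complex_of_real E0)"
  define \<Lambda> where "\<Lambda> = \<bar>E0\<bar> + 1 + F + 2"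
  have \<Lambda>: "\<Lambda> \<ge> 1" using F_nonneg by (simp add: \<Lambda>_def)
  have L0: "L \<ge> 0" using lyapunov_nonneg by (simp add: L_def)
  obtain m where m: "m \<ge> 1" "mean_log \<omega> (complex_of_real E0) m \<le> m * (L + e / 4)"
    using lyapunov_approx[of "e / 4" \<omega> "complex_of_real E0"] e by (auto simp: L_def)
  define \<alpha> where "\<alpha> = real m * \<omega>"
  have "\<alpha> \<notin> \<rat>"
  proof
    assume "\<alpha> \<in> \<rat>"
    then have "\<alpha> / real m \<in> \<rat>" by simp
    then show False using irr m by (simp add: \<alpha>_def)
  qed
  obtain N where N: "\<And>q. q \<ge> N \<Longrightarrow> \<Lambda> ^ m * (m * C) * (3 / real q) powr \<gamma> + 34 * (m * ln \<Lambda>) * (m * card J) / real q \<le> e / 8"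
    using error_small[of "e / 8" "\<Lambda> ^ m * (m * C)" "34 * (m * ln \<Lambda>) * (m * card J)"] e by auto
  obtain q p where q: "N \<le> q" "0 < q" "coprime p (int q)" "\<bar>\<alpha> - real_of_int p / real q\<bar> \<le> 1 / real (q\<^sup>2)"
    using approximants[OF \<open>\<alpha> \<notin> \<rat>\<close>] by blast
  define M where "M = q * m"
  have M1: "M \<ge> 1" using q m by (simp add: M_def)
  have sum0: "(\<Sum>i<q. log_norm f \<omega> (complex_of_real E0) m (\<theta> + real i * \<alpha>)) \<le> real M * (L + 3 * e / 8)" for \<theta>
  proof -
    have "(\<Sum>i<q. log_norm f \<omega> (complex_of_real E0) m (\<theta> + real i * \<alpha>)) \<le> q * mean_log \<omega> (complex_of_real E0) m
        + (q * (\<Lambda> ^ m * (m * (C * (3 / q) powr \<gamma>))) + 34 * (m * ln \<Lambda>) * (m * card J))"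
      using birkhoff_sum_approx[OF q(2-4), of "complex_of_real E0" \<Lambda> \<omega> m \<theta>] by (simp add: \<Lambda>_def)
    also have "q * (\<Lambda> ^ m * (m * (C * (3 / q) powr \<gamma>))) + 34 * (m * ln \<Lambda>) * (m * card J)
        = q * (\<Lambda> ^ m * (m * C) * (3 / real q) powr \<gamma> + 34 * (m * ln \<Lambda>) * (m * card J) / real q)"
      using q(2) by (simp add: algebra_simps)
    also have "\<dots> \<le> q * (e / 8)" using N[OF q(1)] by (intro mult_left_mono) auto
    also have "q * mean_log \<omega> (complex_of_real E0) m \<le> q * (m * (L + e / 4))" using m(2) by (intro mult_left_mono) auto
    also have "q * (e / 8) \<le> q * (m * (e / 8))" using m(1) e by (intro mult_left_mono) auto
    finally show ?thesis by (simp add: M_def algebra_simps)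
  qed
  \<comment> \<open>The budget e splits into e / 4 for the mean at length m, e / 8 for the orbit
    comparison, e / 8 for the change of energy and e / 2 for the incomplete last block.\<close>
  define d where "d = min 1 (e / (8 * \<Lambda> ^ m))"
  have d: "d > 0" using e \<Lambda> by (simp add: d_def)
  have blockM: "log_norm f \<omega> (complex_of_real E) M \<theta> \<le> M * (L + e / 2)" if E: "\<bar>E - E0\<bar> < d" for E \<theta>
  proof -
    have zE: "cmod (complex_of_real E) + F + 2 \<le> \<Lambda>" "cmod (complex_of_real E0) + F + 2 \<le> \<Lambda>"
      using E by (auto simp: \<Lambda>_def d_def)
    have near: "log_norm f \<omega> (complex_of_real E) m x \<le> log_norm f \<omega> (complex_of_real E0) m x + m * (e / 8)" for x
    proof -
      have "cmod (complex_of_real E - complex_of_real E0) = \<bar>E - E0\<bar>" by (simp flip: of_real_diff)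
      then have "\<bar>log_norm f \<omega> (complex_of_real E) m x - log_norm f \<omega> (complex_of_real E0) m x\<bar> \<le> \<Lambda> ^ m * (m * \<bar>E - E0\<bar>)"
        using log_norm_diff_le[OF zE, of \<omega> m x x] by simp
      also have "\<dots> \<le> \<Lambda> ^ m * (m * (e / (8 * \<Lambda> ^ m)))"
        using E \<Lambda> by (intro mult_left_mono) (auto simp: d_def)
      also have "\<dots> = m * (e / 8)" using \<Lambda> by simp
      finally show ?thesis by linarith
    qed
    have "log_norm f \<omega> (complex_of_real E) M \<theta> \<le> (\<Sum>i<q. log_norm f \<omega> (complex_of_real E) m (\<theta> + real i * \<alpha>))"
      unfolding M_def \<alpha>_def by (rule log_norm_block_le)
    also have "\<dots> \<le> (\<Sum>i<q. log_norm f \<omega> (complex_of_real E0) m (\<theta> + real i * \<alpha>) + m * (e / 8))"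
      by (intro sum_mono near)
    also have "\<dots> = (\<Sum>i<q. log_norm f \<omega> (complex_of_real E0) m (\<theta> + real i * \<alpha>)) + M * (e / 8)"
      by (simp add: sum.distrib M_def)
    also have "\<dots> \<le> M * (L + e / 2)" using sum0[of \<theta>] by (simp add: algebra_simps)
    finally show ?thesis .
  qed
  have blocks: "log_norm f \<omega> (complex_of_real E) (k * M + r) \<theta> \<le> k * (M * (L + e / 2)) + r * ln \<Lambda>"
    if E: "\<bar>E - E0\<bar> < d" for E k r \<theta>
  proof (induction k arbitrary: \<theta>)
    case 0
    have "cmod (complex_of_real E) + F + 2 \<le> \<Lambda>" using E by (auto simp: \<Lambda>_def d_def)
    then show ?case using log_norm_le by simp
  next
    case (Suc k)
    have "log_norm f \<omega> (complex_of_real E) (M + (k * M + r)) \<theta>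
      \<le> log_norm f \<omega> (complex_of_real E) M \<theta> + log_norm f \<omega> (complex_of_real E) (k * M + r) (\<theta> + real M * \<omega>)"
      by (rule log_norm_add_le)
    also have "\<dots> \<le> M * (L + e / 2) + (k * (M * (L + e / 2)) + r * ln \<Lambda>)"
      by (intro add_mono blockM[OF E] Suc.IH)
    also have "\<dots> = Suc k * (M * (L + e / 2)) + r * ln \<Lambda>" by (simp add: distrib_right)
    finally show ?case by (simp add: add.assoc)
  qed
  obtain n0 where n0: "2 * (M * ln \<Lambda>) / e \<le> real n0" using real_arch_simple by blast
  have "log_norm f \<omega> (complex_of_real E) n \<theta> \<le> n * (L + e)" if n: "n \<ge> n0" and E: "\<bar>E - E0\<bar> < d" for n E \<theta>
  proof -
    have "log_norm f \<omega> (complex_of_real E) n \<theta> \<le> (n div M) * (M * (L + e / 2)) + (n mod M) * ln \<Lambda>"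
      using blocks[OF E, of "n div M" "n mod M" \<theta>] by simp
    also have "real (n div M) * (M * (L + e / 2)) = real (n div M * M) * (L + e / 2)" by simp
    also have "\<dots> \<le> real n * (L + e / 2)" using L0 e by (intro mult_right_mono) (auto simp flip: of_nat_mult)
    also have "(n mod M) * ln \<Lambda> \<le> M * ln \<Lambda>"
      using \<Lambda> M1 by (intro mult_right_mono) (auto intro: less_imp_le)
    also have "M * ln \<Lambda> \<le> real n0 * e / 2" using n0 e by (simp add: field_simps)
    also have "\<dots> \<le> real n * e / 2" using n e by (intro divide_right_mono mult_right_mono) auto
    finally show ?thesis by (simp add: algebra_simps)
  qed
  then show ?thesis using d unfolding L_def by blast
qed

text \<open>Continuity of the exponent replaces the reference value at E0 by the one at E;
  compactness leaves finitely many thresholds, and their sum exceeds each of them.\<close>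

lemma log_norm_upper_uniform:
  assumes irr: "\<omega> \<notin> \<rat>" and e: "e > 0"
    and cont: "continuous_on {-K..K} (\<lambda>E. lyapunov f \<omega> (complex_of_real E))"
  shows "\<exists>n0. \<forall>n\<ge>n0. \<forall>E\<in>{-K..K}. \<forall>\<theta>.
    log_norm f \<omega> (complex_of_real E) n \<theta> \<le> n * (lyapunov f \<omega> (complex_of_real E) + e)"
proof -
  define L where "L E = lyapunov f \<omega> (complex_of_real E)" for E
  have ex: "\<exists>n0 d. d > 0 \<and> (\<forall>n\<ge>n0. \<forall>E\<in>{-K..K}. \<bar>E - E0\<bar> < d \<longrightarrow> (\<forall>\<theta>. log_norm f \<omega> (complex_of_real E) n \<theta> \<le> n * (L E + e)))"
    if E0: "E0 \<in> {-K..K}" for E0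
  proof -
    obtain n0 d where d: "d > 0" "\<And>n E \<theta>. n \<ge> n0 \<Longrightarrow> \<bar>E - E0\<bar> < d \<Longrightarrow> log_norm f \<omega> (complex_of_real E) n \<theta> \<le> n * (L E0 + e / 2)"
      using log_norm_upper[OF irr, of "e / 2" E0] e unfolding L_def half_gt_zero_iff by blast
    obtain d' where d': "d' > 0" "\<And>E. E \<in> {-K..K} \<Longrightarrow> dist E E0 < d' \<Longrightarrow> dist (L E) (L E0) < e / 2"
      using cont E0 e unfolding continuous_on_iff L_def by (metis half_gt_zero)
    have "log_norm f \<omega> (complex_of_real E) n \<theta> \<le> n * (L E + e)"
      if "n \<ge> n0" "E \<in> {-K..K}" "\<bar>E - E0\<bar> < min d d'" for n E \<theta>
    proof -
      have "log_norm f \<omega> (complex_of_real E) n \<theta> \<le> n * (L E0 + e / 2)" using d that by auto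
      also have "\<dots> \<le> n * (L E + e)"
      proof (rule mult_left_mono)
        have "\<bar>L E - L E0\<bar> < e / 2" using d'(2)[of E] that by (simp add: dist_real_def)
        then show "L E0 + e / 2 \<le> L E + e" by linarith
      qed simp
      finally show ?thesis .
    qed
    then show ?thesis using d d' by (intro exI[of _ n0] exI[of _ "min d d'"]) auto
  qed
  then obtain nn D where D: "\<And>E0. E0 \<in> {-K..K} \<Longrightarrow> D E0 > 0"
    "\<And>E0 n E \<theta>. E0 \<in> {-K..K} \<Longrightarrow> n \<ge> nn E0 \<Longrightarrow> E \<in> {-K..K} \<Longrightarrow> \<bar>E - E0\<bar> < D E0 \<Longrightarrow> log_norm f \<omega> (complex_of_real E) n \<theta> \<le> n * (L E + e)"
    by metis
  obtain S where S: "S \<subseteq> {-K..K}" "finite S" "{-K..K} \<subseteq> (\<Union>E0\<in>S. ball E0 (D E0))"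
  proof (rule compactE_image[of "{-K..K}" "{-K..K}" "\<lambda>E0. ball E0 (D E0)"])
    show "{-K..K} \<subseteq> (\<Union>E0\<in>{-K..K}. ball E0 (D E0))"
    proof
      fix x assume "x \<in> {-K..K}"
      then show "x \<in> (\<Union>E0\<in>{-K..K}. ball E0 (D E0))" using D(1)[of x] by (intro UN_I[of x]) auto
    qed
  qed auto
  have "log_norm f \<omega> (complex_of_real E) n \<theta> \<le> n * (L E + e)"
    if n: "n \<ge> sum nn S" and E: "E \<in> {-K..K}" for n E \<theta>
  proof -
    obtain E0 where E0: "E0 \<in> S" "E \<in> ball E0 (D E0)" using S(3) E by blast
    have "nn E0 \<le> n" using member_le_sum[of E0 S nn] E0 S(2) n by simp
    then show ?thesis using D(2)[of E0 n E \<theta>] E0 S(1) E by (auto simp: dist_real_def)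
  qed
  then show ?thesis unfolding L_def by blast
qed

text \<open>Every mean is at least n times the exponent, so only the comparison error matters. The
  constant c ensures \<Lambda>^n q^(-\<gamma>) \<le> exp (- n) once q \<ge> exp (c n); the jumps
  cost order n^2 in total, which is small against q n.\<close>

lemma birkhoff_sum_lower:
  fixes K e :: real
  assumes e: "e > 0" and K: "K \<ge> 0"
  defines "c \<equiv> (ln (K + F + 3) + 1) / \<gamma>"
  shows "\<exists>n0. \<forall>n\<ge>n0. \<forall>q p. 0 < q \<longrightarrow> coprime p (int q) \<longrightarrow> \<bar>\<omega> - real_of_int p / real q\<bar> \<le> 1 / real (q\<^sup>2)
    \<longrightarrow> exp (c * n) \<le> real q \<longrightarrow> (\<forall>E\<in>{-K..K}. \<forall>\<theta>.
      q * (n * (lyapunov f \<omega> (complex_of_real E) - e)) \<le> (\<Sum>i<q. log_norm f \<omega> (complex_of_real E) n (\<theta> + real i * \<omega>)))"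
proof -
  define \<Lambda> where "\<Lambda> = K + F + 3"
  have \<Lambda>: "\<Lambda> \<ge> 1" using F_nonneg K by (simp add: \<Lambda>_def)
  have ln\<Lambda>: "ln \<Lambda> \<ge> 0" using \<Lambda> by simp
  have c: "c > 0" "c * \<gamma> = ln \<Lambda> + 1" using ln\<Lambda> gamma_pos by (auto simp: c_def \<Lambda>_def[symmetric] add_nonneg_pos)
  have "(\<lambda>n. C * 3 powr \<gamma> * exp (- real n)) \<longlonglongrightarrow> 0" by real_asymp
  then have "\<forall>\<^sub>F n in sequentially. C * 3 powr \<gamma> * exp (- real n) < e / 2"
    using e by (intro order_tendstoD) auto
  moreover have "(\<lambda>n. 34 * ln \<Lambda> * card J * (real n * exp (- c * real n))) \<longlonglongrightarrow> 0"
  proof -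
    have "(\<lambda>n. real n * exp (- c * real n)) \<longlonglongrightarrow> 0" using c(1) by real_asymp
    then show ?thesis by (intro tendsto_mult_right_zero)
  qed
  then have "\<forall>\<^sub>F n in sequentially. 34 * ln \<Lambda> * card J * (real n * exp (- c * real n)) < e / 2"
    using e by (intro order_tendstoD) auto
  ultimately have "\<forall>\<^sub>F n in sequentially. C * 3 powr \<gamma> * exp (- real n) < e / 2
      \<and> 34 * ln \<Lambda> * card J * (real n * exp (- c * real n)) < e / 2"
    by (rule eventually_conj)
  then obtain n0 where n0: "\<And>n. n \<ge> n0 \<Longrightarrow> C * 3 powr \<gamma> * exp (- real n) < e / 2"
      "\<And>n. n \<ge> n0 \<Longrightarrow> 34 * ln \<Lambda> * card J * (real n * exp (- c * real n)) < e / 2"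
    unfolding eventually_sequentially by auto
  show ?thesis
  proof (intro exI[of _ n0] allI impI ballI)
    fix n q :: nat and p E \<theta>
    assume n: "n0 \<le> n" and q: "0 < q" "coprime p (int q)" "\<bar>\<omega> - real_of_int p / real q\<bar> \<le> 1 / real (q\<^sup>2)"
      and qn: "exp (c * n) \<le> real q" and E: "E \<in> {-K..K}"
    define z where "z = complex_of_real E"
    have z: "cmod z + F + 2 \<le> \<Lambda>" using E by (auto simp: z_def \<Lambda>_def)
    have e1: "\<Lambda> ^ n * (n * (C * (3 / q) powr \<gamma>)) \<le> n * (e / 2)"
    proof -
      have "(3 / real q) powr \<gamma> \<le> (3 / exp (c * n)) powr \<gamma>"
        using qn q gamma_pos by (intro powr_mono2 divide_left_mono) auto
      also have "\<dots> = 3 powr \<gamma> * exp (- (c * \<gamma>) * n)"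
        by (simp add: powr_divide exp_powr_real exp_minus field_simps)
      also have "\<dots> = 3 powr \<gamma> * (exp (- real n) / \<Lambda> ^ n)"
      proof -
        have "\<Lambda> ^ n = exp (ln \<Lambda> * n)" using \<Lambda> by (simp add: exp_of_nat2_mult)
        then show ?thesis unfolding c(2) by (simp add: algebra_simps flip: exp_diff)
      qed
      finally have "\<Lambda> ^ n * (n * (C * (3 / q) powr \<gamma>)) \<le> \<Lambda> ^ n * (n * (C * (3 powr \<gamma> * (exp (- real n) / \<Lambda> ^ n))))"
        using \<Lambda> C_nonneg by (intro mult_left_mono) auto
      also have "\<dots> = n * (C * 3 powr \<gamma> * exp (- real n))" using \<Lambda> by simp
      also have "\<dots> \<le> n * (e / 2)" using n0(1)[OF n] by (intro mult_left_mono) auto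
      finally show ?thesis .
    qed
    have e2: "34 * (n * ln \<Lambda>) * (n * card J) \<le> q * (n * (e / 2))"
    proof -
      have "34 * (n * ln \<Lambda>) * (n * card J) = exp (c * n) * (n * (34 * ln \<Lambda> * card J * (real n * exp (- c * real n))))"
        by (simp add: exp_minus)
      also have "\<dots> \<le> q * (n * (e / 2))"
        using qn n0(2)[OF n] ln\<Lambda> by (intro mult_mono mult_left_mono) (auto intro!: mult_nonneg_nonneg)
      finally show ?thesis .
    qed
    have "q * (n * lyapunov f \<omega> z) \<le> q * mean_log \<omega> z n"
      by (intro mult_left_mono lyapunov_le) auto
    also have "\<dots> \<le> (\<Sum>i<q. log_norm f \<omega> z n (\<theta> + real i * \<omega>))
        + (q * (\<Lambda> ^ n * (n * (C * (3 / q) powr \<gamma>))) + 34 * (n * ln \<Lambda>) * (n * card J))"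
      using birkhoff_sum_approx[OF q z, of \<omega> n \<theta>] by linarith
    also have "q * (\<Lambda> ^ n * (n * (C * (3 / q) powr \<gamma>))) + 34 * (n * ln \<Lambda>) * (n * card J)
        \<le> q * (n * (e / 2)) + q * (n * (e / 2))"
      using e1 e2 by (intro add_mono mult_left_mono) auto
    finally show "q * (n * (lyapunov f \<omega> (complex_of_real E) - e))
      \<le> (\<Sum>i<q. log_norm f \<omega> (complex_of_real E) n (\<theta> + real i * \<omega>))"
      by (simp add: z_def algebra_simps)
  qed
qed

text \<open>The order of the quantifiers is the point: c is fixed before R, so the norm exp (R n l /
  2) found in a window of length q \<ge> exp (c n) can be any power of exp (c n). Points below the
  maximal rate are rare because the upper bound is uniform and the orbit sum nearly maximal;
  near-maximality at both lengths n and 2 n rules out cancellation between neighbouring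
  blocks.\<close>

lemma cocycle_growth:
  fixes K l :: real
  assumes irr: "\<omega> \<notin> \<rat>" and K: "K \<ge> 0"
    and cont: "continuous_on {-K..K} (\<lambda>E. lyapunov f \<omega> (complex_of_real E))"
    and l: "l > 0" "\<And>E. E \<in> {-K..K} \<Longrightarrow> l \<le> lyapunov f \<omega> (complex_of_real E)"
  shows "\<exists>c>0. \<forall>R\<ge>1. \<exists>n0. \<forall>n\<ge>n0. \<forall>q p. 0 < q \<longrightarrow> coprime p (int q) \<longrightarrow>
    \<bar>\<omega> - real_of_int p / real q\<bar> \<le> 1 / real (q\<^sup>2) \<longrightarrow> exp (c * n) \<le> real q \<longrightarrow>
    (\<forall>\<theta> E y. \<bar>E\<bar> \<le> K \<longrightarrow> \<bar>y\<bar> \<le> exp (- (c * n)) \<longrightarrow> (\<exists>i. i + R * n \<le> q \<and>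
      exp (real (R * n) * l / 2) \<le> opnorm (cocycle f \<omega> (Complex E y) (R * n) (\<theta> + real i * \<omega>))))"
proof -
  define L where "L E = lyapunov f \<omega> (complex_of_real E)" for E
  define \<Lambda> where "\<Lambda> = K + F + 3"
  have \<Lambda>: "\<Lambda> \<ge> 1" using F_nonneg K by (simp add: \<Lambda>_def)
  have ln\<Lambda>: "ln \<Lambda> \<ge> 0" using \<Lambda> by simp
  define c0 where "c0 = (ln \<Lambda> + 1) / \<gamma>"
  have c0: "c0 > 0" using ln\<Lambda> gamma_pos by (simp add: c0_def add_nonneg_pos)
  \<comment> \<open>2 c0 makes the lower bound available at length 2 n; 2 ln \<Lambda> + 2 makes an
    imaginary part of at most exp (- c n) change log norms at lengths up to 2 n by at most
    1.\<close>
  define c where "c = 2 * (c0 + ln \<Lambda> + 1)"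
  have c: "c > 0" "2 * c0 \<le> c" "2 * ln \<Lambda> + 2 \<le> c" using c0 ln\<Lambda> by (auto simp: c_def)
  define \<tau> where "\<tau> = l / 20"
  have \<tau>: "\<tau> > 0" "\<And>E. E \<in> {-K..K} \<Longrightarrow> 20 * \<tau> \<le> L E" using l by (auto simp: \<tau>_def L_def)
  show ?thesis
  proof (intro exI[of _ c] conjI c(1) allI impI)
    fix R :: nat assume R: "R \<ge> 1"
    \<comment> \<open>Deviations exceeding \<tau> then occupy at most a fraction 2 e / \<tau> = 1 /
      (4 R) of the orbit for each of the two lengths, together 1 / (2 R), which is what a run
      avoiding them tolerates.\<close>
    define e where "e = \<tau> / (8 * real R)"
    have e: "e > 0" "e \<le> \<tau> / 8" "2 * e * (4 * real R) = \<tau>"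
      using \<tau> R by (auto simp: e_def field_simps)
    obtain N1 where N1: "\<And>n E \<theta>. n \<ge> N1 \<Longrightarrow> E \<in> {-K..K} \<Longrightarrow> log_norm f \<omega> (complex_of_real E) n \<theta> \<le> n * (L E + e)"
      using log_norm_upper_uniform[OF irr e(1) cont] unfolding L_def by blast
    obtain N2 where N2: "\<And>n q p E \<theta>. n \<ge> N2 \<Longrightarrow> 0 < q \<Longrightarrow> coprime p (int q) \<Longrightarrow> \<bar>\<omega> - real_of_int p / real q\<bar> \<le> 1 / real (q\<^sup>2)
        \<Longrightarrow> exp (c0 * n) \<le> real q \<Longrightarrow> E \<in> {-K..K} \<Longrightarrow>
        q * (n * (L E - e)) \<le> (\<Sum>i<q. log_norm f \<omega> (complex_of_real E) n (\<theta> + real i * \<omega>))"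
      using birkhoff_sum_lower[OF e(1) K, of \<omega>, folded \<Lambda>_def, folded c0_def]
      by (elim exE) (simp only: L_def, metis)
    have "\<forall>\<^sub>F n in sequentially. 2 * real R * real n < exp (c * real n)" using c(1) R by real_asymp
    then obtain N3 where N3: "\<And>n. n \<ge> N3 \<Longrightarrow> 2 * real R * real n < exp (c * real n)"
      unfolding eventually_sequentially by blast
    obtain N4 where N4: "2 / \<tau> \<le> real N4" using real_arch_simple by blast
    show "\<exists>n0. \<forall>n\<ge>n0. \<forall>q p. 0 < q \<longrightarrow> coprime p (int q) \<longrightarrow>
      \<bar>\<omega> - real_of_int p / real q\<bar> \<le> 1 / real (q\<^sup>2) \<longrightarrow> exp (c * n) \<le> real q \<longrightarrow>
      (\<forall>\<theta> E y. \<bar>E\<bar> \<le> K \<longrightarrow> \<bar>y\<bar> \<le> exp (- (c * n)) \<longrightarrow> (\<exists>i. i + R * n \<le> q \<and>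
        exp (real (R * n) * l / 2) \<le> opnorm (cocycle f \<omega> (Complex E y) (R * n) (\<theta> + real i * \<omega>))))"
    proof (rule exI[of _ "max 1 (max (max N1 N2) (max N3 N4))"], intro allI impI)
      fix n q :: nat and p \<theta> E y
      assume n: "max 1 (max (max N1 N2) (max N3 N4)) \<le> n"
        and q: "0 < q" "coprime p (int q)" "\<bar>\<omega> - real_of_int p / real q\<bar> \<le> 1 / real (q\<^sup>2)"
        and qn: "exp (c * n) \<le> real q" and "\<bar>E\<bar> \<le> K" and y: "\<bar>y\<bar> \<le> exp (- (c * n))"
      then have E: "E \<in> {-K..K}" by auto
      have n1: "n \<ge> 1" using n by simp
      have n\<tau>: "2 \<le> n * \<tau>"
      proof -
        have "2 / \<tau> \<le> real n" using N4 n by linarith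
        then show ?thesis using \<tau> by (simp add: field_simps)
      qed
      define z where "z = Complex E y"
      have upper: "log_norm f \<omega> (complex_of_real E) k x \<le> k * (L E + e)" if "k \<ge> n" for k x
        using N1[of k E x] that n E by simp
      have bad: "real (card {i. i < q \<and> log_norm f \<omega> (complex_of_real E) k (\<theta> + real i * \<omega>) < k * (L E - \<tau>)}) * (4 * real R) \<le> real q"
        if k: "k = n \<or> k = 2 * n" for k
      proof -
        have "c0 * k \<le> c * n"
        proof -
          have "c0 * k \<le> c0 * (2 * real n)" using k c0 by (intro mult_left_mono) auto
          also have "\<dots> = (2 * c0) * n" by simp
          also have "\<dots> \<le> c * n" using c(2) by (intro mult_right_mono) auto
          finally show ?thesis .
        qed
        then have "exp (c0 * k) \<le> real q" using qn by (meson exp_le_cancel_iff order_trans)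
        then have "q * (k * (L E - e)) \<le> (\<Sum>i<q. log_norm f \<omega> (complex_of_real E) k (\<theta> + real i * \<omega>))"
          using k n by (intro N2[OF _ q _ E]) auto
        then have s: "q * (k * (L E + e) - k * (2 * e)) \<le> (\<Sum>i<q. log_norm f \<omega> (complex_of_real E) k (\<theta> + real i * \<omega>))"
          by (simp add: algebra_simps)
        let ?D = "{i. i < q \<and> log_norm f \<omega> (complex_of_real E) k (\<theta> + real i * \<omega>) < k * (L E - \<tau>)}"
        have "real (card {i. i < q \<and> log_norm f \<omega> (complex_of_real E) k (\<theta> + real i * \<omega>) < k * (L E + e) - k * (\<tau> + e)}) * (k * (\<tau> + e)) \<le> q * (k * (2 * e))"
          using upper[of k] k by (intro card_deviation_le s) auto
        moreover have "k * (L E + e) - k * (\<tau> + e) = k * (L E - \<tau>)" by (simp add: algebra_simps)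
        ultimately have "real (card ?D) * (k * (\<tau> + e)) \<le> q * (k * (2 * e))" by simp
        then have "k * (card ?D * (\<tau> + e)) \<le> k * (q * (2 * e))" by (simp add: mult_ac)
        then have "card ?D * (\<tau> + e) \<le> q * (2 * e)" using k n1 by (subst (asm) mult_le_cancel_left_pos) auto
        moreover have "card ?D * \<tau> \<le> card ?D * (\<tau> + e)" using e by (intro mult_left_mono) auto
        ultimately have "card ?D * (2 * e * (4 * real R)) \<le> q * (2 * e)" unfolding e(3) by linarith
        then have "(2 * e) * (card ?D * (4 * real R)) \<le> (2 * e) * q" by (simp add: mult_ac)
        then show ?thesis using e(1) by (subst (asm) mult_le_cancel_left_pos) auto
      qed
      define B1 where "B1 = {i. i < q \<and> log_norm f \<omega> (complex_of_real E) n (\<theta> + real i * \<omega>) < n * (L E - \<tau>)}"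
      define B2 where "B2 = {i. i < q \<and> log_norm f \<omega> (complex_of_real E) (2 * n) (\<theta> + real i * \<omega>) < real (2 * n) * (L E - \<tau>)}"
      have "real (card (B1 \<union> B2) * (2 * R)) \<le> real q"
      proof -
        have "real (card (B1 \<union> B2)) \<le> real (card B1) + real (card B2)"
          using card_Un_le[of B1 B2] by (simp flip: of_nat_add)
        then have "real (card (B1 \<union> B2)) * (4 * real R) \<le> (real (card B1) + real (card B2)) * (4 * real R)"
          by (intro mult_right_mono) auto
        also have "\<dots> \<le> real q + real q"
          using bad[of n] bad[of "2 * n"] by (simp add: B1_def B2_def distrib_right)
        finally show ?thesis by (simp add: mult_ac)
      qed
      then have cardB: "card (B1 \<union> B2) * (2 * R) \<le> q" by (simp only: of_nat_le_iff)
      have "2 * real R * real n < real q" using N3[of n] n qn by simp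
      then have "real (2 * R * n) < real q" by simp
      then have "2 * R * n < q" by (simp only: of_nat_less_iff)
      then obtain i where i: "i + R * n \<le> q" "\<And>j. j < R \<Longrightarrow> i + j * n \<notin> B1 \<union> B2"
        using run_avoiding[OF _ cardB, of n] by (auto simp: B1_def B2_def)
      define x where "x j = \<theta> + real (i + j * n) * \<omega>" for j
      define A where "A j = cocycle f \<omega> z n (x j)" for j
      have less: "i + j * n < q" if "j < R" for j
      proof -
        have "j * n < R * n" using that n1 by simp
        then show ?thesis using i(1) by linarith
      qed
      have low: "n * (L E - \<tau>) \<le> log_norm f \<omega> (complex_of_real E) n (x j)"
        "real (2 * n) * (L E - \<tau>) \<le> log_norm f \<omega> (complex_of_real E) (2 * n) (x j)" if "j < R" for j
        using i(2)[OF that] less[OF that] by (auto simp: B1_def B2_def x_def not_less)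
      have perturb: "\<bar>log_norm f \<omega> z k w - log_norm f \<omega> (complex_of_real E) k w\<bar> \<le> 1" if "k \<le> 2 * n" for k w
      proof -
        have y1: "\<bar>y\<bar> \<le> 1" using y c(1) order_trans[OF y, of 1] by simp
        have "cmod z \<le> \<bar>E\<bar> + \<bar>y\<bar>" using cmod_le[of z] by (simp add: z_def)
        then have z: "cmod z + F + 2 \<le> \<Lambda>" "cmod (complex_of_real E) + F + 2 \<le> \<Lambda>"
          using E y1 by (auto simp: \<Lambda>_def)
        have "cmod (z - complex_of_real E) = \<bar>y\<bar>" by (simp add: z_def cmod_def)
        then have "\<bar>log_norm f \<omega> z k w - log_norm f \<omega> (complex_of_real E) k w\<bar> \<le> \<Lambda> ^ k * (k * \<bar>y\<bar>)"
          using log_norm_diff_le[OF z, of \<omega> k w w] by simp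
        also have "\<dots> \<le> \<Lambda> ^ (2 * n) * (real (2 * n) * exp (- (c * n)))"
          using that \<Lambda> y by (intro mult_mono power_increasing) auto
        also have "\<dots> \<le> \<Lambda> ^ (2 * n) * (exp (real (2 * n)) * exp (- (c * n)))"
        proof (intro mult_left_mono mult_right_mono)
          show "real (2 * n) \<le> exp (real (2 * n))"
            using exp_ge_add_one_self[of "real (2 * n)"] by linarith
        qed (use \<Lambda> in auto)
        also have "\<dots> = exp (ln \<Lambda> * real (2 * n) + real (2 * n) - c * n)"
        proof -
          have "\<Lambda> ^ (2 * n) = exp (ln \<Lambda> * real (2 * n))" using \<Lambda> by (subst exp_of_nat2_mult) auto
          then show ?thesis by (simp add: exp_add exp_diff exp_minus divide_inverse)
        qed
        also have "\<dots> = exp (n * (2 * ln \<Lambda> + 2 - c))" by (simp add: algebra_simps)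
        also have "\<dots> \<le> 1" using c(3) by (simp add: mult_nonneg_nonpos)
        finally show ?thesis .
      qed
      define a where "a j = log_norm f \<omega> z n (x j)" for j
      define b where "b j = log_norm f \<omega> z (2 * n) (x j)" for j
      have a_low: "n * (L E - \<tau>) - 1 \<le> a j" and b_low: "2 * (n * (L E - \<tau>)) - 1 \<le> b j" if "j < R" for j
        using low[OF that] perturb[of n "x j"] perturb[of "2 * n" "x j"] by (auto simp: a_def b_def)
      have a_up: "a j \<le> n * (L E + e) + 1" for j
        using upper[of n "x j"] perturb[of n "x j"] by (auto simp: a_def)
      have ne: "n * e \<le> n * \<tau> / 8" using mult_left_mono[OF e(2), of "real n"] by simp
      have nL: "20 * (n * \<tau>) \<le> n * L E" using mult_left_mono[OF \<tau>(2)[OF E], of "real n"] by simp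
      have A_exp: "opnorm (A j) = exp (a j)" for j by (simp add: A_def a_def opnorm_cocycle)
      have pair_exp: "opnorm (A (Suc j) ** A j) = exp (b j)" for j
      proof -
        have "x (Suc j) = x j + real n * \<omega>" by (simp add: x_def algebra_simps)
        then have "A (Suc j) ** A j = cocycle f \<omega> z (n + n) (x j)" by (simp add: A_def cocycle_add)
        then show ?thesis by (simp add: b_def opnorm_cocycle mult_2)
      qed
      have exp3: "8 \<le> exp (3::real)"
      proof -
        have "(2::real) ^ 3 \<le> exp 1 ^ 3" using exp_ge_add_one_self[of 1] by (intro power_mono) auto
        then show ?thesis by (simp flip: exp_of_nat_mult)
      qed
      \<comment> \<open>\<eta> = exp (- 5 n \<tau>) absorbs the defect of a pair against its two
        blocks, at most 2 n \<tau> + 2 n e + 3. As the exponent is at least 20 \<tau> = l, the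
        squared norms stay above 8 / \<eta>^3 and the rate n l / 2 survives the loss \<eta> /
        2.\<close>
      have chain: "exp (n * l / 2) ^ R \<le> opnorm (matrix_chain A R)"
      proof (rule avalanche[of R A "exp (- 5 * (n * \<tau>))"])
        fix j assume j: "j < R"
        show "det (A j) = 1" by (simp add: A_def det_cocycle)
        have cube: "exp (- 5 * (n * \<tau>)) ^ 3 = exp (- 15 * (n * \<tau>))" by (simp flip: exp_of_nat_mult)
        have "8 / exp (- 5 * (n * \<tau>)) ^ 3 \<le> exp 3 / exp (- 5 * (n * \<tau>)) ^ 3"
          using exp3 by (intro divide_right_mono) auto
        also have "\<dots> = exp (3 + 15 * (n * \<tau>))" unfolding cube by (simp flip: exp_diff)
        also have "\<dots> \<le> exp (2 * a j)"
          using a_low[OF j] nL n\<tau> by (simp add: algebra_simps)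
        also have "\<dots> = (opnorm (A j))\<^sup>2" by (simp add: A_exp exp_double)
        finally show "8 / exp (- 5 * (n * \<tau>)) ^ 3 \<le> (opnorm (A j))\<^sup>2" .
        have "exp (-1) \<le> (1/2 :: real)" using exp_ge_add_one_self[of 1] by (simp add: exp_minus field_simps)
        then have half: "exp (- 5 * (n * \<tau>)) * exp (-1) * exp (a j) \<le> exp (- 5 * (n * \<tau>)) * (1/2) * exp (a j)"
          by (intro mult_right_mono mult_left_mono) auto
        have "n * l / 2 \<le> - 5 * (n * \<tau>) + -1 + a j"
          using a_low[OF j] nL n\<tau> by (simp add: \<tau>_def algebra_simps)
        then have "exp (n * l / 2) \<le> exp (- 5 * (n * \<tau>)) * exp (-1) * exp (a j)"
          by (simp flip: exp_add)
        also note half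
        also have "exp (- 5 * (n * \<tau>)) * (1/2) * exp (a j) = exp (- 5 * (n * \<tau>)) / 2 * opnorm (A j)"
          by (simp add: A_exp)
        finally show "exp (n * l / 2) \<le> exp (- 5 * (n * \<tau>)) / 2 * opnorm (A j)" .
      next
        fix j assume j: "Suc j < R"
        have "- 5 * (n * \<tau>) + a (Suc j) + a j \<le> b j"
          using b_low[of j] a_up[of j] a_up[of "Suc j"] j ne n\<tau> by (simp add: algebra_simps)
        then show "exp (- 5 * (n * \<tau>)) * opnorm (A (Suc j)) * opnorm (A j) \<le> opnorm (A (Suc j) ** A j)"
          by (simp add: A_exp pair_exp flip: exp_add)
      qed (use \<tau>(1) in auto)
      moreover have "matrix_chain A k = cocycle f \<omega> z (k * n) (\<theta> + real i * \<omega>)" for k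
      proof (induction k)
        case (Suc k)
        have "x k = \<theta> + real i * \<omega> + real (k * n) * \<omega>" by (simp add: x_def algebra_simps)
        then have "matrix_chain A (Suc k) = cocycle f \<omega> z (k * n + n) (\<theta> + real i * \<omega>)"
          by (simp only: matrix_chain.simps Suc A_def cocycle_add)
        then show ?case by (simp add: add.commute)
      qed simp
      moreover have "exp (n * l / 2) ^ R = exp (real (R * n) * l / 2)"
        by (simp add: mult_ac flip: exp_of_nat_mult)
      ultimately have "exp (real (R * n) * l / 2) \<le> opnorm (cocycle f \<omega> (Complex E y) (R * n) (\<theta> + real i * \<omega>))"
        by (simp only: z_def)
      then show "\<exists>i. i + R * n \<le> q \<and>
        exp (real (R * n) * l / 2) \<le> opnorm (cocycle f \<omega> (Complex E y) (R * n) (\<theta> + real i * \<omega>))"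
        using i(1) by blast
    qed
  qed
qed

end


section \<open>Decay of solutions off a source\<close>

text \<open>Up to a constant factor, the Wronskian of u with its complex conjugate: a flux through
  the bond from j to j + 1.\<close>

definition current :: "(int \<Rightarrow> complex) \<Rightarrow> int \<Rightarrow> real" where
  "current u j = Im (cnj (u j) * u (j + 1))"

definition solves_at :: "(int \<Rightarrow> real) \<Rightarrow> complex \<Rightarrow> (int \<Rightarrow> complex) \<Rightarrow> int \<Rightarrow> bool" where
  "solves_at V z u i \<longleftrightarrow> u (i - 1) + u (i + 1) + complex_of_real (V i) * u i = z * u i"

lemma current_le: "\<bar>current u j\<bar> \<le> ((cmod (u j))\<^sup>2 + (cmod (u (j + 1)))\<^sup>2) / 2"
proof -
  have "\<bar>current u j\<bar> \<le> cmod (u j) * cmod (u (j + 1))"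
    unfolding current_def by (rule order_trans[OF abs_Im_le_cmod]) (simp add: norm_mult)
  also have "\<dots> \<le> ((cmod (u j))\<^sup>2 + (cmod (u (j + 1)))\<^sup>2) / 2"
    using sum_squares_bound[of "cmod (u j)" "cmod (u (j + 1))"] by simp
  finally show ?thesis .
qed

text \<open>Discrete Green identity: the real potential drops out and Im z is the only source of
  flux.\<close>

lemma current_step:
  assumes "solves_at V z u i"
  shows "current u i = current u (i - 1) + Im z * (cmod (u i))\<^sup>2"
proof -
  have *: "u (i + 1) = z * u i - complex_of_real (V i) * u i - u (i - 1)"
    using assms by (simp add: solves_at_def algebra_simps)
  show ?thesis
    unfolding current_def * cmod_power2 by (simp add: power2_eq_square algebra_simps)
qed

text \<open>Constancy of the Wronskian of two solutions at the same energy.\<close>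

lemma determinant_step:
  assumes "solves_at V z u i" "solves_at V z s i"
  shows "u (i + 1) * s i - u i * s (i + 1) = u i * s (i - 1) - u (i - 1) * s i"
proof -
  have *: "u (i + 1) = z * u i - complex_of_real (V i) * u i - u (i - 1)"
    "s (i + 1) = z * s i - complex_of_real (V i) * s i - s (i - 1)"
    using assms by (simp_all add: solves_at_def algebra_simps)
  show ?thesis unfolding * by (simp add: algebra_simps)
qed

lemma current_mono:
  assumes "a \<le> b" "\<And>i. a < i \<Longrightarrow> i \<le> b \<Longrightarrow> solves_at V z u i" "Im z \<ge> 0"
  shows "current u a \<le> current u b"
  using assms(1,2)
proof (induction b rule: int_ge_induct)
  case (step b)
  have "current u b \<le> current u (b + 1)"
    using current_step[OF step.prems[of "b + 1"]] step.hyps assms(3) by simp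
  then show ?case using step by force
qed simp

text \<open>Comparing the indefinite form \<^const>\<open>current\<close> on two vectors: if they are nearly parallel,
  i.e. if the determinant is small, the normalized values are close.\<close>

lemma current_comparison:
  fixes x1 x2 s1 s2 :: complex
  defines "D \<equiv> x1 * s2 - x2 * s1"
  shows "((cmod s1)\<^sup>2 + (cmod s2)\<^sup>2) * Im (cnj x2 * x1)
    \<le> ((cmod x1)\<^sup>2 + (cmod x2)\<^sup>2) * Im (cnj s2 * s1)
      + cmod D * (cmod x1 * cmod s1 + cmod x2 * cmod s2)"
proof -
  have 1: "(cmod s2)\<^sup>2 * Im (cnj x2 * x1) = (cmod x2)\<^sup>2 * Im (cnj s2 * s1) + Im (cnj (x2 * s2) * D)"
    unfolding D_def cmod_power2 by (simp add: power2_eq_square algebra_simps)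
  have 2: "(cmod s1)\<^sup>2 * Im (cnj x2 * x1) = (cmod x1)\<^sup>2 * Im (cnj s2 * s1) - Im (cnj D * (x1 * s1))"
    unfolding D_def cmod_power2 by (simp add: power2_eq_square algebra_simps)
  have "Im (cnj (x2 * s2) * D) \<le> cmod (cnj (x2 * s2) * D)" using abs_Im_le_cmod abs_le_D1 by blast
  moreover have "- Im (cnj D * (x1 * s1)) \<le> cmod (cnj D * (x1 * s1))"
    using abs_Im_le_cmod abs_le_D2 by blast
  ultimately have "(cmod s1)\<^sup>2 * Im (cnj x2 * x1) + (cmod s2)\<^sup>2 * Im (cnj x2 * x1)
    \<le> (cmod x1)\<^sup>2 * Im (cnj s2 * s1) + (cmod x2)\<^sup>2 * Im (cnj s2 * s1)
      + (cmod (cnj D * (x1 * s1)) + cmod (cnj (x2 * s2) * D))"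
    using 1 2 by linarith
  then show ?thesis by (simp add: norm_mult algebra_simps)
qed

lemma cauchy_schwarz2:
  fixes a b c d :: real
  shows "(a * c + b * d)\<^sup>2 \<le> (a\<^sup>2 + b\<^sup>2) * (c\<^sup>2 + d\<^sup>2)"
proof -
  have "(a\<^sup>2 + b\<^sup>2) * (c\<^sup>2 + d\<^sup>2) - (a * c + b * d)\<^sup>2 = (a * d - b * c)\<^sup>2"
    by (simp add: power2_eq_square algebra_simps)
  then show ?thesis by (smt (verit) zero_le_power2)
qed

section \<open>Square summable solutions to the left of a source, upper half plane\<close>

context
  fixes V :: "int \<Rightarrow> real" and z :: complex and u :: "int \<Rightarrow> complex" and m :: int and M :: real
  assumes solves: "\<And>i. i < m \<Longrightarrow> solves_at V z u i"
    and y: "Im z > 0"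
    and square_sum: "\<And>F. finite F \<Longrightarrow> (\<Sum>i\<in>F. (cmod (u i))\<^sup>2) \<le> M\<^sup>2"
begin

lemma pair_le: "(cmod (u i))\<^sup>2 + (cmod (u (i + 1)))\<^sup>2 \<le> M\<^sup>2"
  using square_sum[of "{i, i + 1}"] by simp

lemma current_left_mono: "a \<le> b \<Longrightarrow> b < m \<Longrightarrow> current u a \<le> current u b"
  using solves y by (intro current_mono[of _ _ V z]) auto

text \<open>By monotonicity a negative value would persist at all sites further left and keep |u
  j|^2 + |u (j + 1)|^2 above a positive constant there, against square summability.\<close>

lemma current_nonneg:
  assumes j: "j < m"
  shows "0 \<le> current u j"
proof (rule ccontr)
  assume "\<not> 0 \<le> current u j"
  define c where "c = - current u j"
  have c: "c > 0" using \<open>\<not> 0 \<le> current u j\<close> by (simp add: c_def)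
  have *: "2 * c \<le> (cmod (u (j - int k)))\<^sup>2 + (cmod (u (j - int k + 1)))\<^sup>2" for k
    using current_left_mono[of "j - int k" j] j current_le[of u "j - int k"] by (simp add: c_def)
  have inj: "inj_on (\<lambda>k. j - int k) {..<n}" "inj_on (\<lambda>k. j - int k + 1) {..<n}" for n
    by (auto intro!: inj_onI)
  have le: "real n * (2 * c) \<le> 2 * M\<^sup>2" for n
  proof -
    have "real n * (2 * c) = (\<Sum>k<n. 2 * c)" by simp
    also have "\<dots> \<le> (\<Sum>k<n. (cmod (u (j - int k)))\<^sup>2 + (cmod (u (j - int k + 1)))\<^sup>2)"
      by (intro sum_mono *)
    also have "\<dots> = (\<Sum>i\<in>(\<lambda>k. j - int k) ` {..<n}. (cmod (u i))\<^sup>2)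
        + (\<Sum>i\<in>(\<lambda>k. j - int k + 1) ` {..<n}. (cmod (u i))\<^sup>2)"
      by (simp add: sum.distrib sum.reindex[OF inj(1)] sum.reindex[OF inj(2)])
    also have "\<dots> \<le> M\<^sup>2 + M\<^sup>2" by (intro add_mono square_sum) auto
    finally show ?thesis by simp
  qed
  obtain n where "M\<^sup>2 / c < real n" using reals_Archimedean2 by blast
  then show False using le[of n] c by (simp add: field_simps)
qed

lemma coord_le_current:
  assumes "e < m"
  shows "Im z * (cmod (u e))\<^sup>2 \<le> current u e"
  using current_step[OF solves[OF assms]] current_nonneg[of "e - 1"] assms by simp

text \<open>Over two sites the flux gains Im z times the mass of a neighbouring pair, and that mass
  is at least twice the flux at the outset.\<close>

lemma current_growth: "(1 + 2 * Im z) ^ k * current u (m - 1 - 2 * int k) \<le> M\<^sup>2"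
proof (induction k)
  case 0
  have "0 \<le> (cmod (u (m - 1)))\<^sup>2 + (cmod (u m))\<^sup>2" by simp
  then show ?case using current_le[of u "m - 1"] pair_le[of "m - 1"] by simp
next
  case (Suc k)
  define j where "j = m - 1 - 2 * int k"
  have j: "j < m" "m - 1 - 2 * int (Suc k) = j - 2" by (auto simp: j_def)
  have "current u j = current u (j - 1) + Im z * (cmod (u j))\<^sup>2"
    "current u (j - 1) = current u (j - 2) + Im z * (cmod (u (j - 1)))\<^sup>2"
    using current_step[OF solves[of j]] current_step[OF solves[of "j - 1"]] j by simp_all
  then have "current u j = current u (j - 2) + Im z * ((cmod (u (j - 1)))\<^sup>2 + (cmod (u j))\<^sup>2)"
    by (simp add: algebra_simps)
  moreover have "Im z * (2 * current u (j - 2)) \<le> Im z * ((cmod (u (j - 1)))\<^sup>2 + (cmod (u j))\<^sup>2)"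
    using current_le[of u "j - 1"] current_left_mono[of "j - 2" "j - 1"] j y
    by (intro mult_left_mono) auto
  ultimately have "(1 + 2 * Im z) * current u (j - 2) \<le> current u j" by (simp add: algebra_simps)
  then have "(1 + 2 * Im z) ^ k * ((1 + 2 * Im z) * current u (j - 2)) \<le> (1 + 2 * Im z) ^ k * current u j"
    using y by (intro mult_left_mono) auto
  then show ?case using Suc j by (simp add: j_def mult_ac)
qed

text \<open>A bound of Combes-Thomas type obtained from the flux alone. Its rate is of order Im z
  whatever the potential; it supplies summability in the distance.\<close>

lemma exponential_decay:
  assumes "e \<le> m - 1 - 2 * int k"
  shows "(cmod (u e))\<^sup>2 \<le> M\<^sup>2 / (Im z * (1 + 2 * Im z) ^ k)"
proof -
  have "(1 + 2 * Im z) ^ k * (Im z * (cmod (u e))\<^sup>2) \<le> (1 + 2 * Im z) ^ k * current u (m - 1 - 2 * int k)"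
    using y coord_le_current[of e] current_left_mono[OF assms] assms by (intro mult_left_mono) auto
  also have "\<dots> \<le> M\<^sup>2" by (rule current_growth)
  finally show ?thesis using y by (simp add: field_simps)
qed

text \<open>At a the flux of u is at least of order Im z |u|^2, while that of s is at most 1 / (2
  S^2), since it can only grow towards b, where s is small. So u is transversal to s and their
  Wronskian at a is at least of order Im z |u|. At b the same Wronskian is at most M / S. Hence u is
  small at a, and by monotonicity of the flux at every site further left.\<close>

lemma block_decay:
  assumes eab: "e \<le> a" "a \<le> b" "b < m"
    and s: "\<And>i. a < i \<Longrightarrow> i \<le> b \<Longrightarrow> solves_at V z s i"
    and sa: "(cmod (s a))\<^sup>2 + (cmod (s (a + 1)))\<^sup>2 = 1"
    and sb: "(cmod (s b))\<^sup>2 + (cmod (s (b + 1)))\<^sup>2 \<le> 1 / S\<^sup>2"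
    and L: "\<And>i. cmod (z - of_real (V i)) \<le> L"
    and S: "S > 0" "S\<^sup>2 \<ge> (2 * L\<^sup>2 + 3) / Im z"
  shows "(cmod (u e))\<^sup>2 \<le> 2 * (2 * L\<^sup>2 + 3)\<^sup>2 * M\<^sup>2 / (S\<^sup>2 * Im z ^ 3)"
proof -
  define C where "C = 2 * L\<^sup>2 + 3"
  have C: "C > 0" by (simp add: C_def add_nonneg_pos)
  define X where "X = (cmod (u a))\<^sup>2 + (cmod (u (a + 1)))\<^sup>2"
  define D where "D j = u (j + 1) * s j - u j * s (j + 1)" for j
  have am: "a < m" using eab by simp
  have X0: "X \<ge> 0" by (simp add: X_def)
  \<comment> \<open>The recurrence bounds u (a + 1) by u a and u (a - 1), so the flux controls the
    whole pair at a; 2 L^2 + 3 dominates both coefficients 2 L^2 + 1 and 2.\<close>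
  have Xw: "Im z * X \<le> C * current u a"
  proof -
    have L0: "L \<ge> 0" using L[of 0] norm_ge_zero order_trans by blast
    have "u (a + 1) = (z - of_real (V a)) * u a - u (a - 1)"
      using solves[OF am] by (simp add: solves_at_def algebra_simps)
    then have "cmod (u (a + 1)) \<le> L * cmod (u a) + cmod (u (a - 1))"
      using norm_triangle_ineq4[of "(z - of_real (V a)) * u a" "u (a - 1)"]
        mult_right_mono[OF L[of a] norm_ge_zero[of "u a"]] by (simp add: norm_mult)
    then have "(cmod (u (a + 1)))\<^sup>2 \<le> (L * cmod (u a) + cmod (u (a - 1)))\<^sup>2"
      by (intro power_mono) auto
    also have "\<dots> \<le> 2 * (L * cmod (u a))\<^sup>2 + 2 * (cmod (u (a - 1)))\<^sup>2"
      using sum_squares_bound[of "L * cmod (u a)" "cmod (u (a - 1))"] by (simp add: power2_sum)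
    finally have "X \<le> (2 * L\<^sup>2 + 1) * (cmod (u a))\<^sup>2 + 2 * (cmod (u (a - 1)))\<^sup>2"
      by (simp add: X_def power_mult_distrib algebra_simps)
    also have "\<dots> \<le> C * (cmod (u a))\<^sup>2 + C * (cmod (u (a - 1)))\<^sup>2"
      by (intro add_mono mult_right_mono) (auto simp: C_def)
    finally have "Im z * X \<le> Im z * (C * (cmod (u a))\<^sup>2 + C * (cmod (u (a - 1)))\<^sup>2)"
      using y by (intro mult_left_mono) auto
    also have "\<dots> = C * (Im z * (cmod (u a))\<^sup>2 + Im z * (cmod (u (a - 1)))\<^sup>2)"
      by (simp add: algebra_simps)
    also have "\<dots> \<le> C * current u a"
      using current_step[OF solves[OF am]] coord_le_current[of "a - 1"] am C
      by (intro mult_left_mono) auto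
    finally show ?thesis .
  qed
  have sw: "current s a \<le> 1 / (2 * S\<^sup>2)"
    using current_mono[OF eab(2) s] y current_le[of s b] sb by force
  have Dab: "D a = D b"
    using eab(2) s eab(3)
  proof (induction b rule: int_ge_induct)
    case (step b)
    have "D (b + 1) = D b"
      using determinant_step[OF solves[of "b + 1"] step.prems(1)[of "b + 1"]] step by (simp add: D_def)
    then show ?case using step by auto
  qed simp
  have sa': "cmod (u (a+1)) * cmod (s (a+1)) + cmod (u a) * cmod (s a) \<le> sqrt X"
  proof (rule real_le_rsqrt)
    have "(cmod (u (a+1)) * cmod (s (a+1)) + cmod (u a) * cmod (s a))\<^sup>2
      \<le> ((cmod (u (a+1)))\<^sup>2 + (cmod (u a))\<^sup>2) * ((cmod (s (a+1)))\<^sup>2 + (cmod (s a))\<^sup>2)"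
      by (rule cauchy_schwarz2)
    also have "(cmod (s (a+1)))\<^sup>2 + (cmod (s a))\<^sup>2 = 1" using sa by simp
    finally show "(cmod (u (a+1)) * cmod (s (a+1)) + cmod (u a) * cmod (s a))\<^sup>2 \<le> X"
      by (simp add: X_def)
  qed
  have "current u a \<le> X * current s a + cmod (D a) * (cmod (u (a+1)) * cmod (s (a+1)) + cmod (u a) * cmod (s a))"
    using current_comparison[of "s (a + 1)" "s a" "u a" "u (a + 1)"] sa
    by (simp add: current_def D_def X_def add.commute)
  also have "\<dots> \<le> X * (1 / (2 * S\<^sup>2)) + cmod (D a) * sqrt X"
    using X0 sw sa' by (intro add_mono mult_left_mono) auto
  finally have 1: "C * current u a \<le> C * (X * (1 / (2 * S\<^sup>2)) + cmod (D a) * sqrt X)"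
    using C by (intro mult_left_mono) auto
  \<comment> \<open>The size condition on S lets half of the left side of \<open>Xw\<close> absorb
    the flux of s.\<close>
  have "C \<le> Im z * S\<^sup>2" using S(2) y by (simp add: C_def field_simps)
  then have "C * (1 / (2 * S\<^sup>2)) \<le> Im z / 2" using S(1) by (simp add: field_simps)
  then have "C * (1 / (2 * S\<^sup>2)) * X \<le> Im z / 2 * X" using X0 by (intro mult_right_mono)
  then have "Im z / 2 * X \<le> C * cmod (D a) * sqrt X"
    using 1 Xw by (simp add: algebra_simps)
  then have "sqrt X * (Im z / 2 * sqrt X) \<le> sqrt X * (C * cmod (D a))"
    using X0 by (simp add: mult_ac flip: power2_eq_square)
  then have "Im z / 2 * sqrt X \<le> C * cmod (D a)"
    using X0 C by (cases "X = 0") auto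
  then have "(Im z / 2 * sqrt X)\<^sup>2 \<le> (C * cmod (D a))\<^sup>2"
    using y X0 by (intro power_mono) auto
  then have 2: "(Im z)\<^sup>2 * X / 4 \<le> C\<^sup>2 * (cmod (D a))\<^sup>2"
    using X0 by (simp add: power_mult_distrib power_divide)
  have "(cmod (D a))\<^sup>2 \<le> M\<^sup>2 / S\<^sup>2"
  proof -
    have "cmod (D b) \<le> cmod (u (b+1)) * cmod (s b) + cmod (u b) * cmod (s (b+1))"
      unfolding D_def by (rule order_trans[OF norm_triangle_ineq4]) (simp add: norm_mult)
    then have "(cmod (D b))\<^sup>2 \<le> (cmod (u (b+1)) * cmod (s b) + cmod (u b) * cmod (s (b+1)))\<^sup>2"
      by (intro power_mono) auto
    also have "\<dots> \<le> ((cmod (u (b+1)))\<^sup>2 + (cmod (u b))\<^sup>2) * ((cmod (s b))\<^sup>2 + (cmod (s (b+1)))\<^sup>2)"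
      by (rule cauchy_schwarz2)
    also have "\<dots> \<le> M\<^sup>2 * (1 / S\<^sup>2)"
      using pair_le[of b] sb by (intro mult_mono) auto
    finally show ?thesis by (simp add: Dab)
  qed
  then have "C\<^sup>2 * (cmod (D a))\<^sup>2 \<le> C\<^sup>2 * (M\<^sup>2 / S\<^sup>2)" by (intro mult_left_mono) auto
  with 2 have 3: "(Im z)\<^sup>2 * X / 4 \<le> C\<^sup>2 * (M\<^sup>2 / S\<^sup>2)" by linarith
  have "Im z * (cmod (u e))\<^sup>2 \<le> current u a"
    using coord_le_current[of e] current_left_mono[OF eab(1)] eab by auto
  also have "\<dots> \<le> X / 2" using current_le[of u a] by (simp add: X_def)
  finally have "(Im z)\<^sup>2 * (Im z * (cmod (u e))\<^sup>2) \<le> (Im z)\<^sup>2 * (X / 2)" by (intro mult_left_mono) auto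
  then have "Im z ^ 3 * (cmod (u e))\<^sup>2 \<le> 2 * ((Im z)\<^sup>2 * X / 4)"
    by (simp add: power2_eq_square power3_eq_cube mult_ac)
  also have "\<dots> \<le> 2 * (C\<^sup>2 * (M\<^sup>2 / S\<^sup>2))" using 3 by linarith
  finally have "Im z ^ 3 * (cmod (u e))\<^sup>2 \<le> 2 * C\<^sup>2 * (M\<^sup>2 / S\<^sup>2)" by simp
  then show ?thesis unfolding C_def[symmetric] using y S(1) by (simp add: field_simps)
qed

end

lemma solves_at_reflect: "solves_at (\<lambda>i. V (- i)) z (\<lambda>i. u (- i)) i \<longleftrightarrow> solves_at V z u (- i)"
proof -
  have "- (i - 1) = - i + 1" "- (i + 1) = - i - 1" by simp_all
  then show ?thesis unfolding solves_at_def by (simp only: add.commute add.left_commute)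
qed

lemma solves_at_cnj:
  assumes "solves_at V z u i"
  shows "solves_at V (cnj z) (\<lambda>i. cnj (u i)) i"
  using arg_cong[OF assms[unfolded solves_at_def], of cnj] by (simp add: solves_at_def)

lemma sum_reflect_le:
  fixes u :: "int \<Rightarrow> complex"
  assumes "\<And>F. finite F \<Longrightarrow> (\<Sum>i\<in>F. (cmod (u i))\<^sup>2) \<le> M" "finite F"
  shows "(\<Sum>i\<in>F. (cmod (u (- i)))\<^sup>2) \<le> M"
proof -
  have "(\<Sum>i\<in>F. (cmod (u (- i)))\<^sup>2) = (\<Sum>i\<in>uminus ` F. (cmod (u i))\<^sup>2)"
    by (subst sum.reindex) auto
  then show ?thesis using assms by simp
qed

text \<open>The case of negative imaginary part is reduced to the positive one by complex conjugation.\<close>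

lemma left_decay:
  fixes u :: "int \<Rightarrow> complex"
  assumes solves: "\<And>i. i < m \<Longrightarrow> solves_at V z u i" and y: "Im z \<noteq> 0"
    and square_sum: "\<And>F. finite F \<Longrightarrow> (\<Sum>i\<in>F. (cmod (u i))\<^sup>2) \<le> M\<^sup>2"
  shows left_exponential_decay: "e \<le> m - 1 - 2 * int k \<Longrightarrow>
      (cmod (u e))\<^sup>2 \<le> M\<^sup>2 / (\<bar>Im z\<bar> * (1 + 2 * \<bar>Im z\<bar>) ^ k)"
    and left_block_decay: "e \<le> a \<Longrightarrow> a \<le> b \<Longrightarrow> b < m \<Longrightarrow>
      (\<And>i. a < i \<Longrightarrow> i \<le> b \<Longrightarrow> solves_at V z s i) \<Longrightarrow>
      (cmod (s a))\<^sup>2 + (cmod (s (a + 1)))\<^sup>2 = 1 \<Longrightarrow>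
      (cmod (s b))\<^sup>2 + (cmod (s (b + 1)))\<^sup>2 \<le> 1 / S\<^sup>2 \<Longrightarrow>
      (\<And>i. cmod (z - of_real (V i)) \<le> L) \<Longrightarrow> S > 0 \<Longrightarrow> S\<^sup>2 \<ge> (2 * L\<^sup>2 + 3) / \<bar>Im z\<bar> \<Longrightarrow>
      (cmod (u e))\<^sup>2 \<le> 2 * (2 * L\<^sup>2 + 3)\<^sup>2 * M\<^sup>2 / (S\<^sup>2 * \<bar>Im z\<bar> ^ 3)"
proof -
  have cnj_solves: "\<And>i. i < m \<Longrightarrow> solves_at V (cnj z) (\<lambda>i. cnj (u i)) i" using solves solves_at_cnj by blast
  have cnj_sum: "\<And>F. finite F \<Longrightarrow> (\<Sum>i\<in>F. (cmod (cnj (u i)))\<^sup>2) \<le> M\<^sup>2" using square_sum by simp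
  show "(cmod (u e))\<^sup>2 \<le> M\<^sup>2 / (\<bar>Im z\<bar> * (1 + 2 * \<bar>Im z\<bar>) ^ k)" if "e \<le> m - 1 - 2 * int k"
  proof (cases "Im z > 0")
    case True
    then show ?thesis using exponential_decay[OF solves True square_sum that] by simp
  next
    case False
    then have "Im (cnj z) > 0" using y by simp
    from exponential_decay[OF cnj_solves this cnj_sum that] False show ?thesis by simp
  qed
  show "(cmod (u e))\<^sup>2 \<le> 2 * (2 * L\<^sup>2 + 3)\<^sup>2 * M\<^sup>2 / (S\<^sup>2 * \<bar>Im z\<bar> ^ 3)"
    if *: "e \<le> a" "a \<le> b" "b < m" "\<And>i. a < i \<Longrightarrow> i \<le> b \<Longrightarrow> solves_at V z s i"
      "(cmod (s a))\<^sup>2 + (cmod (s (a + 1)))\<^sup>2 = 1" "(cmod (s b))\<^sup>2 + (cmod (s (b + 1)))\<^sup>2 \<le> 1 / S\<^sup>2"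
      "\<And>i. cmod (z - of_real (V i)) \<le> L" "S > 0" "S\<^sup>2 \<ge> (2 * L\<^sup>2 + 3) / \<bar>Im z\<bar>"
  proof (cases "Im z > 0")
    case True
    then show ?thesis using block_decay[OF solves True square_sum *(1-8)] *(9) by simp
  next
    case False
    then have pos: "Im (cnj z) > 0" using y by simp
    have L: "cmod (cnj z - of_real (V i)) \<le> L" for i
      using *(7)[of i] complex_mod_cnj[of "z - of_real (V i)"] by simp
    have "(cmod (cnj (u e)))\<^sup>2 \<le> 2 * (2 * L\<^sup>2 + 3)\<^sup>2 * M\<^sup>2 / (S\<^sup>2 * Im (cnj z) ^ 3)"
    proof (rule block_decay[OF cnj_solves pos cnj_sum *(1-3), where s = "\<lambda>i. cnj (s i)"])
      show "solves_at V (cnj z) (\<lambda>i. cnj (s i)) i" if "a < i" "i \<le> b" for i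
        using *(4)[OF that] by (rule solves_at_cnj)
    qed (use * L False in simp_all)
    then show ?thesis using False by simp
  qed
qed

text \<open>The cocycle acts on values at neighbouring sites, the right one in the first component,
  so v holds the values at c and c - 1. The recurrence holds from site c on; to the left of c - 1
  truncation by \<open>nat\<close> makes the function constant.\<close>

definition block_solution :: "(real \<Rightarrow> real) \<Rightarrow> real \<Rightarrow> real \<Rightarrow> complex \<Rightarrow> int \<Rightarrow> complex^2 \<Rightarrow> int \<Rightarrow> complex" where
  "block_solution f \<omega> \<theta> z c v i = (cocycle f \<omega> z (nat (i - (c - 1))) (\<theta> + of_int c * \<omega>) *v v) $ 2"

lemma cocycle_Suc_components:
  "(cocycle f \<omega> z (Suc k) x *v v) $ 1
    = (z - of_real (f (x + real k * \<omega>))) * (cocycle f \<omega> z k x *v v) $ 1 - (cocycle f \<omega> z k x *v v) $ 2"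
  "(cocycle f \<omega> z (Suc k) x *v v) $ 2 = (cocycle f \<omega> z k x *v v) $ 1"
  by (simp_all add: matrix_vector_2 transfer_matrix_def flip: matrix_vector_mul_assoc)

lemma block_solution_solves:
  assumes "c \<le> i"
  shows "solves_at (\<lambda>i. f (of_int i * \<omega> + \<theta>)) z (block_solution f \<omega> \<theta> z c v) i"
proof -
  define k where "k = nat (i - c)"
  have i: "i = c + int k" using assms by (simp add: k_def)
  have n: "nat (i - 1 - (c - 1)) = k" "nat (i - (c - 1)) = Suc k" "nat (i + 1 - (c - 1)) = Suc (Suc k)"
    by (auto simp: i)
  have ph: "\<theta> + of_int c * \<omega> + real k * \<omega> = of_int i * \<omega> + \<theta>" by (simp add: i algebra_simps)
  show ?thesis
    unfolding solves_at_def block_solution_def n cocycle_Suc_components ph by (simp add: algebra_simps)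
qed

lemma block_solution_ends:
  "(cmod (block_solution f \<omega> \<theta> z c v (c - 1)))\<^sup>2 + (cmod (block_solution f \<omega> \<theta> z c v c))\<^sup>2 = (norm v)\<^sup>2"
  "(cmod (block_solution f \<omega> \<theta> z c v (c + int k - 1)))\<^sup>2 + (cmod (block_solution f \<omega> \<theta> z c v (c + int k)))\<^sup>2
    = (norm (cocycle f \<omega> z k (\<theta> + of_int c * \<omega>) *v v))\<^sup>2"
proof -
  have k: "(cmod (block_solution f \<omega> \<theta> z c v (c + int k - 1)))\<^sup>2 + (cmod (block_solution f \<omega> \<theta> z c v (c + int k)))\<^sup>2
    = (norm (cocycle f \<omega> z k (\<theta> + of_int c * \<omega>) *v v))\<^sup>2" for k
  proof -
    have n: "nat (c + int k - 1 - (c - 1)) = k" "nat (c + int k - (c - 1)) = Suc k" by auto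
    show ?thesis unfolding block_solution_def n cocycle_Suc_components(2) norm2_sq by simp
  qed
  show "(cmod (block_solution f \<omega> \<theta> z c v (c + int k - 1)))\<^sup>2 + (cmod (block_solution f \<omega> \<theta> z c v (c + int k)))\<^sup>2
    = (norm (cocycle f \<omega> z k (\<theta> + of_int c * \<omega>) *v v))\<^sup>2" by (rule k)
  show "(cmod (block_solution f \<omega> \<theta> z c v (c - 1)))\<^sup>2 + (cmod (block_solution f \<omega> \<theta> z c v c))\<^sup>2 = (norm v)\<^sup>2"
    using k[of 0] by simp
qed

text \<open>One good block anywhere between e and the source is enough. To the left of the source
  its contracted vector provides the comparison solution. To the right, the lattice is reflected,
  the block is crossed backwards, and the expanded vector takes that place.\<close>

lemma growth_decay:
  fixes u :: "int \<Rightarrow> complex"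
  assumes solves: "\<And>i. i \<noteq> m \<Longrightarrow> solves_at (\<lambda>i. f (of_int i * \<omega> + \<theta>)) z u i" and y: "Im z \<noteq> 0"
    and square_sum: "\<And>F. finite F \<Longrightarrow> (\<Sum>i\<in>F. (cmod (u i))\<^sup>2) \<le> M\<^sup>2"
    and L: "\<And>x. cmod (z - of_real (f x)) \<le> L" and S: "S > 0" "S\<^sup>2 \<ge> (2 * L\<^sup>2 + 3) / \<bar>Im z\<bar>"
    and growth: "S \<le> opnorm (cocycle f \<omega> z k (\<theta> + of_int c * \<omega>))" and k: "k \<ge> 1"
    and pos: "e < c \<and> c + int k \<le> m \<or> m < c \<and> c + int k \<le> e"
  shows "(cmod (u e))\<^sup>2 \<le> 2 * (2 * L\<^sup>2 + 3)\<^sup>2 * M\<^sup>2 / (S\<^sup>2 * \<bar>Im z\<bar> ^ 3)"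
proof -
  define A where "A = cocycle f \<omega> z k (\<theta> + of_int c * \<omega>)"
  have A: "det A = 1" by (simp add: A_def det_cocycle)
  have inv: "(1 / opnorm A)\<^sup>2 \<le> 1 / S\<^sup>2"
    using growth S(1) by (simp add: A_def power_divide frac_le power_mono)
  show ?thesis
    using pos
  proof
    assume pos: "e < c \<and> c + int k \<le> m"
    obtain v where v: "norm v = 1" "norm (A *v v) \<le> 1 / opnorm A" using contracted_vector[OF A] by blast
    have "(norm (A *v v))\<^sup>2 \<le> 1 / S\<^sup>2" using v(2) inv power_mono[OF v(2), of 2] by simp
    then show ?thesis
      using left_block_decay[OF solves y square_sum, of m e "c - 1" "c + int k - 1"
          "block_solution f \<omega> \<theta> z c v" S L] pos k v(1) block_solution_solves[of c _ f \<omega> \<theta> z v] L S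
        block_solution_ends[of f \<omega> \<theta> z c v] unfolding A_def by auto
  next
    assume pos: "m < c \<and> c + int k \<le> e"
    obtain v where v: "norm v = 1 / opnorm A" "norm (A *v v) = 1" using expanded_vector[OF A] by blast
    define s where "s i = block_solution f \<omega> \<theta> z c v (- i)" for i
    have "(cmod (u (- (- e))))\<^sup>2 \<le> 2 * (2 * L\<^sup>2 + 3)\<^sup>2 * M\<^sup>2 / (S\<^sup>2 * \<bar>Im z\<bar> ^ 3)"
    proof (rule left_block_decay[where m = "- m" and V = "\<lambda>i. f (of_int (- i) * \<omega> + \<theta>)" and u = "\<lambda>i. u (- i)"
          and a = "- (c + int k)" and b = "- c" and s = s, OF _ y])
      show "solves_at (\<lambda>i. f (of_int (- i) * \<omega> + \<theta>)) z (\<lambda>i. u (- i)) i" if "i < - m" for i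
        using solves[of "- i"] that solves_at_reflect[of "\<lambda>i. f (of_int i * \<omega> + \<theta>)" z u i] by simp
      show "(\<Sum>i\<in>F. (cmod (u (- i)))\<^sup>2) \<le> M\<^sup>2" if "finite F" for F
        using square_sum that by (rule sum_reflect_le)
      show "solves_at (\<lambda>i. f (of_int (- i) * \<omega> + \<theta>)) z s i" if "- (c + int k) < i" "i \<le> - c" for i
        unfolding s_def solves_at_reflect[of "\<lambda>i. f (of_int i * \<omega> + \<theta>)"] using that by (intro block_solution_solves) simp
      have "- (- (c + int k) + 1) = c + int k - 1" by simp
      then show "(cmod (s (- (c + int k))))\<^sup>2 + (cmod (s (- (c + int k) + 1)))\<^sup>2 = 1"
        using block_solution_ends(2)[of f \<omega> \<theta> z c v k] v(2) by (simp add: s_def A_def add.commute)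
      have "- (- c + 1) = c - 1" by simp
      then show "(cmod (s (- c)))\<^sup>2 + (cmod (s (- c + 1)))\<^sup>2 \<le> 1 / S\<^sup>2"
        using block_solution_ends(1)[of f \<omega> \<theta> z c v] v(1) inv by (simp add: s_def add.commute)
    qed (use pos k L S in simp_all)
    then show ?thesis by simp
  qed
qed

lemma two_sided_exponential_decay:
  fixes u :: "int \<Rightarrow> complex"
  assumes solves: "\<And>i. i \<noteq> m \<Longrightarrow> solves_at V z u i" and y: "Im z \<noteq> 0"
    and square_sum: "\<And>F. finite F \<Longrightarrow> (\<Sum>i\<in>F. (cmod (u i))\<^sup>2) \<le> M\<^sup>2"
    and pos: "1 + 2 * int k \<le> \<bar>e - m\<bar>"
  shows "(cmod (u e))\<^sup>2 \<le> M\<^sup>2 / (\<bar>Im z\<bar> * (1 + 2 * \<bar>Im z\<bar>) ^ k)"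
proof (cases "e < m")
  case True
  then show ?thesis using left_exponential_decay[OF solves y square_sum, of m e k] pos by auto
next
  case False
  have "(cmod (u (- (- e))))\<^sup>2 \<le> M\<^sup>2 / (\<bar>Im z\<bar> * (1 + 2 * \<bar>Im z\<bar>) ^ k)"
  proof (rule left_exponential_decay[where m = "- m" and V = "\<lambda>i. V (- i)" and u = "\<lambda>i. u (- i)", OF _ y])
    show "solves_at (\<lambda>i. V (- i)) z (\<lambda>i. u (- i)) i" if "i < - m" for i
      using solves[of "- i"] that solves_at_reflect[of V z u i] by simp
    show "(\<Sum>i\<in>F. (cmod (u (- i)))\<^sup>2) \<le> M\<^sup>2" if "finite F" for F
      using square_sum that by (rule sum_reflect_le)
  qed (use False pos in simp)
  then show ?thesis by simp
qed


section \<open>Resolvent and evolution of a bounded self-adjoint operator\<close>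

lemma cscale_cscale: "cscale a (cscale b u) = cscale (a * b) u"
  by transfer (simp add: fun_eq_iff)

lemma cscale_one [simp]: "cscale 1 u = u"
  by transfer (simp add: fun_eq_iff)

lemma cscale_add_right: "cscale a (u + v) = cscale a u + cscale a v"
  by transfer (simp add: fun_eq_iff algebra_simps)

lemma cscale_diff_right: "cscale a (u - v) = cscale a u - cscale a v"
  by transfer (simp add: fun_eq_iff algebra_simps)

lemma cscale_diff_left: "cscale (a - b) u = cscale a u - cscale b u"
  by transfer (simp add: fun_eq_iff algebra_simps)

lemma scaleR_eq_cscale: "r *\<^sub>R u = cscale (complex_of_real r) u"
  by (rule scaleR_ell2_def)

lemma cinner_commute: "cinner v u = cnj (cinner u v)"
  by (simp add: cinner_def mult.commute flip: infsum_cnj)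

lemma cinner_add_left: "cinner (u + v) w = cinner u w + cinner v w"
  unfolding cinner_def plus_ell2.rep_eq distrib_right
  by (intro infsum_add summable_coord_prod)

lemma cinner_cscale_left: "cinner (cscale c u) v = c * cinner u v"
  unfolding cinner_def cscale.rep_eq mult.assoc
  by (intro infsum_cmult_right summable_coord_prod)

lemma Re_cinner_self: "Re (cinner u u) = (norm u)\<^sup>2"
  by (simp add: power2_norm_eq_inner inner_ell2_def)

lemma cmod_cinner_le: "cmod (cinner u v) \<le> norm u * norm v"
proof (cases "cinner u v = 0")
  case False
  define c where "c = cnj (cinner u v) / of_real (cmod (cinner u v))"
  have "cnj (cinner u v) * cinner u v = of_real (cmod (cinner u v)) * of_real (cmod (cinner u v))"
    by (metis complex_norm_square mult.commute of_real_power power2_eq_square)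
  then have "cinner (cscale c u) v = of_real (cmod (cinner u v))"
    using False unfolding cinner_cscale_left c_def by simp
  then have "cmod (cinner u v) = inner (cscale c u) v" by (simp add: inner_ell2_def)
  also have "\<dots> \<le> norm (cscale c u) * norm v" by (rule norm_cauchy_schwarz)
  also have "norm (cscale c u) = norm u"
    using False by (simp add: norm_cscale c_def norm_divide)
  finally show ?thesis .
qed simp

lemma bounded_linear_coord: "bounded_linear (\<lambda>u. coord u n)"
  by (rule bounded_linear_intro[of _ 1])
    (auto simp: plus_ell2.rep_eq scaleR_eq_cscale cscale.rep_eq scaleR_conv_of_real norm_coord_le)

lemma cinner_delta: "cinner u (delta n) = coord u n"
proof -
  have "cinner u (delta n) = (\<Sum>\<^sub>\<infinity>i\<in>{n}. coord u i * cnj (coord (delta n) i))"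
    unfolding cinner_def by (rule infsum_cong_neutral) (auto simp: delta.rep_eq)
  then show ?thesis by (simp add: delta.rep_eq)
qed

lemma norm_delta: "norm (delta n) = 1"
proof -
  have "(norm (delta n))\<^sup>2 = Re (coord (delta n) n)"
    unfolding Re_cinner_self[symmetric] cinner_delta ..
  then show ?thesis using norm_ge_zero[of "delta n"] by (auto simp: delta.rep_eq power2_eq_1_iff)
qed

locale bounded_selfadjoint =
  fixes H :: "'a ell2 \<Rightarrow> 'a ell2" and B :: real
  assumes H_add: "H (u + v) = H u + H v"
    and H_cscale: "H (cscale c u) = cscale c (H u)"
    and H_bound: "norm (H u) \<le> B * norm u"
    and H_sym: "cinner (H u) v = cinner u (H v)"
    and B_pos: "B > 0"
begin

lemma H_diff: "H (u - v) = H u - H v"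
  using H_add[of "u - v" v] by simp

section \<open>Invertibility of H - z off the real axis and for large z\<close>

definition bounded_below :: "complex \<Rightarrow> real \<Rightarrow> bool" where
  "bounded_below z c \<longleftrightarrow> c > 0 \<and> (\<forall>u. c * norm u \<le> norm (H u - cscale z u))"

text \<open>H being symmetric, the imaginary part of the inner product of (H - z) u with u is - Im z
  |u|^2.\<close>

lemma bounded_below_Im:
  assumes "Im z \<noteq> 0"
  shows "bounded_below z \<bar>Im z\<bar>"
  unfolding bounded_below_def
proof (intro conjI allI)
  fix u
  have "cnj (cinner (H u) u) = cinner (H u) u" using H_sym[of u u] cinner_commute[of u "H u"] by simp
  then have "Im (cinner (H u) u) = 0" by (metis Im_complex_of_real Reals_cnj_iff complex_is_Real_iff)
  moreover have "Im (cinner u u) = 0" using cinner_commute[of u u] by (simp add: complex_eq_iff)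
  moreover have "cinner (H u - cscale z u) u = cinner (H u) u - z * cinner u u"
    using cinner_add_left[of "H u - cscale z u" "cscale z u" u] by (simp add: cinner_cscale_left)
  ultimately have "Im (cinner (H u - cscale z u) u) = - Im z * (norm u)\<^sup>2"
    by (simp add: Re_cinner_self)
  then have "\<bar>Im z\<bar> * (norm u)\<^sup>2 = \<bar>Im (cinner (H u - cscale z u) u)\<bar>" by (simp add: abs_mult)
  also have "\<dots> \<le> norm (H u - cscale z u) * norm u"
    using abs_Im_le_cmod cmod_cinner_le order_trans by blast
  finally have "\<bar>Im z\<bar> * norm u * norm u \<le> norm (H u - cscale z u) * norm u"
    by (simp add: power2_eq_square mult_ac)
  then show "\<bar>Im z\<bar> * norm u \<le> norm (H u - cscale z u)"
    by (cases "u = 0") (auto simp: mult_le_cancel_right)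
qed (use assms in simp)

lemma bounded_below_large:
  assumes "cmod z > B"
  shows "bounded_below z (cmod z - B)"
  unfolding bounded_below_def
proof (intro conjI allI)
  fix u
  have "norm (cscale z u) - norm (H u) \<le> norm (H u - cscale z u)"
    using norm_triangle_ineq2[of "cscale z u" "H u"] by (simp add: norm_minus_commute)
  then show "(cmod z - B) * norm u \<le> norm (H u - cscale z u)"
    using H_bound[of u] by (simp add: norm_cscale algebra_simps)
qed (use assms in simp)

lemma bounded_below_perturb:
  assumes "bounded_below z c" "cmod (z' - z) \<le> c / 2"
  shows "bounded_below z' (c / 2)"
  unfolding bounded_below_def
proof (intro conjI allI)
  show "0 < c / 2" using assms by (simp add: bounded_below_def)
  fix u
  have "norm (H u - cscale z u) \<le> norm (H u - cscale z' u) + norm (cscale (z' - z) u)"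
    using norm_triangle_ineq[of "H u - cscale z' u" "cscale (z' - z) u"] by (simp add: cscale_diff_left)
  moreover have "norm (cscale (z' - z) u) \<le> c / 2 * norm u"
    unfolding norm_cscale using assms by (intro mult_right_mono) auto
  moreover have "c * norm u \<le> norm (H u - cscale z u)" using assms by (simp add: bounded_below_def)
  ultimately show "c / 2 * norm u \<le> norm (H u - cscale z' u)" by simp
qed

definition solvable :: "complex \<Rightarrow> bool" where
  "solvable z \<longleftrightarrow> (\<forall>w. \<exists>u. H u - cscale z u = w)"

lemma solvable_large:
  assumes "cmod z > B"
  shows "solvable z"
  unfolding solvable_def
proof
  fix w
  define F where "F u = cscale (1 / z) (H u - w)" for u
  have z: "z \<noteq> 0" using assms B_pos by auto
  have "dist (F u) (F v) \<le> (B / cmod z) * dist u v" for u v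
  proof -
    have "F u - F v = cscale (1 / z) (H (u - v))" by (simp add: F_def H_diff flip: cscale_diff_right)
    then show ?thesis using H_bound[of "u - v"] z
      by (simp add: dist_norm norm_cscale norm_divide divide_right_mono)
  qed
  then have "\<exists>!u. F u = u"
    using assms B_pos by (intro banach_fix_type[of "B / cmod z"]) (auto simp: divide_less_eq_1)
  then obtain u where "F u = u" by blast
  then have "cscale z u = cscale z (F u)" by simp
  also have "\<dots> = H u - w" using z by (simp add: F_def cscale_cscale)
  finally show "\<exists>u. H u - cscale z u = w" by (intro exI[of _ u]) simp
qed

text \<open>The lower bound gives any solution map at z the Lipschitz constant 1 / c, so the
  equation at z' is a fixed point problem for a contraction.\<close>

lemma solvable_near:
  assumes "solvable z" "bounded_below z c" "cmod (z' - z) < c"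
  shows "solvable z'"
  unfolding solvable_def
proof
  fix w
  obtain R where R: "\<And>v. H (R v) - cscale z (R v) = v" using assms(1) unfolding solvable_def by metis
  have c: "c > 0" "\<And>u. c * norm u \<le> norm (H u - cscale z u)" using assms(2) by (auto simp: bounded_below_def)
  define F where "F u = R (w + cscale (z' - z) u)" for u
  have "dist (F u) (F v) \<le> (cmod (z' - z) / c) * dist u v" for u v
  proof -
    have "H (F u - F v) - cscale z (F u - F v)
      = (H (F u) - cscale z (F u)) - (H (F v) - cscale z (F v))"
      by (simp add: H_diff cscale_diff_right)
    also have "\<dots> = cscale (z' - z) (u - v)"
      by (simp add: F_def R cscale_diff_right)
    finally have "c * norm (F u - F v) \<le> cmod (z' - z) * norm (u - v)"
      using c(2)[of "F u - F v"] by (simp add: norm_cscale)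
    then show ?thesis using c(1) by (simp add: dist_norm field_simps)
  qed
  then have "\<exists>!u. F u = u"
    using assms(3) c by (intro banach_fix_type[of "cmod (z' - z) / c"]) auto
  then obtain u where u: "F u = u" by blast
  have "H u - cscale z u = w + cscale (z' - z) u" using R[of "w + cscale (z' - z) u"] u by (simp add: F_def)
  then show "\<exists>u. H u - cscale z' u = w" by (intro exI[of _ u]) (simp add: cscale_diff_left algebra_simps)
qed

text \<open>Surjectivity is carried to z in one step from a point z0 = +-i Y outside the disc of
  radius B: the lower bound at z0 is Y, and for large Y the disc of radius Y about z0 contains z. Y
  = B + |z|^2 / |Im z| suffices, as |z - z0|^2 = |z|^2 + Y^2 - 2 |Im z| Y.\<close>

lemma solvable_Im:
  assumes "Im z \<noteq> 0"
  shows "solvable z"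
proof -
  define s where "s = sgn (Im z)"
  define q where "q = (Re z)\<^sup>2 + (Im z)\<^sup>2"
  define Y where "Y = B + q / \<bar>Im z\<bar>"
  have s: "s * Im z = \<bar>Im z\<bar>" "s\<^sup>2 = 1" "\<bar>s\<bar> = 1" using assms by (auto simp: s_def sgn_if)
  have q: "q > 0" using assms by (simp add: q_def add_nonneg_pos)
  then have Q0: "q / \<bar>Im z\<bar> > 0" using assms by simp
  then have Y: "Y \<ge> B" "Y > 0" using B_pos unfolding Y_def by linarith+
  define z0 where "z0 = Complex 0 (s * Y)"
  have Im0: "\<bar>Im z0\<bar> = Y" using Y s by (simp add: z0_def abs_mult)
  have "cmod z0 = Y" using Y s by (simp add: z0_def cmod_def abs_mult)
  then have "solvable z0" using Q0 by (intro solvable_large) (simp add: Y_def)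
  moreover have "bounded_below z0 Y" using bounded_below_Im[of z0] Im0 Y by simp
  moreover have "cmod (z - z0) < Y"
  proof -
    have 1: "\<bar>Im z\<bar> * Y = \<bar>Im z\<bar> * B + q"
      using assms by (simp add: Y_def distrib_left)
    have 2: "\<bar>Im z\<bar> * B > 0" using assms B_pos by simp
    have "(cmod (z - z0))\<^sup>2 = q + s\<^sup>2 * Y\<^sup>2 - 2 * ((s * Im z) * Y)"
      unfolding cmod_power2 q_def z0_def minus_complex.sel complex.sel by algebra
    also have "\<dots> = q + Y\<^sup>2 - 2 * (\<bar>Im z\<bar> * Y)" by (simp only: s mult_1)
    finally have "(cmod (z - z0))\<^sup>2 < Y\<^sup>2" using 1 2 q by linarith
    then show ?thesis by (rule power2_less_imp_less) (use Y in linarith)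
  qed
  ultimately show ?thesis by (rule solvable_near)
qed

text \<open>A region where the resolvent is known to exist and which holds all contours; the true
  resolvent set may be larger.\<close>

definition resolvent_set :: "complex set" where
  "resolvent_set = {z. Im z \<noteq> 0 \<or> cmod z > B}"

definition resolvent :: "complex \<Rightarrow> 'a ell2 \<Rightarrow> 'a ell2" where
  "resolvent z w = (THE u. H u - cscale z u = w)"

lemma bounded_below_unique:
  assumes "bounded_below z c" "H u - cscale z u = H v - cscale z v"
  shows "u = v"
proof -
  have "H (u - v) - cscale z (u - v) = 0"
    using assms(2) by (simp add: H_diff cscale_diff_right algebra_simps)
  then have "c * norm (u - v) \<le> 0" using assms(1) unfolding bounded_below_def by (metis norm_zero)
  then show ?thesis using assms(1) by (simp add: bounded_below_def mult_le_0_iff)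
qed

lemma resolvent_set_bounded_below: "z \<in> resolvent_set \<Longrightarrow> \<exists>c. bounded_below z c"
  using bounded_below_Im bounded_below_large by (auto simp: resolvent_set_def)

lemma resolvent_eqI:
  assumes "z \<in> resolvent_set" "H u - cscale z u = w"
  shows "resolvent z w = u"
  unfolding resolvent_def using assms resolvent_set_bounded_below bounded_below_unique by (intro the_equality) metis+

lemma resolvent_eq:
  assumes "z \<in> resolvent_set"
  shows "H (resolvent z w) - cscale z (resolvent z w) = w"
proof -
  have "solvable z" using assms solvable_large solvable_Im by (auto simp: resolvent_set_def)
  then obtain u where "H u - cscale z u = w" by (auto simp: solvable_def)
  then show ?thesis using resolvent_eqI[OF assms] by metis
qed

lemma norm_resolvent_le:
  assumes "z \<in> resolvent_set" "bounded_below z c"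
  shows "norm (resolvent z w) \<le> norm w / c"
  using assms(2) resolvent_eq[OF assms(1), of w]
  unfolding bounded_below_def by (metis mult.commute pos_le_divide_eq)

lemma resolvent_cscale:
  assumes "z \<in> resolvent_set"
  shows "resolvent z (cscale a w) = cscale a (resolvent z w)"
proof (rule resolvent_eqI[OF assms])
  have "cscale a (H (resolvent z w) - cscale z (resolvent z w)) = cscale a w" using resolvent_eq[OF assms] by simp
  then show "H (cscale a (resolvent z w)) - cscale z (cscale a (resolvent z w)) = cscale a w"
    by (simp add: H_cscale cscale_diff_right cscale_cscale mult.commute)
qed

lemma resolvent_identity:
  assumes "z \<in> resolvent_set" "z' \<in> resolvent_set"
  shows "resolvent z w - resolvent z' w = cscale (z - z') (resolvent z (resolvent z' w))"
proof -
  have "resolvent z (cscale (z - z') (resolvent z' w)) = resolvent z w - resolvent z' w"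
  proof (rule resolvent_eqI[OF assms(1)])
    have "H (resolvent z w) - cscale z (resolvent z w) = w" "H (resolvent z' w) - cscale z' (resolvent z' w) = w"
      using resolvent_eq assms by blast+
    then show "H (resolvent z w - resolvent z' w) - cscale z (resolvent z w - resolvent z' w) = cscale (z - z') (resolvent z' w)"
      by (simp add: H_diff cscale_diff_right cscale_diff_left algebra_simps)
  qed
  then show ?thesis using resolvent_cscale[OF assms(1)] by simp
qed

lemma open_resolvent_set: "open resolvent_set"
proof -
  have "resolvent_set = {z. Im z < 0} \<union> {z. Im z > 0} \<union> {z. cmod z > B}" by (auto simp: resolvent_set_def)
  moreover have "open {z::complex. cmod z > B}" by (intro open_Collect_less continuous_intros)
  ultimately show ?thesis
    using open_halfspace_Im_lt open_halfspace_Im_gt by (simp add: open_Un)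
qed

lemma resolvent_tendsto:
  assumes z: "z \<in> resolvent_set"
  shows "((\<lambda>z'. resolvent z' w) \<longlongrightarrow> resolvent z w) (at z)"
proof -
  obtain c where c: "bounded_below z c" using resolvent_set_bounded_below[OF z] by blast
  then have c0: "c > 0" by (simp add: bounded_below_def)
  have ev: "\<forall>\<^sub>F z' in at z. z' \<in> resolvent_set \<and> cmod (z' - z) < c / 2"
  proof (rule eventually_conj)
    show "\<forall>\<^sub>F z' in at z. z' \<in> resolvent_set" using open_resolvent_set z by (rule eventually_at_in_open')
    show "\<forall>\<^sub>F z' in at z. cmod (z' - z) < c / 2"
      unfolding eventually_at using c0 by (intro exI[of _ "c / 2"]) (auto simp: dist_norm)
  qed
  have "((\<lambda>z'. resolvent z' w - resolvent z w) \<longlongrightarrow> 0) (at z)"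
  proof (rule Lim_null_comparison)
    have "((\<lambda>z'. cmod (z' - z) * (norm (resolvent z w) / (c / 2)))
        \<longlongrightarrow> cmod (z - z) * (norm (resolvent z w) / (c / 2))) (at z)"
      using c0 by (intro tendsto_intros) auto
    then show "((\<lambda>z'. cmod (z' - z) * (norm (resolvent z w) / (c / 2))) \<longlongrightarrow> 0) (at z)" by simp
    show "\<forall>\<^sub>F z' in at z. norm (resolvent z' w - resolvent z w) \<le> cmod (z' - z) * (norm (resolvent z w) / (c / 2))"
      using ev
    proof eventually_elim
      case (elim z')
      then have "norm (resolvent z' (resolvent z w)) \<le> norm (resolvent z w) / (c / 2)"
        using bounded_below_perturb[OF c, of z'] by (intro norm_resolvent_le) auto
      then show ?case using resolvent_identity[of z' z w] elim z
        unfolding norm_cscale by (simp only: norm_cscale) (intro mult_left_mono, auto)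
    qed
  qed
  then show ?thesis by (simp add: LIM_zero_iff)
qed

text \<open>By the resolvent identity the difference quotient is an entry of the resolvent at z'
  applied to the one at z, and it converges by strong continuity.\<close>

lemma holomorphic_resolvent: "(\<lambda>z. coord (resolvent z w) n) holomorphic_on resolvent_set"
  unfolding holomorphic_on_def field_differentiable_def
proof
  fix z assume z: "z \<in> resolvent_set"
  have "((\<lambda>z'. (coord (resolvent z' w) n - coord (resolvent z w) n) / (z' - z)) \<longlongrightarrow> coord (resolvent z (resolvent z w)) n) (at z)"
  proof (rule Lim_transform_eventually)
    show "((\<lambda>z'. coord (resolvent z' (resolvent z w)) n) \<longlongrightarrow> coord (resolvent z (resolvent z w)) n) (at z)"
      by (rule bounded_linear.tendsto[OF bounded_linear_coord resolvent_tendsto[OF z]])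
    have "\<forall>\<^sub>F z' in at z. z' \<in> resolvent_set" using open_resolvent_set z by (rule eventually_at_in_open')
    moreover have "\<forall>\<^sub>F z' in at z. z' \<noteq> z" by (auto simp: eventually_at_filter)
    ultimately show "\<forall>\<^sub>F z' in at z. coord (resolvent z' (resolvent z w)) n = (coord (resolvent z' w) n - coord (resolvent z w) n) / (z' - z)"
    proof eventually_elim
      case (elim z')
      have "coord (resolvent z' w - resolvent z w) n = (z' - z) * coord (resolvent z' (resolvent z w)) n"
        unfolding resolvent_identity[OF elim(1) z] by (simp add: cscale.rep_eq)
      then show ?case using elim by (simp add: minus_ell2.rep_eq)
    qed
  qed
  then have "((\<lambda>z. coord (resolvent z w) n) has_field_derivative coord (resolvent z (resolvent z w)) n) (at z)"
    by (simp add: has_field_derivative_iff)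
  then show "\<exists>f'. ((\<lambda>z. coord (resolvent z w) n) has_field_derivative f') (at z within resolvent_set)"
    using has_field_derivative_at_within by blast
qed

lemma H_power_bound: "norm ((H ^^ k) w) \<le> B ^ k * norm w"
proof (induction k)
  case (Suc k)
  have "norm ((H ^^ Suc k) w) \<le> B * norm ((H ^^ k) w)" using H_bound by simp
  also have "\<dots> \<le> B * (B ^ k * norm w)" using Suc B_pos by (intro mult_left_mono) auto
  finally show ?case by (simp add: mult_ac)
qed simp

text \<open>The finite form with remainder serves twice: its terms can be integrated over a contour,
  and at sites far from the source its first terms vanish, leaving a small remainder.\<close>

lemma neumann:
  assumes "cmod z > B"
  shows "coord (resolvent z w) n = - (\<Sum>k<N. coord ((H ^^ k) w) n / z ^ Suc k) + coord (resolvent z ((H ^^ N) w)) n / z ^ N"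
proof (induction N)
  case (Suc N)
  have z: "z \<in> resolvent_set" "z \<noteq> 0" using assms B_pos by (auto simp: resolvent_set_def)
  define v where "v = (H ^^ N) w"
  have "resolvent z (H v) = H (resolvent z v)"
  proof (rule resolvent_eqI[OF z(1)])
    have "H (H (resolvent z v) - cscale z (resolvent z v)) = H v" using resolvent_eq[OF z(1)] by simp
    then show "H (H (resolvent z v)) - cscale z (H (resolvent z v)) = H v" by (simp add: H_diff H_cscale)
  qed
  moreover have "H (resolvent z v) = v + cscale z (resolvent z v)" using resolvent_eq[OF z(1), of v] by (simp add: algebra_simps)
  ultimately have "coord (resolvent z (H v)) n = coord v n + z * coord (resolvent z v) n"
    by (simp add: plus_ell2.rep_eq cscale.rep_eq)
  then have "coord (resolvent z v) n / z ^ N = - (coord v n / z ^ Suc N) + coord (resolvent z (H v)) n / z ^ Suc N"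
    using z(2) by (simp add: field_simps)
  then show ?case using Suc by (simp add: v_def)
qed simp

lemma neumann_remainder:
  assumes "cmod z \<ge> K" "K > B"
  shows "cmod (coord (resolvent z w) n + (\<Sum>k<N. coord ((H ^^ k) w) n / z ^ Suc k)) \<le> (B / K) ^ N * norm w / (K - B)"
proof -
  have z: "cmod z > B" "z \<in> resolvent_set" using assms by (auto simp: resolvent_set_def)
  have "cmod (coord (resolvent z w) n + (\<Sum>k<N. coord ((H ^^ k) w) n / z ^ Suc k))
      = cmod (coord (resolvent z ((H ^^ N) w)) n) / cmod z ^ N"
    unfolding neumann[OF z(1), of w n N] by (simp add: norm_divide norm_power)
  moreover have "cmod (coord (resolvent z ((H ^^ N) w)) n) \<le> norm (resolvent z ((H ^^ N) w))"
    by (rule norm_coord_le)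
  moreover have "norm (resolvent z ((H ^^ N) w)) \<le> norm ((H ^^ N) w) / (cmod z - B)"
    by (rule norm_resolvent_le[OF z(2) bounded_below_large[OF z(1)]])
  moreover have "norm ((H ^^ N) w) / (cmod z - B) \<le> B ^ N * norm w / (K - B)"
    using H_power_bound[of N w] assms B_pos by (intro frac_le) auto
  moreover have "cmod (coord (resolvent z ((H ^^ N) w)) n) / cmod z ^ N \<le> B ^ N * norm w / (K - B) / K ^ N"
    if "cmod (coord (resolvent z ((H ^^ N) w)) n) \<le> B ^ N * norm w / (K - B)"
    using that assms B_pos by (intro frac_le power_mono zero_less_power) (auto intro: order_trans[OF norm_ge_zero])
  ultimately have "cmod (coord (resolvent z w) n + (\<Sum>k<N. coord ((H ^^ k) w) n / z ^ Suc k))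
      \<le> B ^ N * norm w / (K - B) / K ^ N"
    by linarith
  then show ?thesis by (simp add: power_divide mult_ac)
qed

section \<open>The unitary group and its contour representation\<close>

definition evolution :: "real \<Rightarrow> 'a ell2 \<Rightarrow> 'a ell2" where
  "evolution t = op_exp (\<lambda>u. cscale (- \<i> * complex_of_real t) (H u))"

lemma scaled_H_power: "((\<lambda>u. cscale c (H u)) ^^ k) u = cscale (c ^ k) ((H ^^ k) u)"
  by (induction k) (simp_all add: H_cscale cscale_cscale)

lemma bounded_linear_scaled_H: "bounded_linear (\<lambda>u. cscale c (H u))"
proof (rule bounded_linear_intro)
  fix u v r
  show "cscale c (H (u + v)) = cscale c (H u) + cscale c (H v)" by (simp add: H_add cscale_add_right)
  show "cscale c (H (r *\<^sub>R u)) = r *\<^sub>R cscale c (H u)"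
    by (simp add: scaleR_eq_cscale H_cscale cscale_cscale mult.commute)
  show "norm (cscale c (H u)) \<le> norm u * (cmod c * B)"
    using mult_left_mono[OF H_bound[of u] norm_ge_zero[of c]] by (simp add: norm_cscale mult_ac)
qed

lemma coord_evolution_sums:
  "(\<lambda>k. (- \<i> * of_real t) ^ k / fact k * coord ((H ^^ k) w) n) sums coord (evolution t w) n"
proof -
  let ?c = "- \<i> * complex_of_real t"
  have "(\<lambda>k. ((\<lambda>u. cscale ?c (H u)) ^^ k) w /\<^sub>R fact k) sums evolution t w"
    unfolding evolution_def op_exp_def by (intro summable_sums summable_op_exp bounded_linear_scaled_H)
  from bounded_linear.sums[OF bounded_linear_coord[of n] this]
  show ?thesis
    by (simp only: scaled_H_power scaleR_eq_cscale cscale.rep_eq) (simp add: field_simps)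
qed

text \<open>Termwise differentiation: the differentiated series is the exponential series started at
  A w, whose sum is A applied to the original sum, and it converges uniformly on bounded sets. The
  derivative is taken in the Hilbert space norm in order to differentiate the squared norm.\<close>

lemma has_derivative_evolution:
  "((\<lambda>s. evolution s w) has_derivative (\<lambda>h. h *\<^sub>R cscale (- \<i>) (H (evolution s w)))) (at s)"
proof -
  define A where "A = (\<lambda>u. cscale (- \<i>) (H u))"
  have blA: "bounded_linear A" unfolding A_def by (rule bounded_linear_scaled_H)
  have Apow: "(A ^^ k) u = cscale ((- \<i>) ^ k) ((H ^^ k) u)" for k u
    unfolding A_def by (rule scaled_H_power)
  have Abound: "norm ((A ^^ k) u) \<le> B ^ k * norm u" for k u
    using H_power_bound[of k u] by (simp add: Apow norm_cscale norm_power)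
  define E where "E s = (\<Sum>k. (s ^ k / fact k) *\<^sub>R (A ^^ k) w)" for s :: real
  have Asum: "summable (\<lambda>k. ((r * B) ^ k / fact k) * c)" for r c :: real
    using summable_mult2[OF summable_exp[of "r * B"], of c] by (simp add: field_simps)
  have term_le: "norm ((s ^ k / fact k) *\<^sub>R (A ^^ k) u) \<le> ((r * B) ^ k / fact k) * norm u"
    if "\<bar>s\<bar> \<le> r" for s r k u
  proof -
    have "norm ((s ^ k / fact k) *\<^sub>R (A ^^ k) u) \<le> (r ^ k / fact k) * (B ^ k * norm u)"
      using that Abound[of k u] by (auto intro!: mult_mono divide_right_mono power_mono simp: power_abs)
    then show ?thesis by (simp add: power_mult_distrib mult_ac)
  qed
  have Esums: "(\<lambda>k. (s ^ k / fact k) *\<^sub>R (A ^^ k) u) sums (\<Sum>k. (s ^ k / fact k) *\<^sub>R (A ^^ k) u)" for s u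
    by (rule summable_sums, rule summable_comparison_test'[OF Asum[of "\<bar>s\<bar>" "norm u"], of 0]) (rule term_le, simp)
  have E_ev: "evolution s w = E s" for s
  proof -
    have "cscale ((- \<i> * of_real s) ^ k) ((H ^^ k) w) /\<^sub>R fact k = (s ^ k / fact k) *\<^sub>R (A ^^ k) w" for k
      unfolding Apow power_mult_distrib[of "- \<i>"] by (simp add: scaleR_eq_cscale cscale_cscale field_simps)
    then show ?thesis by (simp only: evolution_def op_exp_def E_def scaled_H_power)
  qed
  have deriv: "(E has_derivative (\<lambda>h. h *\<^sub>R A (E s))) (at s)" for s
  proof -
    define r where "r = \<bar>s\<bar> + 1"
    define S where "S = ball (0::real) r"
    define f where "f n s = (s ^ n / fact n) *\<^sub>R (A ^^ n) w" for n and s :: real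
    define f' where "f' n s h = h *\<^sub>R ((of_nat n * s ^ (n - 1) / fact n) *\<^sub>R (A ^^ n) w)" for n and s h :: real
    have sS: "s \<in> S" by (simp add: S_def r_def)
    have unif: "uniform_limit S (\<lambda>n x. \<Sum>i<n. (x ^ i / fact i) *\<^sub>R (A ^^ i) (A w))
        (\<lambda>x. \<Sum>i. (x ^ i / fact i) *\<^sub>R (A ^^ i) (A w)) sequentially"
      by (rule Weierstrass_m_test[OF _ Asum[of r "norm (A w)"]], rule term_le) (simp add: S_def)
    have AE: "A (E x) = (\<Sum>i. (x ^ i / fact i) *\<^sub>R (A ^^ i) (A w))" for x
    proof -
      have "(\<lambda>i. A ((x ^ i / fact i) *\<^sub>R (A ^^ i) w)) sums A (E x)"
        unfolding E_def by (rule bounded_linear.sums[OF blA Esums])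
      then have "(\<lambda>i. (x ^ i / fact i) *\<^sub>R (A ^^ i) (A w)) sums A (E x)"
        by (simp add: linear_scale[OF bounded_linear.linear[OF blA]] funpow_swap1)
      then show ?thesis by (rule sums_unique)
    qed
    have "\<exists>g. \<forall>x\<in>S. (\<lambda>n. f n x) sums (g x) \<and> (g has_derivative (\<lambda>h. h *\<^sub>R A (E x))) (at x within S)"
    proof (rule has_derivative_series[OF _ _ _ sS])
      show "convex S" by (simp add: S_def)
      show "(f n has_derivative f' n x) (at x within S)" for n x
        unfolding f_def f'_def
        by (auto intro!: derivative_eq_intros simp: fun_eq_iff)
      show "(\<lambda>n. f n s) sums E s" unfolding f_def E_def by (rule Esums)
      fix e :: real assume e: "e > 0"
      have "\<forall>\<^sub>F n in sequentially. \<forall>x\<in>S. dist (\<Sum>i<n. (x ^ i / fact i) *\<^sub>R (A ^^ i) (A w)) (A (E x)) < e"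
        using unif e unfolding uniform_limit_iff AE by blast
      then obtain N where N: "\<And>n x. n \<ge> N \<Longrightarrow> x \<in> S \<Longrightarrow>
          norm ((\<Sum>i<n. (x ^ i / fact i) *\<^sub>R (A ^^ i) (A w)) - A (E x)) < e"
        unfolding eventually_sequentially dist_norm by blast
      have sum_f': "(\<Sum>i<Suc n. f' i x h) = h *\<^sub>R (\<Sum>i<n. (x ^ i / fact i) *\<^sub>R (A ^^ i) (A w))" for n x h
      proof -
        have "f' (Suc i) x h = h *\<^sub>R ((x ^ i / fact i) *\<^sub>R (A ^^ i) (A w))" for i
          unfolding f'_def by (simp add: funpow_swap1 fact_Suc divide_simps)
        moreover have "f' 0 x h = 0" by (simp add: f'_def)
        ultimately show ?thesis by (simp add: sum.lessThan_Suc_shift scaleR_sum_right del: sum.lessThan_Suc)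
      qed
      show "\<forall>\<^sub>F n in sequentially. \<forall>x\<in>S. \<forall>h. norm ((\<Sum>i<n. f' i x h) - h *\<^sub>R A (E x)) \<le> e * norm h"
        unfolding eventually_sequentially
      proof (intro exI[of _ "Suc N"] allI impI ballI)
        fix n x h assume n: "Suc N \<le> n" and x: "x \<in> S"
        obtain n' where n': "n = Suc n'" "N \<le> n'" using n by (cases n) auto
        have "norm ((\<Sum>i<n. f' i x h) - h *\<^sub>R A (E x))
          = norm h * norm ((\<Sum>i<n'. (x ^ i / fact i) *\<^sub>R (A ^^ i) (A w)) - A (E x))"
          unfolding n'(1) sum_f' by (simp flip: scaleR_diff_right)
        also have "\<dots> \<le> norm h * e" using N[OF n'(2) x] by (intro mult_left_mono) auto
        finally show "norm ((\<Sum>i<n. f' i x h) - h *\<^sub>R A (E x)) \<le> e * norm h" by (simp add: mult.commute)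
      qed
    qed
    then obtain g where g: "\<And>x. x \<in> S \<Longrightarrow> (\<lambda>n. f n x) sums (g x)"
      "\<And>x. x \<in> S \<Longrightarrow> (g has_derivative (\<lambda>h. h *\<^sub>R A (E x))) (at x within S)" by blast
    have gE: "g x = E x" if "x \<in> S" for x
      using g(1)[OF that] Esums[of x w] sums_unique2 unfolding f_def E_def by blast
    have "(g has_derivative (\<lambda>h. h *\<^sub>R A (E s))) (at s)"
      using g(2)[OF sS] at_within_open[OF sS] by (simp add: S_def)
    then show ?thesis
      by (rule has_derivative_transform_within_open[of _ _ _ _ S]) (use sS gE in \<open>auto simp: S_def\<close>)
  qed
  then show ?thesis by (simp add: E_ev A_def)
qed

lemma evolution_0: "evolution 0 w = w"
proof -
  have "coord (evolution 0 w) n = coord w n" for n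
    using sums_unique2[OF coord_evolution_sums[of 0 w n] sums_finite[of "{0}"]] by simp
  then show ?thesis by (intro coord_inject[THEN iffD1] ext)
qed

lemma continuous_coord_evolution: "continuous_on UNIV (\<lambda>t. coord (evolution t w) n)"
proof -
  have "continuous_on UNIV (\<lambda>t. evolution t w)"
    by (intro continuous_at_imp_continuous_on ballI has_derivative_continuous[OF has_derivative_evolution])
  then show ?thesis by (rule bounded_linear.continuous_on[OF bounded_linear_coord])
qed

text \<open>The derivative of the squared norm is twice the real inner product of - \<i> H u with u,
  which vanishes for symmetric H.\<close>

lemma norm_evolution: "norm (evolution t w) = norm w"
proof -
  have skew: "inner (cscale (- \<i>) (H u)) u = 0" for u
  proof -
    have "cnj (cinner (H u) u) = cinner (H u) u" using H_sym[of u u] cinner_commute[of u "H u"] by simp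
    then have "Im (cinner (H u) u) = 0" by (metis Im_complex_of_real Reals_cnj_iff complex_is_Real_iff)
    then show ?thesis by (simp add: inner_ell2_def cinner_cscale_left)
  qed
  have "((\<lambda>s. inner (evolution s w) (evolution s w)) has_derivative (\<lambda>h. 0)) (at s)" for s
    using has_derivative_inner[OF has_derivative_evolution[of w s] has_derivative_evolution[of w s]] skew[of "evolution s w"]
    by (simp add: inner_commute[of "evolution s w"])
  then have "\<exists>c. \<forall>s\<in>UNIV. inner (evolution s w) (evolution s w) = c"
    by (intro has_derivative_zero_constant) (auto intro: has_derivative_at_withinI)
  then have "inner (evolution t w) (evolution t w) = inner (evolution 0 w) (evolution 0 w)" by auto
  then show ?thesis by (simp add: evolution_0 norm_eq_sqrt_inner)
qed

end

text \<open>The residue of exp (c z) / z^(k + 1) at 0. In the induction the derivative of this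
  function, having a primitive, integrates to 0 around the square and so links consecutive
  exponents.\<close>

lemma contour_integral_exp_inverse_power:
  fixes c :: complex
  assumes K: "K > 0"
  defines "\<gamma> \<equiv> rectpath (Complex (- K) (- K)) (Complex K K)"
  shows "((\<lambda>z. exp (c * z) / z ^ Suc k) has_contour_integral (2 * pi * \<i> * (c ^ k / fact k))) \<gamma>"
proof (induction k)
  have im: "path_image \<gamma> \<subseteq> UNIV - {0}"
    unfolding \<gamma>_def using K by (subst path_image_rectpath_cbox_minus_box) (auto simp: in_box_complex_iff)
  have loop: "pathfinish \<gamma> = pathstart \<gamma>" "valid_path \<gamma>" by (simp_all add: \<gamma>_def)
  {
    case 0
    have "winding_number \<gamma> 0 = 1"
      unfolding \<gamma>_def using K by (intro winding_number_rectpath) (auto simp: in_box_complex_iff)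
    moreover have "((\<lambda>z. exp (c * z) / (z - 0)) has_contour_integral (2 * pi * \<i> * winding_number \<gamma> 0 * exp (c * 0))) \<gamma>"
      using im loop by (intro Cauchy_integral_formula_convex_simple[of UNIV]) (auto intro!: holomorphic_intros)
    ultimately show ?case by simp
  next
    case (Suc k)
    have "((\<lambda>z. c * exp (c * z) / z ^ Suc k - of_nat (Suc k) * exp (c * z) / z ^ Suc (Suc k)) has_contour_integral 0) \<gamma>"
    proof (rule Cauchy_theorem_primitive[of "UNIV - {0}" "\<lambda>z. exp (c * z) / z ^ Suc k"])
      fix z :: complex assume z: "z \<in> UNIV - {0}"
      then have "z ^ Suc k \<noteq> 0" by simp
      have "((\<lambda>z. exp (c * z) / z ^ Suc k) has_field_derivative
          ((c * exp (c * z)) * z ^ Suc k - exp (c * z) * (of_nat (Suc k) * z ^ k)) / (z ^ Suc k * z ^ Suc k)) (at z within UNIV - {0})"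
        using z by (auto intro!: derivative_eq_intros simp del: power_Suc)
      moreover have "((c * exp (c * z)) * z ^ Suc k - exp (c * z) * (of_nat (Suc k) * z ^ k)) / (z ^ Suc k * z ^ Suc k)
          = c * exp (c * z) / z ^ Suc k - of_nat (Suc k) * exp (c * z) / z ^ Suc (Suc k)"
        using z by (simp add: divide_simps) (simp add: algebra_simps)
      ultimately show "((\<lambda>z. exp (c * z) / z ^ Suc k) has_field_derivative
          c * exp (c * z) / z ^ Suc k - of_nat (Suc k) * exp (c * z) / z ^ Suc (Suc k)) (at z within UNIV - {0})"
        by simp
    qed (use loop im in auto)
    from has_contour_integral_diff[OF has_contour_integral_lmul[OF Suc.IH, of c] this]
    have "((\<lambda>z. of_nat (Suc k) * (exp (c * z) / z ^ Suc (Suc k))) has_contour_integral c * (2 * pi * \<i> * (c ^ k / fact k))) \<gamma>"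
      by (simp del: power_Suc of_nat_Suc)
    from has_contour_integral_lmul[OF this, of "inverse (of_nat (Suc k))"]
    have "((\<lambda>z. exp (c * z) / z ^ Suc (Suc k)) has_contour_integral
      inverse (of_nat (Suc k)) * (c * (2 * pi * \<i> * (c ^ k / fact k)))) \<gamma>"
      by (simp del: power_Suc of_nat_Suc flip: mult.assoc)
    moreover have "inverse (of_nat (Suc k)) * (c * (2 * pi * \<i> * (c ^ k / fact k))) = 2 * pi * \<i> * (c ^ Suc k / fact (Suc k))"
      by (simp add: divide_simps)
    ultimately show ?case by simp
  }
qed

lemma cmod_Complex_diff: "cmod (Complex a c - Complex b c) = \<bar>a - b\<bar>" "cmod (Complex c a - Complex c b) = \<bar>a - b\<bar>"
  by (simp_all add: cmod_def)

lemma norm_add4: "norm (a + b + c + d) \<le> norm a + norm b + norm c + norm d" for a :: "'a::real_normed_vector"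
  using norm_triangle_ineq[of "a + b + c" d] norm_triangle_ineq[of "a + b" c] norm_triangle_ineq[of a b]
  by linarith

lemma contour_integral_rectpath:
  fixes f :: "complex \<Rightarrow> complex" and a b c d :: real
  assumes "f contour_integrable_on rectpath (Complex a c) (Complex b d)"
  shows "contour_integral (rectpath (Complex a c) (Complex b d)) f
    = contour_integral (linepath (Complex a c) (Complex b c)) f
    + contour_integral (linepath (Complex b c) (Complex b d)) f
    + contour_integral (linepath (Complex b d) (Complex a d)) f
    + contour_integral (linepath (Complex a d) (Complex a c)) f"
    "f contour_integrable_on linepath (Complex a c) (Complex b c)"
    "f contour_integrable_on linepath (Complex b c) (Complex b d)"
    "f contour_integrable_on linepath (Complex b d) (Complex a d)"
    "f contour_integrable_on linepath (Complex a d) (Complex a c)"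
  using assms by (simp_all add: rectpath_def Let_def contour_integrable_joinI)

lemma contour_integral_square_bound:
  fixes f :: "complex \<Rightarrow> complex"
  assumes int: "f contour_integrable_on rectpath (Complex (- K) (- K)) (Complex K K)"
    and K: "K > 0" and M: "\<And>z. z \<in> path_image (rectpath (Complex (- K) (- K)) (Complex K K)) \<Longrightarrow> cmod (f z) \<le> M"
  shows "cmod (contour_integral (rectpath (Complex (- K) (- K)) (Complex K K)) f) \<le> 8 * K * M"
proof -
  have img: "path_image (rectpath (Complex (- K) (- K)) (Complex K K))
    = closed_segment (Complex (- K) (- K)) (Complex K (- K)) \<union> (closed_segment (Complex K (- K)) (Complex K K)
      \<union> (closed_segment (Complex K K) (Complex (- K) K) \<union> closed_segment (Complex (- K) K) (Complex (- K) (- K))))"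
    by (simp add: rectpath_def Let_def path_image_join)
  have M0: "0 \<le> M" using M[of "Complex K K"] img norm_ge_zero order_trans by blast
  have len: "cmod (Complex K (- K) - Complex (- K) (- K)) = 2 * K" "cmod (Complex K K - Complex K (- K)) = 2 * K"
    "cmod (Complex (- K) K - Complex K K) = 2 * K" "cmod (Complex (- K) (- K) - Complex (- K) K) = 2 * K"
    using K by (simp_all add: cmod_Complex_diff)
  note I = contour_integral_rectpath[OF int]
  have "cmod (contour_integral (linepath (Complex (- K) (- K)) (Complex K (- K))) f) \<le> M * (2 * K)"
    using contour_integral_bound_linepath[OF I(2) M0] M img len by auto
  moreover have "cmod (contour_integral (linepath (Complex K (- K)) (Complex K K)) f) \<le> M * (2 * K)"
    using contour_integral_bound_linepath[OF I(3) M0] M img len by auto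
  moreover have "cmod (contour_integral (linepath (Complex K K) (Complex (- K) K)) f) \<le> M * (2 * K)"
    using contour_integral_bound_linepath[OF I(4) M0] M img len by auto
  moreover have "cmod (contour_integral (linepath (Complex (- K) K) (Complex (- K) (- K))) f) \<le> M * (2 * K)"
    using contour_integral_bound_linepath[OF I(5) M0] M img len by auto
  ultimately show ?thesis
    unfolding I(1) by (intro order_trans[OF norm_add4]) (simp add: mult_ac)
qed

context bounded_selfadjoint
begin

text \<open>On the square |z| \<ge> K > B, so the resolvent entry is its Neumann sum up to order (B
  / K)^N. Integrated against the exponential, the Neumann sum reproduces the partial sums of the
  exponential series.\<close>

lemma evolution_contour_integral:
  assumes K: "K > B"
  shows "((\<lambda>z. exp (- \<i> * of_real t * z) * coord (resolvent z w) n) has_contour_integral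
    - (2 * pi * \<i>) * coord (evolution t w) n) (rectpath (Complex (- K) (- K)) (Complex K K))"
    (is "(?F has_contour_integral _) ?\<gamma>")
proof -
  have K0: "K > 0" using K B_pos by simp
  have img: "cmod z \<ge> K" if "z \<in> path_image ?\<gamma>" for z
  proof -
    have "z \<in> cbox (Complex (- K) (- K)) (Complex K K) - box (Complex (- K) (- K)) (Complex K K)"
      using that K0 by (subst (asm) path_image_rectpath_cbox_minus_box) auto
    then have "\<bar>Re z\<bar> \<ge> K \<or> \<bar>Im z\<bar> \<ge> K" by (auto simp: in_cbox_complex_iff in_box_complex_iff)
    then show ?thesis using abs_Re_le_cmod[of z] abs_Im_le_cmod[of z] by linarith
  qed
  have "path_image ?\<gamma> \<subseteq> resolvent_set" using img K by (force simp: resolvent_set_def)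
  then have Fint: "?F contour_integrable_on ?\<gamma>"
    by (intro contour_integrable_holomorphic_simple[OF _ open_resolvent_set])
      (auto intro!: holomorphic_intros holomorphic_resolvent)
  define c where "c = - \<i> * complex_of_real t"
  define a where "a k = coord ((H ^^ k) w) n" for k
  define T where "T N z = - (\<Sum>k<N. a k * (exp (c * z) / z ^ Suc k))" for N z
  have T: "(T N has_contour_integral - (\<Sum>k<N. a k * (2 * pi * \<i> * (c ^ k / fact k)))) ?\<gamma>" for N
    unfolding T_def
    by (intro has_contour_integral_neg has_contour_integral_sum has_contour_integral_lmul
        contour_integral_exp_inverse_power K0) auto
  have bound: "cmod (contour_integral ?\<gamma> ?F - (- (2 * pi * \<i>)) * (\<Sum>k<N. c ^ k / fact k * a k))
      \<le> 8 * K * (exp (2 * K * \<bar>t\<bar>) * (norm w / (K - B))) * (B / K) ^ N" for N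
  proof -
    define D where "D z = ?F z - T N z" for z
    have D: "(D has_contour_integral contour_integral ?\<gamma> ?F - - (\<Sum>k<N. a k * (2 * pi * \<i> * (c ^ k / fact k)))) ?\<gamma>"
      unfolding D_def by (intro has_contour_integral_diff T has_contour_integral_integral Fint)
    have "cmod (contour_integral ?\<gamma> D) \<le> 8 * K * (exp (2 * K * \<bar>t\<bar>) * ((B / K) ^ N * norm w / (K - B)))"
    proof (rule contour_integral_square_bound[OF _ K0])
      show "D contour_integrable_on ?\<gamma>" using D by (rule has_contour_integral_integrable)
      fix z assume z: "z \<in> path_image ?\<gamma>"
      have "D z = exp (c * z) * (coord (resolvent z w) n + (\<Sum>k<N. a k / z ^ Suc k))"
        by (simp add: D_def T_def c_def algebra_simps sum_distrib_left)
      moreover have "cmod (exp (c * z)) \<le> exp (2 * K * \<bar>t\<bar>)"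
      proof -
        have "z \<in> cbox (Complex (- K) (- K)) (Complex K K)"
          using z K0 path_image_rectpath_subset_cbox[of "Complex (- K) (- K)" "Complex K K"] by auto
        then have "\<bar>Im z\<bar> \<le> K" by (auto simp: in_cbox_complex_iff)
        then have "\<bar>t * Im z\<bar> \<le> \<bar>t\<bar> * (2 * K)" unfolding abs_mult using K0 by (intro mult_left_mono) auto
        then show ?thesis by (simp add: c_def mult_ac)
      qed
      ultimately show "cmod (D z) \<le> exp (2 * K * \<bar>t\<bar>) * ((B / K) ^ N * norm w / (K - B))"
        using neumann_remainder[OF img[OF z] K, of w n N] unfolding a_def
        by (simp only: norm_mult) (intro mult_mono, auto)
    qed
    moreover have "contour_integral ?\<gamma> D = contour_integral ?\<gamma> ?F - (- (2 * pi * \<i>)) * (\<Sum>k<N. c ^ k / fact k * a k)"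
      unfolding contour_integral_unique[OF D] sum_distrib_left by (simp add: mult_ac sum_negf)
    moreover have "8 * K * (exp (2 * K * \<bar>t\<bar>) * ((B / K) ^ N * norm w / (K - B)))
        = 8 * K * (exp (2 * K * \<bar>t\<bar>) * (norm w / (K - B))) * (B / K) ^ N" by simp
    ultimately show ?thesis by metis
  qed
  have "(\<lambda>N. (\<Sum>k<N. c ^ k / fact k * a k)) \<longlonglongrightarrow> coord (evolution t w) n"
    using coord_evolution_sums[of t w n] by (simp add: sums_def c_def a_def)
  then have "(\<lambda>N. cmod (contour_integral ?\<gamma> ?F - (- (2 * pi * \<i>)) * (\<Sum>k<N. c ^ k / fact k * a k)))
      \<longlonglongrightarrow> cmod (contour_integral ?\<gamma> ?F - (- (2 * pi * \<i>)) * coord (evolution t w) n)"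
    by (intro tendsto_intros)
  moreover have "(\<lambda>N. 8 * K * (exp (2 * K * \<bar>t\<bar>) * (norm w / (K - B))) * (B / K) ^ N) \<longlonglongrightarrow> 0"
    using K B_pos by (intro tendsto_mult_right_zero LIMSEQ_realpow_zero) auto
  ultimately have "cmod (contour_integral ?\<gamma> ?F - (- (2 * pi * \<i>)) * coord (evolution t w) n) \<le> 0"
    by (rule LIMSEQ_le) (use bound in auto)
  then have eq: "contour_integral ?\<gamma> ?F = (- (2 * pi * \<i>)) * coord (evolution t w) n"
    by (simp add: eq_neg_iff_add_eq_0)
  show ?thesis using has_contour_integral_integral[OF Fint] unfolding eq .
qed

text \<open>The square is lowered to the rectangle |Im z| \<le> y. There the exponential has modulus
  at most exp (t y), and the long sides see the resolvent at height y. Only the short sides meet the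
  real axis, and on them |z| \<ge> K.\<close>

lemma coord_evolution_le:
  assumes K: "K > B" and y: "0 < y" "y \<le> K" and t: "t \<ge> 0" and G: "0 \<le> G" "0 \<le> G'"
    and top: "\<And>x. \<bar>x\<bar> \<le> K \<Longrightarrow> cmod (coord (resolvent (Complex x y) w) n) \<le> G"
    and bot: "\<And>x. \<bar>x\<bar> \<le> K \<Longrightarrow> cmod (coord (resolvent (Complex x (- y)) w) n) \<le> G"
    and side: "\<And>z. cmod z \<ge> K \<Longrightarrow> cmod (coord (resolvent z w) n) \<le> G'"
  shows "cmod (coord (evolution t w) n) \<le> exp (t * y) * K * (G + G')"
proof -
  have K0: "K > 0" using K B_pos by simp
  define F where "F z = exp (- \<i> * of_real t * z) * coord (resolvent z w) n" for z
  have hol: "F holomorphic_on resolvent_set" unfolding F_def by (intro holomorphic_intros holomorphic_resolvent)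
  have F: "(F has_contour_integral - (2 * pi * \<i>) * coord (evolution t w) n) (rectpath (Complex (- K) (- K)) (Complex K K))"
    unfolding F_def by (rule evolution_contour_integral[OF K])
  define L where "L a b = contour_integral (linepath a b) F" for a b
  have "- (2 * pi * \<i>) * coord (evolution t w) n = L (Complex (- K) (- K)) (Complex K (- K))
    + L (Complex K (- K)) (Complex K K) + L (Complex K K) (Complex (- K) K) + L (Complex (- K) K) (Complex (- K) (- K))"
    using contour_integral_rectpath(1)[OF has_contour_integral_integrable[OF F]] contour_integral_unique[OF F]
    by (simp add: L_def)
  moreover have split: "L (Complex x a) (Complex x b) = L (Complex x a) (Complex x c) + L (Complex x c) (Complex x b)"
    if "\<bar>x\<bar> = K" "c \<in> closed_segment a b" for x a b c
  proof -
    have "Complex x c \<in> closed_segment (Complex x a) (Complex x b)"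
      using that(2) by (simp add: closed_segment_same_Re)
    moreover have "closed_segment (Complex x a) (Complex x b) \<subseteq> resolvent_set"
    proof
      fix z assume "z \<in> closed_segment (Complex x a) (Complex x b)"
      then have "Re z = x" by (simp add: closed_segment_same_Re)
      then show "z \<in> resolvent_set" using abs_Re_le_cmod[of z] that(1) K by (auto simp: resolvent_set_def)
    qed
    ultimately show ?thesis unfolding L_def
      by (intro contour_integral_split_linepath holomorphic_on_imp_continuous_on holomorphic_on_subset[OF hol])
  qed
  \<comment> \<open>On each open half plane the integrand has a primitive, so integrals depend on
    end points alone; this moves the horizontal sides to heights y and - y.\<close>
  obtain P where P: "\<And>z. Im z > 0 \<Longrightarrow> (P has_field_derivative F z) (at z within {z. Im z > 0})"
  proof (rule holomorphic_convex_primitive'[of "{z. Im z > 0}" F])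
    show "F holomorphic_on {z. Im z > 0}" by (rule holomorphic_on_subset[OF hol]) (auto simp: resolvent_set_def)
    fix g assume g: "\<And>x. x \<in> {z. Im z > 0} \<Longrightarrow> (g has_field_derivative F x) (at x within {z. Im z > 0})"
    show thesis by (rule that[of g]) (use g in simp)
  qed (simp_all add: convex_halfspace_Im_gt open_halfspace_Im_gt)
  have up: "L a b = P b - P a" if "Im a > 0" "Im b > 0" for a b
  proof -
    have "closed_segment a b \<subseteq> {z. Im z > 0}"
      using that by (intro closed_segment_subset convex_halfspace_Im_gt) auto
    then show ?thesis unfolding L_def
      using contour_integral_primitive[of "{z. Im z > 0}" P F "linepath a b"] P contour_integral_unique by auto
  qed
  obtain Q where Q: "\<And>z. Im z < 0 \<Longrightarrow> (Q has_field_derivative F z) (at z within {z. Im z < 0})"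
  proof (rule holomorphic_convex_primitive'[of "{z. Im z < 0}" F])
    show "F holomorphic_on {z. Im z < 0}" by (rule holomorphic_on_subset[OF hol]) (auto simp: resolvent_set_def)
    fix g assume g: "\<And>x. x \<in> {z. Im z < 0} \<Longrightarrow> (g has_field_derivative F x) (at x within {z. Im z < 0})"
    show thesis by (rule that[of g]) (use g in simp)
  qed (simp_all add: convex_halfspace_Im_lt open_halfspace_Im_lt)
  have down: "L a b = Q b - Q a" if "Im a < 0" "Im b < 0" for a b
  proof -
    have "closed_segment a b \<subseteq> {z. Im z < 0}"
      using that by (intro closed_segment_subset convex_halfspace_Im_lt) auto
    then show ?thesis unfolding L_def
      using contour_integral_primitive[of "{z. Im z < 0}" Q F "linepath a b"] Q contour_integral_unique by auto
  qed
  have "L (Complex K (- K)) (Complex K K)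
      = L (Complex K (- K)) (Complex K (- y)) + (L (Complex K (- y)) (Complex K y) + L (Complex K y) (Complex K K))"
    using split[of K "- y" "- K" K] split[of K y "- y" K] y K0 by (simp add: closed_segment_eq_real_ivl)
  moreover have "L (Complex (- K) K) (Complex (- K) (- K))
      = L (Complex (- K) K) (Complex (- K) y) + (L (Complex (- K) y) (Complex (- K) (- y)) + L (Complex (- K) (- y)) (Complex (- K) (- K)))"
    using split[of "- K" y K "- K"] split[of "- K" "- y" y "- K"] y K0 by (simp add: closed_segment_eq_real_ivl)
  ultimately have "- (2 * pi * \<i>) * coord (evolution t w) n = L (Complex (- K) (- y)) (Complex K (- y))
     + L (Complex K (- y)) (Complex K y) + L (Complex K y) (Complex (- K) y) + L (Complex (- K) y) (Complex (- K) (- y))"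
    using y K0 by (simp add: up down)
  then have sum: "cmod (- (2 * pi * \<i>) * coord (evolution t w) n) \<le> cmod (L (Complex (- K) (- y)) (Complex K (- y)))
     + cmod (L (Complex K (- y)) (Complex K y)) + cmod (L (Complex K y) (Complex (- K) y)) + cmod (L (Complex (- K) y) (Complex (- K) (- y)))"
    by (simp only: norm_add4)
  have expF: "cmod (F z) \<le> exp (t * y) * cmod (coord (resolvent z w) n)" if "Im z \<le> y" for z
    unfolding F_def norm_mult using that t by (intro mult_right_mono) (auto intro: mult_left_mono)
  have bnd: "cmod (L a b) \<le> C * cmod (b - a)"
    if "closed_segment a b \<subseteq> resolvent_set" "C \<ge> 0" "\<And>z. z \<in> closed_segment a b \<Longrightarrow> cmod (F z) \<le> C" for a b C
    unfolding L_def using that hol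
    by (intro contour_integral_bound_linepath contour_integrable_continuous_linepath
        holomorphic_on_imp_continuous_on) (auto intro: holomorphic_on_subset)
  have hor: "cmod (L (Complex a s) (Complex b s)) \<le> (exp (t * y) * G) * (2 * K)"
    if "\<bar>a\<bar> = K" "b = - a" "s \<in> {y, - y}" for a b s
  proof -
    have seg: "z = Complex (Re z) s \<and> \<bar>Re z\<bar> \<le> K" if "z \<in> closed_segment (Complex a s) (Complex b s)" for z
      using that \<open>\<bar>a\<bar> = K\<close> \<open>b = - a\<close>
      by (auto simp: closed_segment_same_Im closed_segment_eq_real_ivl complex_eq_iff split: if_splits)
    have "cmod (L (Complex a s) (Complex b s)) \<le> (exp (t * y) * G) * cmod (Complex b s - Complex a s)"
    proof (rule bnd)
      show "closed_segment (Complex a s) (Complex b s) \<subseteq> resolvent_set"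
      proof
        fix z assume "z \<in> closed_segment (Complex a s) (Complex b s)"
        then have "Im z = s" using seg[of z] by (metis complex.sel(2))
        then show "z \<in> resolvent_set" using that(3) y by (auto simp: resolvent_set_def)
      qed
      show "0 \<le> exp (t * y) * G" using G by simp
      fix z assume z: "z \<in> closed_segment (Complex a s) (Complex b s)"
      have "Im z = s" using seg[OF z] by (metis complex.sel(2))
      then have "cmod (F z) \<le> exp (t * y) * cmod (coord (resolvent z w) n)" using that(3) y by (intro expF) auto
      also have "cmod (coord (resolvent z w) n) \<le> G"
        using seg[OF z] top[of "Re z"] bot[of "Re z"] that(3) by auto
      finally show "cmod (F z) \<le> exp (t * y) * G" by simp
    qed
    also have "cmod (Complex b s - Complex a s) = 2 * K"
      using that(1,2) by (simp add: cmod_Complex_diff)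
    finally show ?thesis .
  qed
  have vert: "cmod (L (Complex a s) (Complex a (- s))) \<le> (exp (t * y) * G') * (2 * y)"
    if "\<bar>a\<bar> = K" "s \<in> {y, - y}" for a s
  proof -
    have seg: "Re z = a \<and> Im z \<le> y" if "z \<in> closed_segment (Complex a s) (Complex a (- s))" for z
      using that \<open>s \<in> {y, - y}\<close> y
      by (auto simp: closed_segment_same_Re closed_segment_eq_real_ivl split: if_splits)
    have zK: "cmod z \<ge> K" if "z \<in> closed_segment (Complex a s) (Complex a (- s))" for z
      using seg[OF that] \<open>\<bar>a\<bar> = K\<close> abs_Re_le_cmod[of z] by auto
    have "cmod (L (Complex a s) (Complex a (- s))) \<le> (exp (t * y) * G') * cmod (Complex a (- s) - Complex a s)"
    proof (rule bnd)
      show "closed_segment (Complex a s) (Complex a (- s)) \<subseteq> resolvent_set" using zK K by (force simp: resolvent_set_def)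
      show "0 \<le> exp (t * y) * G'" using G by simp
      fix z assume z: "z \<in> closed_segment (Complex a s) (Complex a (- s))"
      have "cmod (F z) \<le> exp (t * y) * cmod (coord (resolvent z w) n)" using seg[OF z] by (intro expF) auto
      also have "cmod (coord (resolvent z w) n) \<le> G'" using side zK[OF z] .
      finally show "cmod (F z) \<le> exp (t * y) * G'" by simp
    qed
    also have "cmod (Complex a (- s) - Complex a s) = 2 * y"
      using that(2) y by (auto simp: cmod_Complex_diff)
    finally show ?thesis .
  qed
  \<comment> \<open>Two long sides of length 2 K and two short ones of length 2 y \<le> 2 K add up
    to 4 K (G + G'), which is divided by 2 \<pi> \<ge> 4.\<close>
  have "2 * pi * cmod (coord (evolution t w) n) \<le> 2 * ((exp (t * y) * G) * (2 * K)) + 2 * ((exp (t * y) * G') * (2 * y))"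
    using sum hor[of "- K" K "- y"] hor[of K "- K" y] vert[of K "- y"] vert[of "- K" y] K0
    by (simp add: norm_mult)
  also have "(exp (t * y) * G') * (2 * y) \<le> (exp (t * y) * G') * (2 * K)"
    using y G by (intro mult_left_mono) auto
  finally have "2 * pi * cmod (coord (evolution t w) n) \<le> 4 * (exp (t * y) * K * (G + G'))"
    by (simp add: algebra_simps)
  moreover have "4 * cmod (coord (evolution t w) n) \<le> 2 * pi * cmod (coord (evolution t w) n)"
    using pi_gt3 by (intro mult_right_mono) auto
  ultimately show ?thesis by linarith
qed

end


section \<open>Green's function of the Schroedinger operator\<close>

lemma cinner_add_right: "cinner u (v + w) = cinner u v + cinner u w"
  by (subst (1 2 3) cinner_commute) (simp add: cinner_add_left)

lemma schroedinger_sym: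
  assumes "bounded (range f)"
  shows "cinner (schroedinger f \<omega> \<theta> u) v = cinner u (schroedinger f \<omega> \<theta> v)"
proof -
  obtain M where M: "\<And>x. \<bar>f x\<bar> \<le> M" using assms by (auto simp: bounded_iff)
  define S where "S k u = (Abs_ell2 (\<lambda>n. coord u (n + k)) :: int ell2)" for k :: int and u
  define W where "W u = (Abs_ell2 (\<lambda>n. of_real (f (of_int n * \<omega> + \<theta>)) * coord u n) :: int ell2)" for u
  have S: "coord (S k u) n = coord u (n + k)" for k u n
    unfolding S_def by (subst Abs_ell2_inverse) (simp_all add: square_summable_shift)
  have W: "coord (W u) n = of_real (f (of_int n * \<omega> + \<theta>)) * coord u n" for u n
    unfolding W_def by (subst Abs_ell2_inverse) (simp_all, rule square_summable_mult, rule M)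
  have dec: "schroedinger f \<omega> \<theta> u = S (-1) u + S 1 u + W u" for u
    by (rule coord_inject[THEN iffD1], rule ext)
      (simp add: plus_ell2.rep_eq coord_schroedinger[OF assms] S W)
  have symS: "cinner (S k u) v = cinner u (S (- k) v)" for k u v
  proof -
    have "bij_betw (\<lambda>n. n + k) UNIV UNIV" by (simp add: bij_betw_def surj_plus_right)
    from infsum_reindex_bij_betw[OF this, of "\<lambda>n. coord u n * cnj (coord v (n - k))"]
    show ?thesis by (simp add: cinner_def S)
  qed
  have symW: "cinner (W u) v = cinner u (W v)" for u v
    by (simp add: cinner_def W mult_ac)
  show ?thesis unfolding dec cinner_add_left cinner_add_right symS symW by (simp add: add_ac)
qed

lemma schroedinger_selfadjoint:
  assumes "bounded (range f)"
  shows "\<exists>B. bounded_selfadjoint (schroedinger f \<omega> \<theta>) B"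
proof -
  let ?H = "schroedinger f \<omega> \<theta>"
  have bl: "bounded_linear ?H" using bounded_linear_schroedinger[OF assms, of 1 \<omega> \<theta>] by simp
  obtain B where B: "B > 0" "\<And>u. norm (?H u) \<le> norm u * B" using bounded_linear.pos_bounded[OF bl] by blast
  have "bounded_selfadjoint ?H B"
  proof
    fix u v c
    show "?H (u + v) = ?H u + ?H v" by (rule linear_add[OF bounded_linear.linear[OF bl]])
    show "?H (cscale c u) = cscale c (?H u)"
      by (rule coord_inject[THEN iffD1], rule ext)
        (simp add: cscale.rep_eq coord_schroedinger[OF assms] algebra_simps)
    show "norm (?H u) \<le> B * norm u" using B(2)[of u] by (simp add: mult.commute)
    show "cinner (?H u) v = cinner u (?H v)" by (rule schroedinger_sym[OF assms])
  qed (rule B(1))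
  then show ?thesis by blast
qed

text \<open>Each application of the operator spreads the support by one site.\<close>

lemma schroedinger_power_support:
  assumes "bounded (range f)" "int k < \<bar>e - m\<bar>"
  shows "coord ((schroedinger f \<omega> \<theta> ^^ k) (delta m)) e = 0"
  using assms(2)
proof (induction k arbitrary: e)
  case 0
  then show ?case by (auto simp: delta.rep_eq)
next
  case (Suc k)
  then show ?case by (simp add: coord_schroedinger[OF assms(1)])
qed

section \<open>Sums and integrals with exponential weights\<close>

lemma exp_half_le_2: "exp (1 / 2) \<le> (2::real)"
proof -
  have "exp (1 / 2) ^ 2 = exp (1::real)" by (simp flip: exp_of_nat_mult)
  also have "\<dots> \<le> 2 ^ 2" using exp_le by simp
  finally show ?thesis by (rule power2_le_imp_le) simp
qed

lemma sum_power_abs_le: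
  fixes x :: real
  assumes "0 \<le> x" "x < 1" "finite F"
  shows "(\<Sum>n\<in>F. x ^ nat \<bar>n\<bar>) \<le> 2 / (1 - x)"
proof -
  have half: "(\<Sum>n\<in>G. x ^ nat \<bar>n\<bar>) \<le> 1 / (1 - x)" if "finite G" "inj_on (\<lambda>n. nat \<bar>n\<bar>) G" for G :: "int set"
  proof -
    have "(\<Sum>n\<in>G. x ^ nat \<bar>n\<bar>) = (\<Sum>k\<in>(\<lambda>n. nat \<bar>n\<bar>) ` G. x ^ k)"
      using that by (simp add: sum.reindex)
    also have "\<dots> \<le> (\<Sum>k. x ^ k)"
      using assms that by (intro sum_le_suminf summable_geometric) auto
    also have "\<dots> = 1 / (1 - x)" using assms by (simp add: suminf_geometric)
    finally show ?thesis .
  qed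
  have "F = {n\<in>F. n \<ge> 0} \<union> {n\<in>F. n < 0}" by auto
  then have "(\<Sum>n\<in>F. x ^ nat \<bar>n\<bar>) = (\<Sum>n\<in>{n\<in>F. n \<ge> 0}. x ^ nat \<bar>n\<bar>) + (\<Sum>n\<in>{n\<in>F. n < 0}. x ^ nat \<bar>n\<bar>)"
    using assms(3) by (subst sum.union_disjoint[symmetric]) auto
  also have "\<dots> \<le> 1 / (1 - x) + 1 / (1 - x)"
    using assms(3) by (intro add_mono half) (auto simp: inj_on_def)
  finally show ?thesis by simp
qed

text \<open>12 = 2 * 6: exp (a / 2) is at most 2 and the geometric sum at most 6 / a; the rest comes
  from x^P \<le> P! exp x.\<close>

definition poly_exp_const :: "nat \<Rightarrow> real" where
  "poly_exp_const P = 12 * fact P * 2 ^ P"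

text \<open>Half of the exponential is spent on the polynomial weight, the other half is summed
  geometrically. The power P + 1 of 1 / a decides how large the norm of the block has to be.\<close>

lemma poly_exp_sum_le:
  fixes a p :: real and P :: nat
  assumes a: "0 < a" "a \<le> 1" and p: "p \<le> real P" and F: "finite F"
  shows "(\<Sum>n\<in>F. (1 + \<bar>real_of_int n\<bar>) powr p * exp (- a * \<bar>real_of_int n\<bar>)) \<le> poly_exp_const P / a ^ Suc P"
proof -
  have pt: "(1 + r) powr p * exp (- a * r) \<le> 2 * fact P * (2 / a) ^ P * exp (- (a / 2) * r)" if r: "r \<ge> 0" for r
  proof -
    define x where "x = a * (1 + r) / 2"
    have x: "x \<ge> 0" using a r by (simp add: x_def)
    have "(1 + r) powr p \<le> (1 + r) powr real P" using p r by (intro powr_mono) auto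
    also have "\<dots> = (1 + r) ^ P" using r by (simp add: powr_realpow)
    also have "\<dots> = (2 / a * x) ^ P"
    proof -
      have "1 + r = 2 / a * x" using a by (simp add: x_def field_simps)
      then show ?thesis by (simp only:)
    qed
    also have "(2 / a * x) ^ P = (2 / a) ^ P * x ^ P" by (rule power_mult_distrib)
    also have "x ^ P \<le> fact P * exp x"
    proof -
      have "(\<Sum>n\<in>{P}. inverse (fact n) * x ^ n) \<le> (\<Sum>n. inverse (fact n) * x ^ n)"
        using x by (intro sum_le_suminf summable_exp) auto
      then have "inverse (fact P) * x ^ P \<le> exp x" by (simp add: exp_def)
      then show ?thesis by (simp add: field_simps)
    qed
    finally have "(1 + r) powr p * exp (- a * r) \<le> (2 / a) ^ P * (fact P * exp x) * exp (- a * r)"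
      using a by (simp add: mult_left_mono mult_right_mono)
    also have "\<dots> = fact P * (2 / a) ^ P * (exp (a / 2) * exp (- (a / 2) * r))"
    proof -
      have "exp x * exp (- a * r) = exp (a / 2) * exp (- (a / 2) * r)"
        by (simp add: x_def field_simps flip: exp_add)
      then show ?thesis by (simp add: mult_ac)
    qed
    also have "exp (a / 2) \<le> 2" using a by (intro order_trans[OF _ exp_half_le_2]) auto
    finally show ?thesis using a by (simp add: mult_left_mono mult_right_mono mult_ac)
  qed
  define x where "x = exp (- (a / 2))"
  have x: "0 \<le> x" "x < 1" using a by (auto simp: x_def)
  have "(\<Sum>n\<in>F. (1 + \<bar>real_of_int n\<bar>) powr p * exp (- a * \<bar>real_of_int n\<bar>))
    \<le> (\<Sum>n\<in>F. 2 * fact P * (2 / a) ^ P * exp (- (a / 2) * \<bar>real_of_int n\<bar>))"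
    by (intro sum_mono pt) auto
  also have "\<dots> = 2 * fact P * (2 / a) ^ P * (\<Sum>n\<in>F. x ^ nat \<bar>n\<bar>)"
  proof -
    have "exp (- (a / 2) * \<bar>real_of_int n\<bar>) = x ^ nat \<bar>n\<bar>" for n :: int
      unfolding x_def exp_of_nat_mult[symmetric] by (simp add: mult.commute)
    then show ?thesis by (simp only: sum_distrib_left)
  qed
  also have "\<dots> \<le> 2 * fact P * (2 / a) ^ P * (2 / (1 - x))"
    using a by (intro mult_left_mono sum_power_abs_le x F) auto
  also have "\<dots> \<le> 2 * fact P * (2 / a) ^ P * (6 / a)"
  proof (rule mult_left_mono)
    have "(1 + a / 2) * x \<le> exp (a / 2) * x" using x by (intro mult_right_mono exp_ge_add_one_self)
    also have "\<dots> = 1" by (simp add: x_def flip: exp_add)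
    finally have "(1 + a / 2) * x \<le> 1" .
    moreover have "(1 - x) * (1 + a / 2) = 1 + a / 2 - (1 + a / 2) * x"
      by (simp only: left_diff_distrib mult_1_left mult.commute[of x])
    ultimately have "a / 2 \<le> (1 - x) * (1 + a / 2)" by linarith
    also have "\<dots> \<le> (1 - x) * (3 / 2)" using a x by (intro mult_left_mono) auto
    finally show "2 / (1 - x) \<le> 6 / a" using a x by (simp add: field_simps)
  qed (use a in simp)
  also have "\<dots> = poly_exp_const P / a ^ Suc P"
    by (simp add: poly_exp_const_def power_divide mult_ac)
  finally show ?thesis .
qed

lemma exp_integral:
  fixes a :: real
  assumes "a > 0"
  shows "set_integrable lborel {0..} (\<lambda>t. exp (- a * t))" "(LBINT t:{0..}. exp (- a * t)) = 1 / a"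
proof -
  have hi: "((\<lambda>t. exp (- a * t)) has_integral 1 / a) {0..}"
    using has_integral_exp_minus_to_infinity[OF assms, of 0] by simp
  then have "(\<lambda>t. exp (- a * t)) absolutely_integrable_on {0..}"
    by (intro nonnegative_absolutely_integrable_1) auto
  then show int: "set_integrable lborel {0..} (\<lambda>t. exp (- a * t))"
    unfolding set_integrable_def by (subst (asm) integrable_completion) auto
  show "(LBINT t:{0..}. exp (- a * t)) = 1 / a"
    using set_borel_integral_eq_integral(2)[OF int] hi by (simp add: integral_unique)
qed

section \<open>Decay of resolvent entries and amplitudes\<close>

locale schroedinger_model =
  bounded_potential f F + bounded_selfadjoint "schroedinger f \<omega> \<theta>" B for f F \<omega> \<theta> B
begin

lemma bounded_range: "bounded (range f)"
  using f_bound by (auto simp: bounded_iff)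

lemma resolvent_solves:
  assumes "z \<in> resolvent_set" "i \<noteq> m"
  shows "solves_at (\<lambda>i. f (of_int i * \<omega> + \<theta>)) z (coord (resolvent z (delta m))) i"
proof -
  have "coord (schroedinger f \<omega> \<theta> (resolvent z (delta m)) - cscale z (resolvent z (delta m))) i = 0"
    unfolding resolvent_eq[OF assms(1)] using assms(2) by (simp add: delta.rep_eq)
  then show ?thesis
    by (simp add: solves_at_def minus_ell2.rep_eq cscale.rep_eq coord_schroedinger[OF bounded_range])
qed

lemma resolvent_square_sum:
  assumes "Im z \<noteq> 0" "finite G"
  shows "(\<Sum>i\<in>G. (cmod (coord (resolvent z (delta m)) i))\<^sup>2) \<le> (1 / \<bar>Im z\<bar>)\<^sup>2"
proof -
  have "norm (resolvent z (delta m)) \<le> 1 / \<bar>Im z\<bar>"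
    using norm_resolvent_le[OF _ bounded_below_Im[OF assms(1)], of "delta m"] assms(1) by (simp add: resolvent_set_def norm_delta)
  then have "(norm (resolvent z (delta m)))\<^sup>2 \<le> (1 / \<bar>Im z\<bar>)\<^sup>2" by (intro power_mono) auto
  then show ?thesis using sum_coord_le_norm[OF assms(2), of "resolvent z (delta m)"] by linarith
qed

text \<open>Two bounds on the squared entry g are multiplied: the block gives a factor 1 / S^2 but
  no decay in |e - m|, the flux argument gives exponential decay but no smallness. The geometric
  mean keeps 1 / S and half of the decay. The window of length q starts just right of the left one
  of the two sites, so the block lies between them as soon as |e - m| > q.\<close>

lemma green_function_bound:
  fixes q k :: nat and K S y :: real
  defines "D \<equiv> 2 * (K + 1 + F)\<^sup>2 + 3"
  assumes y: "0 < y" "y \<le> 1" and z: "\<bar>Re z\<bar> \<le> K" "\<bar>Im z\<bar> = y"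
    and S: "S > 0" "S\<^sup>2 \<ge> D / y" and k: "k \<ge> 1"
    and growth: "\<And>\<theta>'. \<exists>i. i + k \<le> q \<and> S \<le> opnorm (cocycle f \<omega> z k (\<theta>' + real i * \<omega>))"
    and far: "int q < \<bar>e - m\<bar>"
  shows "(cmod (coord (resolvent z (delta m)) e))\<^sup>2 \<le> 4 * D / (S * y ^ 4) * exp (- y * \<bar>real_of_int (e - m)\<bar> / 4)"
proof -
  have Im: "Im z \<noteq> 0" and resolvent_set: "z \<in> resolvent_set" using y z by (auto simp: resolvent_set_def)
  have D: "D > 0" by (simp add: D_def add_nonneg_pos)
  define g where "g = (cmod (coord (resolvent z (delta m)) e))\<^sup>2"
  have L: "cmod (z - of_real (f x)) \<le> K + 1 + F" for x
  proof -
    have "cmod (z - of_real (f x)) \<le> cmod z + \<bar>f x\<bar>" by (rule order_trans[OF norm_triangle_ineq4]) simp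
    then show ?thesis using cmod_le[of z] z y f_bound[of x] by linarith
  qed
  have "\<exists>c. S \<le> opnorm (cocycle f \<omega> z k (\<theta> + of_int c * \<omega>)) \<and> (e < c \<and> c + int k \<le> m \<or> m < c \<and> c + int k \<le> e)"
  proof (cases "e < m")
    case True
    obtain i where i: "i + k \<le> q" "S \<le> opnorm (cocycle f \<omega> z k (\<theta> + of_int (e + 1) * \<omega> + real i * \<omega>))"
      using growth by blast
    have "\<theta> + of_int (e + 1) * \<omega> + real i * \<omega> = \<theta> + of_int (e + 1 + int i) * \<omega>" by (simp add: algebra_simps)
    from i(2)[unfolded this] show ?thesis using i(1) far True by (intro exI[of _ "e + 1 + int i"]) auto
  next
    case False
    obtain i where i: "i + k \<le> q" "S \<le> opnorm (cocycle f \<omega> z k (\<theta> + of_int (m + 1) * \<omega> + real i * \<omega>))"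
      using growth by blast
    have "\<theta> + of_int (m + 1) * \<omega> + real i * \<omega> = \<theta> + of_int (m + 1 + int i) * \<omega>" by (simp add: algebra_simps)
    from i(2)[unfolded this] show ?thesis using i(1) far False by (intro exI[of _ "m + 1 + int i"]) auto
  qed
  then obtain c where c: "S \<le> opnorm (cocycle f \<omega> z k (\<theta> + of_int c * \<omega>))"
    "e < c \<and> c + int k \<le> m \<or> m < c \<and> c + int k \<le> e" by blast
  have "g \<le> 2 * D\<^sup>2 * (1 / \<bar>Im z\<bar>)\<^sup>2 / (S\<^sup>2 * \<bar>Im z\<bar> ^ 3)"
    unfolding g_def D_def
    by (rule growth_decay[OF resolvent_solves[OF resolvent_set] Im resolvent_square_sum[OF Im] L S(1) _ c(1) k c(2)])
      (use S(2) z in \<open>auto simp: D_def\<close>)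
  also have "\<dots> = 2 * D\<^sup>2 / (S\<^sup>2 * y ^ 5)"
    using y z by (simp add: power2_eq_square power3_eq_cube eval_nat_numeral)
  finally have X: "g \<le> 2 * D\<^sup>2 / (S\<^sup>2 * y ^ 5)" .
  \<comment> \<open>The flux gains one factor per two sites, after one site at the source. From |e -
    m| \<le> 2 j + 2 the geometric mean decays at rate y / 4 per site.\<close>
  define j where "j = nat (\<bar>e - m\<bar> - 1) div 2"
  have j: "1 + 2 * int j \<le> \<bar>e - m\<bar>" "\<bar>e - m\<bar> \<le> 2 * int j + 2" using far unfolding j_def by linarith+
  have "g \<le> (1 / \<bar>Im z\<bar>)\<^sup>2 / (\<bar>Im z\<bar> * (1 + 2 * \<bar>Im z\<bar>) ^ j)"
    unfolding g_def by (rule two_sided_exponential_decay[OF resolvent_solves[OF resolvent_set] Im resolvent_square_sum[OF Im] j(1)])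
  also have "\<dots> = 1 / (y ^ 3 * (1 + 2 * y) ^ j)"
    unfolding z(2) by (simp add: power2_eq_square power3_eq_cube)
  also have "\<dots> \<le> 1 / (y ^ 3 * exp y ^ j)"
  proof -
    have "exp y \<le> 1 + 2 * y"
    proof -
      have "exp y \<le> 1 + y + y\<^sup>2" using y by (intro exp_bound) auto
      also have "y\<^sup>2 \<le> y" using y by (simp add: power2_eq_square mult_left_le)
      finally show ?thesis by simp
    qed
    then show ?thesis using y by (intro divide_left_mono mult_left_mono power_mono mult_pos_pos) auto
  qed
  also have "\<dots> = exp (- (y * j)) / y ^ 3" by (simp add: exp_minus divide_inverse mult.commute flip: exp_of_nat_mult)
  finally have Y: "g \<le> exp (- (y * j)) / y ^ 3" .
  have "g * g \<le> 2 * D\<^sup>2 / (S\<^sup>2 * y ^ 5) * (exp (- (y * j)) / y ^ 3)"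
    using X Y D y S by (intro mult_mono) (auto simp: g_def)
  also have "\<dots> = 2 * (D / (S * y ^ 4) * exp (- (y * j / 2)))\<^sup>2"
  proof -
    have "exp (- (y * j / 2)) ^ 2 = exp (- (y * j))" by (simp flip: exp_of_nat_mult)
    moreover have "y ^ 5 * y ^ 3 = (y ^ 4)\<^sup>2" by (simp flip: power_add power_mult)
    ultimately show ?thesis by (simp add: power_mult_distrib power_divide mult_ac)
  qed
  also have "\<dots> \<le> (2 * (D / (S * y ^ 4) * exp (- (y * j / 2))))\<^sup>2"
  proof -
    have "2 * X\<^sup>2 \<le> (2 * X)\<^sup>2" for X :: real by (simp add: power2_eq_square)
    then show ?thesis .
  qed
  finally have "g\<^sup>2 \<le> (2 * (D / (S * y ^ 4) * exp (- (y * j / 2))))\<^sup>2" by (simp add: power2_eq_square)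
  then have "g \<le> 2 * (D / (S * y ^ 4) * exp (- (y * j / 2)))"
    by (rule power2_le_imp_le) (use D S y in auto)
  also have "exp (- (y * j / 2)) \<le> 2 * exp (- y * \<bar>real_of_int (e - m)\<bar> / 4)"
  proof -
    have "real_of_int \<bar>e - m\<bar> \<le> real_of_int (2 * int j + 2)" using j(2) by (simp only: of_int_le_iff)
    then have "y * \<bar>real_of_int (e - m)\<bar> \<le> y * (2 * j + 2)" using y by (intro mult_left_mono) auto
    then have "exp (- (y * j / 2)) \<le> exp (1 / 2 + - y * \<bar>real_of_int (e - m)\<bar> / 4)"
      using y by (simp add: field_simps)
    also have "\<dots> = exp (1 / 2) * exp (- y * \<bar>real_of_int (e - m)\<bar> / 4)" by (rule exp_add)
    also have "exp (1 / 2) \<le> (2::real)" by (rule exp_half_le_2)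
    finally show ?thesis by simp
  qed
  finally show ?thesis using D S y unfolding g_def by (simp add: mult_left_mono mult_ac divide_right_mono)
qed

text \<open>The contour has half-width K = 2 B. On its short sides the Neumann expansion has no
  terms below order |e - m|, by finite range, and its ratio is B / K = 1 / 2; squaring yields 1 /
  4.\<close>

lemma amplitude_bound:
  fixes q k :: nat and S y t :: real
  defines "D \<equiv> 2 * (2 * B + 1 + F)\<^sup>2 + 3"
  assumes y: "0 < y" "y \<le> 1" "y \<le> 2 * B" and t: "t \<ge> 0"
    and S: "S > 0" "S\<^sup>2 \<ge> D / y" and k: "k \<ge> 1"
    and growth: "\<And>\<theta>' E y'. \<bar>E\<bar> \<le> 2 * B \<Longrightarrow> \<bar>y'\<bar> = y \<Longrightarrow>
      \<exists>i. i + k \<le> q \<and> S \<le> opnorm (cocycle f \<omega> (Complex E y') k (\<theta>' + real i * \<omega>))"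
    and far: "int q < \<bar>e - m\<bar>"
  shows "(cmod (coord (evolution t (delta m)) e))\<^sup>2
    \<le> exp (2 * t * y) * (32 * B\<^sup>2 * D / (S * y ^ 4) * exp (- y * \<bar>real_of_int (e - m)\<bar> / 4) + 8 * (1 / 4) ^ nat \<bar>e - m\<bar>)"
proof -
  define N where "N = nat \<bar>e - m\<bar>"
  define X where "X = 4 * D / (S * y ^ 4) * exp (- y * \<bar>real_of_int (e - m)\<bar> / 4)"
  have D: "D > 0" by (simp add: D_def add_nonneg_pos)
  have X: "X \<ge> 0" using D S y by (simp add: X_def)
  have g: "cmod (coord (resolvent (Complex x y') (delta m)) e) \<le> sqrt X" if "\<bar>x\<bar> \<le> 2 * B" "\<bar>y'\<bar> = y" for x y'
  proof (rule real_le_rsqrt)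
    show "(cmod (coord (resolvent (Complex x y') (delta m)) e))\<^sup>2 \<le> X"
      unfolding X_def D_def
      by (rule green_function_bound[OF y(1,2) _ _ S(1) _ k _ far]) (use that S(2) growth[of x y'] in \<open>auto simp: D_def\<close>)
  qed
  have "cmod (coord (evolution t (delta m)) e) \<le> exp (t * y) * (2 * B) * (sqrt X + (1 / 2) ^ N / B)"
  proof (rule coord_evolution_le[OF _ y(1,3) t])
    fix z :: complex assume z: "2 * B \<le> cmod z"
    have "coord ((schroedinger f \<omega> \<theta> ^^ k) (delta m)) e = 0" if "k < N" for k
      using that by (intro schroedinger_power_support[OF bounded_range]) (simp add: N_def)
    then have "cmod (coord (resolvent z (delta m)) e) \<le> (B / (2 * B)) ^ N * norm (delta m) / (2 * B - B)"
      using neumann_remainder[OF z, of "delta m" e N] B_pos by simp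
    also have "B / (2 * B) = 1 / 2" using B_pos by simp
    finally show "cmod (coord (resolvent z (delta m)) e) \<le> (1 / 2) ^ N / B" by (simp add: norm_delta)
  qed (use X B_pos g y in auto)
  then have "(cmod (coord (evolution t (delta m)) e))\<^sup>2 \<le> (exp (t * y) * (2 * B) * (sqrt X + (1 / 2) ^ N / B))\<^sup>2"
    by (intro power_mono) auto
  also have "\<dots> = exp (2 * t * y) * (4 * B\<^sup>2) * (sqrt X + (1 / 2) ^ N / B)\<^sup>2"
  proof -
    have "exp (t * y) ^ 2 = exp (2 * t * y)" by (simp flip: exp_of_nat_mult)
    then show ?thesis by (simp add: power_mult_distrib)
  qed
  also have "\<dots> \<le> exp (2 * t * y) * (4 * B\<^sup>2) * (2 * X + 2 * ((1 / 4) ^ N / B\<^sup>2))"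
  proof (rule mult_left_mono)
    have "(sqrt X + (1 / 2) ^ N / B)\<^sup>2 \<le> 2 * (sqrt X)\<^sup>2 + 2 * ((1 / 2) ^ N / B)\<^sup>2"
      using sum_squares_bound[of "sqrt X" "(1 / 2) ^ N / B"] by (simp add: power2_sum)
    also have "((1 / 2) ^ N / B)\<^sup>2 = (1 / 4) ^ N / B\<^sup>2"
    proof -
      have "((1 / 2 :: real) ^ N)\<^sup>2 = (1 / 4) ^ N" by (simp add: power2_eq_square flip: power_mult_distrib)
      then show ?thesis by (simp only: power_divide[of _ B])
    qed
    finally show "(sqrt X + (1 / 2) ^ N / B)\<^sup>2 \<le> 2 * X + 2 * ((1 / 4) ^ N / B\<^sup>2)" using X by simp
  qed simp
  also have "\<dots> = exp (2 * t * y) * (8 * B\<^sup>2 * X + 8 * (1 / 4) ^ N)"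
    using B_pos by (simp add: algebra_simps)
  finally show ?thesis by (simp add: X_def N_def mult_ac)
qed

section \<open>Position probabilities and their moments\<close>

lemma prob_eq: "prob f \<omega> \<theta> n t
  = ((cmod (coord (evolution t (delta 0)) n))\<^sup>2 + (cmod (coord (evolution t (delta 1)) n))\<^sup>2) / 2"
  by (simp add: prob_def propagator_def evolution_def cinner_delta)

lemma prob_nonneg: "0 \<le> prob f \<omega> \<theta> n t"
  by (simp add: prob_def)

lemma prob_sum_le:
  assumes "finite G"
  shows "(\<Sum>n\<in>G. prob f \<omega> \<theta> n t) \<le> 1"
proof -
  have "(\<Sum>n\<in>G. prob f \<omega> \<theta> n t) = ((\<Sum>n\<in>G. (cmod (coord (evolution t (delta 0)) n))\<^sup>2)
      + (\<Sum>n\<in>G. (cmod (coord (evolution t (delta 1)) n))\<^sup>2)) / 2"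
    unfolding prob_eq by (simp add: sum.distrib flip: sum_divide_distrib)
  then show ?thesis
    using sum_coord_le_norm[OF assms, of "evolution t (delta 0)"] sum_coord_le_norm[OF assms, of "evolution t (delta 1)"]
    by (simp add: norm_evolution norm_delta)
qed

lemma prob_le_1: "prob f \<omega> \<theta> n t \<le> 1"
  using prob_sum_le[of "{n}" t] by simp

lemma prob_has_sum: "((\<lambda>n. prob f \<omega> \<theta> n t) has_sum 1) UNIV"
proof -
  have *: "((\<lambda>n. (cmod (coord (evolution t (delta m)) n))\<^sup>2) has_sum 1) UNIV" for m
    using has_sum_infsum[OF summable_coord[of "evolution t (delta m)"]] norm_ell2_square[of "evolution t (delta m)"]
    by (simp add: norm_evolution norm_delta)
  from has_sum_cmult_left[OF has_sum_add[OF *[of 0] *[of 1]], of "1 / 2"]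
  show ?thesis by (simp add: prob_eq)
qed

lemma prob_sum_tendsto: "(\<lambda>k. \<Sum>n\<in>{- int k..int k}. prob f \<omega> \<theta> n t) \<longlonglongrightarrow> 1"
proof -
  have "filterlim (\<lambda>k. {- int k..int k}) (finite_subsets_at_top UNIV) sequentially"
    unfolding filterlim_finite_subsets_at_top
  proof (intro allI impI)
    fix X :: "int set" assume X: "finite X \<and> X \<subseteq> UNIV"
    show "\<forall>\<^sub>F k in sequentially. finite {- int k..int k} \<and> X \<subseteq> {- int k..int k} \<and> {- int k..int k} \<subseteq> UNIV"
      unfolding eventually_sequentially
    proof (intro exI[of _ "nat (\<Sum>n\<in>X. \<bar>n\<bar>)"] allI impI conjI subsetI)
      fix k n assume k: "nat (\<Sum>n\<in>X. \<bar>n\<bar>) \<le> k" and n: "n \<in> X"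
      have "\<bar>n\<bar> \<le> (\<Sum>n\<in>X. \<bar>n\<bar>)" using X n by (intro member_le_sum) auto
      then show "n \<in> {- int k..int k}" using k by auto
    qed auto
  qed
  with prob_has_sum[of t] show ?thesis unfolding has_sum_def by (rule filterlim_compose)
qed

lemma continuous_prob: "continuous_on UNIV (\<lambda>t. prob f \<omega> \<theta> n t)"
  unfolding prob_eq by (intro continuous_intros continuous_coord_evolution) simp

lemma weighted_integrable:
  fixes g :: "real \<Rightarrow> real"
  assumes "T > 0" "continuous_on UNIV g" "\<And>t. 0 \<le> g t" "\<And>t. g t \<le> 1"
  shows "set_integrable lborel {0..} (\<lambda>t. exp (- 2 * t / T) * g t)"
proof (rule set_integrable_bound)
  show "set_integrable lborel {0..} (\<lambda>t. exp (- (2 / T) * t))"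
    using assms(1) by (intro exp_integral) auto
  have "g \<in> borel_measurable borel" using assms(2) by (rule borel_measurable_continuous_onI)
  then show "set_borel_measurable lborel {0..} (\<lambda>t. exp (- 2 * t / T) * g t)"
    unfolding set_borel_measurable_def by measurable
  show "AE t in lborel. t \<in> {0..} \<longrightarrow> norm (exp (- 2 * t / T) * g t) \<le> norm (exp (- (2 / T) * t))"
    using assms by (intro AE_I2) (simp add: abs_mult abs_of_nonneg)
qed

lemma weight_integral:
  fixes T :: real
  assumes "T > 0"
  shows "2 / T * (LBINT t:{0..}. exp (- 2 * t / T)) = 1"
  using exp_integral(2)[of "2 / T"] assms by simp

lemma prob_avg_sum:
  fixes T :: real
  assumes "T > 0" "finite G"
  shows "(\<Sum>n\<in>G. prob_avg f \<omega> \<theta> n T) = 2 / T * (LBINT t:{0..}. exp (- 2 * t / T) * (\<Sum>n\<in>G. prob f \<omega> \<theta> n t))"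
proof -
  have int: "set_integrable lborel {0..} (\<lambda>t. exp (- 2 * t / T) * prob f \<omega> \<theta> n t)" for n
    by (intro weighted_integrable assms continuous_prob prob_nonneg prob_le_1)
  have "(LBINT t:{0..}. (\<Sum>n\<in>G. exp (- 2 * t / T) * prob f \<omega> \<theta> n t))
      = (\<Sum>n\<in>G. LBINT t:{0..}. exp (- 2 * t / T) * prob f \<omega> \<theta> n t)"
    unfolding set_lebesgue_integral_def scaleR_sum_right
    by (intro Bochner_Integration.integral_sum) (use int in \<open>simp add: set_integrable_def\<close>)
  then show ?thesis by (simp add: prob_avg_def sum_distrib_left)
qed

lemma prob_avg_nonneg: "T > 0 \<Longrightarrow> 0 \<le> prob_avg f \<omega> \<theta> n T"
  unfolding prob_avg_def set_lebesgue_integral_def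
  by (intro mult_nonneg_nonneg Bochner_Integration.integral_nonneg) (auto simp: prob_nonneg indicator_def)

lemma prob_avg_sum_le:
  assumes "T > 0" "finite G"
  shows "(\<Sum>n\<in>G. prob_avg f \<omega> \<theta> n T) \<le> 1"
proof -
  have cont: "continuous_on UNIV (\<lambda>t. \<Sum>n\<in>G. prob f \<omega> \<theta> n t)"
    by (intro continuous_on_sum continuous_prob)
  have "(LBINT t:{0..}. exp (- 2 * t / T) * (\<Sum>n\<in>G. prob f \<omega> \<theta> n t)) \<le> (LBINT t:{0..}. exp (- 2 * t / T))"
  proof (rule set_integral_mono)
    show "set_integrable lborel {0..} (\<lambda>t. exp (- 2 * t / T) * (\<Sum>n\<in>G. prob f \<omega> \<theta> n t))"
      using assms by (intro weighted_integrable cont sum_nonneg prob_nonneg prob_sum_le)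
    show "set_integrable lborel {0..} (\<lambda>t. exp (- 2 * t / T))"
      using exp_integral(1)[of "2 / T"] assms by simp
    show "exp (- 2 * t / T) * (\<Sum>n\<in>G. prob f \<omega> \<theta> n t) \<le> exp (- 2 * t / T)" for t
      using prob_sum_le[OF assms(2), of t] by (simp add: mult_left_le)
  qed
  then have "2 / T * (LBINT t:{0..}. exp (- 2 * t / T) * (\<Sum>n\<in>G. prob f \<omega> \<theta> n t)) \<le> 2 / T * (LBINT t:{0..}. exp (- 2 * t / T))"
    using assms by (intro mult_left_mono) auto
  then show ?thesis unfolding prob_avg_sum[OF assms] weight_integral[OF assms(1)] .
qed

text \<open>Total probability one passes through the time average by dominated convergence; it
  yields the lower bound 0 on the averaged exponents.\<close>

lemma prob_avg_sum_tendsto: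
  assumes "T > 0"
  shows "(\<lambda>k. \<Sum>n\<in>{- int k..int k}. prob_avg f \<omega> \<theta> n T) \<longlonglongrightarrow> 1"
proof -
  define P where "P k t = (\<Sum>n\<in>{- int k..int k}. prob f \<omega> \<theta> n t)" for k t
  have contP: "continuous_on UNIV (P k)" for k
    unfolding P_def[abs_def] by (intro continuous_on_sum continuous_prob)
  have P: "0 \<le> P k t" "P k t \<le> 1" for k t
    by (simp_all add: P_def sum_nonneg prob_nonneg prob_sum_le)
  have "(\<lambda>k. LINT t|lborel. indicator {0..} t *\<^sub>R (exp (- 2 * t / T) * P k t))
      \<longlonglongrightarrow> (LINT t|lborel. indicator {0..} t *\<^sub>R exp (- 2 * t / T))"
  proof (rule integral_dominated_convergence[where w = "\<lambda>t. indicator {0..} t *\<^sub>R exp (- 2 * t / T)"])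
    show "integrable lborel (\<lambda>t. indicator {0..} t *\<^sub>R exp (- 2 * t / T))"
      using exp_integral(1)[of "2 / T"] assms by (simp add: set_integrable_def)
    show "(\<lambda>t. indicator {0..} t *\<^sub>R (exp (- 2 * t / T) * P k t)) \<in> borel_measurable lborel" for k
      using weighted_integrable[OF assms contP P] unfolding set_integrable_def by (rule borel_measurable_integrable)
    show "AE t in lborel. (\<lambda>k. indicator {0..} t *\<^sub>R (exp (- 2 * t / T) * P k t)) \<longlonglongrightarrow> indicator {0..} t *\<^sub>R exp (- 2 * t / T)"
    proof (rule AE_I2)
      fix t
      have "(\<lambda>k. indicator {0..} t *\<^sub>R (exp (- 2 * t / T) * P k t)) \<longlonglongrightarrow> indicator {0..} t *\<^sub>R (exp (- 2 * t / T) * 1)"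
        unfolding P_def by (intro tendsto_intros prob_sum_tendsto)
      then show "(\<lambda>k. indicator {0..} t *\<^sub>R (exp (- 2 * t / T) * P k t)) \<longlonglongrightarrow> indicator {0..} t *\<^sub>R exp (- 2 * t / T)" by simp
    qed
    show "AE t in lborel. norm (indicator {0..} t *\<^sub>R (exp (- 2 * t / T) * P k t)) \<le> indicator {0..} t *\<^sub>R exp (- 2 * t / T)" for k
      using P by (intro AE_I2) (auto simp: indicator_def mult_left_le abs_mult)
    show "(\<lambda>t. indicator {0..} t *\<^sub>R exp (- 2 * t / T)) \<in> borel_measurable lborel" by measurable
  qed
  then have "(\<lambda>k. 2 / T * (LBINT t:{0..}. exp (- 2 * t / T) * P k t)) \<longlonglongrightarrow> 2 / T * (LBINT t:{0..}. exp (- 2 * t / T))"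
    unfolding set_lebesgue_integral_def by (intro tendsto_intros)
  then show ?thesis unfolding weight_integral[OF assms] P_def by (simp add: prob_avg_sum[OF assms])
qed

text \<open>If the moment series diverges, the infinite sum is \<open>0\<close> and \<open>ln 0 = 0\<close>, so the
  lower bound holds without knowing summability.\<close>

lemma ln_weighted_infsum_nonneg:
  fixes a :: "int \<Rightarrow> real"
  assumes nonneg: "\<And>n. 0 \<le> a n" and lim: "(\<lambda>k. \<Sum>n\<in>{- int k..int k}. a n) \<longlonglongrightarrow> 1" and p: "p > 0"
  shows "0 \<le> ln (\<Sum>\<^sub>\<infinity>n. (1 + \<bar>real_of_int n\<bar>) powr p * a n)"
proof (cases "(\<lambda>n. (1 + \<bar>real_of_int n\<bar>) powr p * a n) summable_on UNIV")
  case True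
  have "1 \<le> (\<Sum>\<^sub>\<infinity>n. (1 + \<bar>real_of_int n\<bar>) powr p * a n)"
  proof (rule LIMSEQ_le_const2[OF lim], intro exI allI impI)
    fix k :: nat
    have "(\<Sum>n\<in>{- int k..int k}. a n) \<le> (\<Sum>n\<in>{- int k..int k}. (1 + \<bar>real_of_int n\<bar>) powr p * a n)"
    proof (rule sum_mono)
      fix n :: int
      have "1 \<le> (1 + \<bar>real_of_int n\<bar>) powr p" using p by (intro ge_one_powr_ge_zero) auto
      then show "a n \<le> (1 + \<bar>real_of_int n\<bar>) powr p * a n" using nonneg[of n] by (simp add: mult_le_cancel_right1)
    qed
    also have "\<dots> \<le> (\<Sum>\<^sub>\<infinity>n. (1 + \<bar>real_of_int n\<bar>) powr p * a n)"
      using nonneg by (intro finite_sum_le_infsum True) auto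
    finally show "(\<Sum>n\<in>{- int k..int k}. a n) \<le> (\<Sum>\<^sub>\<infinity>n. (1 + \<bar>real_of_int n\<bar>) powr p * a n)" .
  qed
  then show ?thesis by simp
next
  case False
  then show ?thesis by (simp add: infsum_not_exists)
qed

lemma ln_moment_nonneg: "p > 0 \<Longrightarrow> 0 \<le> ln (moment f \<omega> \<theta> p t)"
  unfolding moment_def by (rule ln_weighted_infsum_nonneg[OF prob_nonneg prob_sum_tendsto])

lemma ln_moment_avg_nonneg: "p > 0 \<Longrightarrow> T > 0 \<Longrightarrow> 0 \<le> ln (moment_avg f \<omega> \<theta> p T)"
  unfolding moment_avg_def by (rule ln_weighted_infsum_nonneg[OF prob_avg_nonneg prob_avg_sum_tendsto])

text \<open>Up to distance q + 1 the weight is at most (q + 2)^p and the total mass at most 1;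
  beyond, the majorant W takes over. The bound on finite sums also gives summability.\<close>

lemma weighted_infsum_le:
  fixes a W :: "int \<Rightarrow> real"
  assumes nonneg: "\<And>n. 0 \<le> a n" and total: "\<And>G. finite G \<Longrightarrow> (\<Sum>n\<in>G. a n) \<le> 1" and p: "p > 0"
    and far: "\<And>n. int q + 1 < \<bar>n\<bar> \<Longrightarrow> a n \<le> W n" and W: "\<And>n. 0 \<le> W n"
    and sumW: "\<And>G. finite G \<Longrightarrow> (\<Sum>n\<in>G. (1 + \<bar>real_of_int n\<bar>) powr p * W n) \<le> M"
  shows "(\<Sum>\<^sub>\<infinity>n. (1 + \<bar>real_of_int n\<bar>) powr p * a n) \<le> (real q + 2) powr p + M"
proof -
  have fin: "(\<Sum>n\<in>G. (1 + \<bar>real_of_int n\<bar>) powr p * a n) \<le> (real q + 2) powr p + M" if G: "finite G" for G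
  proof -
    have "(1 + \<bar>real_of_int n\<bar>) powr p * a n \<le> (real q + 2) powr p * a n + (1 + \<bar>real_of_int n\<bar>) powr p * W n" for n
    proof (cases "int q + 1 < \<bar>n\<bar>")
      case True
      then show ?thesis using far[OF True] nonneg[of n] by (simp add: add_increasing mult_left_mono)
    next
      case False
      then have "real_of_int \<bar>n\<bar> \<le> real_of_int (int q + 1)" by (simp only: of_int_le_iff not_less)
      then have "(1 + \<bar>real_of_int n\<bar>) powr p \<le> (real q + 2) powr p" using p by (intro powr_mono2) auto
      then show ?thesis using nonneg[of n] W[of n] by (simp add: add_increasing2 mult_right_mono)
    qed
    then have "(\<Sum>n\<in>G. (1 + \<bar>real_of_int n\<bar>) powr p * a n)
        \<le> (\<Sum>n\<in>G. (real q + 2) powr p * a n + (1 + \<bar>real_of_int n\<bar>) powr p * W n)" by (intro sum_mono)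
    also have "\<dots> = (real q + 2) powr p * (\<Sum>n\<in>G. a n) + (\<Sum>n\<in>G. (1 + \<bar>real_of_int n\<bar>) powr p * W n)"
      by (simp add: sum.distrib sum_distrib_left)
    also have "\<dots> \<le> (real q + 2) powr p * 1 + M"
      by (intro add_mono mult_left_mono total sumW G) auto
    finally show ?thesis by simp
  qed
  have "(\<lambda>n. (1 + \<bar>real_of_int n\<bar>) powr p * a n) summable_on UNIV"
    using fin nonneg by (intro nonneg_bdd_above_summable_on bdd_aboveI) auto
  then show ?thesis by (intro infsum_le_finite_sums fin) auto
qed

end


section \<open>Transport bounds\<close>

context schroedinger_model
begin

definition cocycle_bound :: real where
  "cocycle_bound = 2 * (2 * B + 1 + F)\<^sup>2 + 3"

text \<open>Collects what the decay estimate asks of blocks, uniformly in the phase, in |E| \<le> 2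
  B and in both signs of the imaginary part. S y^(P + 5) \<ge> 1 pays for y^(-4) in the amplitude
  bound and y^(-(P + 1)) in the moment sum.\<close>

definition controlled :: "nat \<Rightarrow> real \<Rightarrow> nat \<Rightarrow> bool" where
  "controlled P y q \<longleftrightarrow> (\<exists>k S. k \<ge> 1 \<and> S > 0 \<and> S\<^sup>2 \<ge> cocycle_bound / y \<and> S * y ^ (P + 5) \<ge> 1 \<and>
    (\<forall>\<theta>' E y'. \<bar>E\<bar> \<le> 2 * B \<longrightarrow> \<bar>y'\<bar> = y \<longrightarrow>
      (\<exists>i. i + k \<le> q \<and> S \<le> opnorm (cocycle f \<omega> (Complex E y') k (\<theta>' + real i * \<omega>)))))"

definition tail_const :: "nat \<Rightarrow> real" where
  "tail_const P = 64 * B\<^sup>2 * cocycle_bound * poly_exp_const P * 4 ^ Suc P + 32 * poly_exp_const P"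

lemma cocycle_bound_pos: "cocycle_bound > 0"
  by (simp add: cocycle_bound_def add_nonneg_pos)

lemma poly_exp_const_pos: "poly_exp_const P > 0"
  by (simp add: poly_exp_const_def)

lemma tail_const_nonneg: "tail_const P \<ge> 0"
  using cocycle_bound_pos poly_exp_const_pos[of P] by (simp add: tail_const_def)

text \<open>W does not depend on t, so one tail serves both a fixed time and the time average, and
  its weighted sum is bounded independently of y and q. The margin q + 1 accounts for the second
  initial site, 1.\<close>

lemma controlled_tail:
  assumes ctrl: "controlled P y q" and y: "0 < y" "y \<le> 1" "y \<le> 2 * B" and p: "p \<le> real P"
  shows "\<exists>W. (\<forall>n. 0 \<le> W n) \<and> (\<forall>n t. int q + 1 < \<bar>n\<bar> \<longrightarrow> 0 \<le> t \<longrightarrow> prob f \<omega> \<theta> n t \<le> exp (2 * t * y) * W n) \<and>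
    (\<forall>G. finite G \<longrightarrow> (\<Sum>n\<in>G. (1 + \<bar>real_of_int n\<bar>) powr p * W n) \<le> tail_const P)"
proof -
  obtain k S where k: "k \<ge> 1" and S: "S > 0" "S\<^sup>2 \<ge> cocycle_bound / y" "S * y ^ (P + 5) \<ge> 1"
    and growth: "\<And>\<theta>' E y'. \<bar>E\<bar> \<le> 2 * B \<Longrightarrow> \<bar>y'\<bar> = y \<Longrightarrow>
      \<exists>i. i + k \<le> q \<and> S \<le> opnorm (cocycle f \<omega> (Complex E y') k (\<theta>' + real i * \<omega>))"
    using ctrl unfolding controlled_def by blast
  define c1 where "c1 = 64 * B\<^sup>2 * cocycle_bound / (S * y ^ 4)"
  have c1: "c1 \<ge> 0" using cocycle_bound_pos S y by (simp add: c1_def)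
  define W where "W n = c1 * exp (- (y / 4) * \<bar>real_of_int n\<bar>) + 32 * exp (- 1 * \<bar>real_of_int n\<bar>)" for n
  have W: "0 \<le> W n" for n using c1 by (simp add: W_def)
  have amp: "(cmod (coord (evolution t (delta m)) n))\<^sup>2 \<le> exp (2 * t * y) * W n"
    if m: "m = 0 \<or> m = 1" and far: "int q + 1 < \<bar>n\<bar>" and t: "0 \<le> t" for m n t
  proof -
    have d: "\<bar>n\<bar> - 1 \<le> \<bar>n - m\<bar>" "int q < \<bar>n - m\<bar>" using m far by auto
    then have dr: "\<bar>real_of_int n\<bar> - 1 \<le> \<bar>real_of_int (n - m)\<bar>" by linarith
    have "(cmod (coord (evolution t (delta m)) n))\<^sup>2
      \<le> exp (2 * t * y) * (32 * B\<^sup>2 * cocycle_bound / (S * y ^ 4) * exp (- y * \<bar>real_of_int (n - m)\<bar> / 4) + 8 * (1 / 4) ^ nat \<bar>n - m\<bar>)"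
      unfolding cocycle_bound_def
      by (rule amplitude_bound[OF y t S(1) _ k _ d(2)]) (use S(2) growth in \<open>auto simp: cocycle_bound_def\<close>)
    also have "\<dots> \<le> exp (2 * t * y) * W n"
    proof (rule mult_left_mono)
      have "y * (\<bar>real_of_int n\<bar> - 1) \<le> y * \<bar>real_of_int (n - m)\<bar>" using dr y by (intro mult_left_mono) auto
      then have "exp (- y * \<bar>real_of_int (n - m)\<bar> / 4) \<le> exp (1 / 2 + - (y / 4) * \<bar>real_of_int n\<bar>)"
        using y by (simp add: algebra_simps)
      also have "\<dots> = exp (1 / 2) * exp (- (y / 4) * \<bar>real_of_int n\<bar>)" by (rule exp_add)
      also have "\<dots> \<le> 2 * exp (- (y / 4) * \<bar>real_of_int n\<bar>)" using exp_half_le_2 by (intro mult_right_mono) auto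
      finally have 1: "exp (- y * \<bar>real_of_int (n - m)\<bar> / 4) \<le> 2 * exp (- (y / 4) * \<bar>real_of_int n\<bar>)" .
      have "(1 / 4 :: real) \<le> exp (- 1)" using exp_le by (simp add: exp_minus field_simps)
      then have "(1 / 4 :: real) ^ nat \<bar>n - m\<bar> \<le> exp (- 1) ^ nat \<bar>n - m\<bar>" by (intro power_mono) auto
      also have "\<dots> = exp (- \<bar>real_of_int (n - m)\<bar>)" by (simp flip: exp_of_nat_mult)
      also have "\<dots> \<le> exp (1 + - 1 * \<bar>real_of_int n\<bar>)" using dr by simp
      also have "\<dots> = exp 1 * exp (- 1 * \<bar>real_of_int n\<bar>)" by (rule exp_add)
      also have "\<dots> \<le> 4 * exp (- 1 * \<bar>real_of_int n\<bar>)" using exp_le by (intro mult_right_mono) auto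
      finally have 2: "(1 / 4 :: real) ^ nat \<bar>n - m\<bar> \<le> 4 * exp (- 1 * \<bar>real_of_int n\<bar>)" .
      have "32 * B\<^sup>2 * cocycle_bound / (S * y ^ 4) * exp (- y * \<bar>real_of_int (n - m)\<bar> / 4)
          \<le> 32 * B\<^sup>2 * cocycle_bound / (S * y ^ 4) * (2 * exp (- (y / 4) * \<bar>real_of_int n\<bar>))"
        using cocycle_bound_pos S y by (intro mult_left_mono 1) auto
      then show "32 * B\<^sup>2 * cocycle_bound / (S * y ^ 4) * exp (- y * \<bar>real_of_int (n - m)\<bar> / 4) + 8 * (1 / 4) ^ nat \<bar>n - m\<bar> \<le> W n"
        using 2 by (simp add: W_def c1_def)
    qed simp
    finally show ?thesis .
  qed
  have pr: "prob f \<omega> \<theta> n t \<le> exp (2 * t * y) * W n" if "int q + 1 < \<bar>n\<bar>" "0 \<le> t" for n t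
    unfolding prob_eq using amp[of 0 n t] amp[of 1 n t] that by simp
  have total: "(\<Sum>n\<in>G. (1 + \<bar>real_of_int n\<bar>) powr p * W n) \<le> tail_const P" if G: "finite G" for G
  proof -
    have "(\<Sum>n\<in>G. (1 + \<bar>real_of_int n\<bar>) powr p * W n)
      = c1 * (\<Sum>n\<in>G. (1 + \<bar>real_of_int n\<bar>) powr p * exp (- (y / 4) * \<bar>real_of_int n\<bar>))
        + 32 * (\<Sum>n\<in>G. (1 + \<bar>real_of_int n\<bar>) powr p * exp (- 1 * \<bar>real_of_int n\<bar>))"
      unfolding W_def sum_distrib_left sum.distrib[symmetric] by (intro sum.cong) (simp_all add: algebra_simps)
    also have "\<dots> \<le> c1 * (poly_exp_const P / (y / 4) ^ Suc P) + 32 * (poly_exp_const P / 1 ^ Suc P)"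
      using c1 y by (intro add_mono mult_left_mono poly_exp_sum_le p G) auto
    also have "c1 * (poly_exp_const P / (y / 4) ^ Suc P)
        = 64 * B\<^sup>2 * cocycle_bound * poly_exp_const P * 4 ^ Suc P / (S * y ^ (P + 5))"
    proof -
      have "P + 5 = 4 + Suc P" by simp
      then have "y ^ (P + 5) = y ^ 4 * y ^ Suc P" by (simp only: power_add)
      then show ?thesis by (simp only: c1_def power_divide) (simp add: mult_ac)
    qed
    also have "\<dots> \<le> 64 * B\<^sup>2 * cocycle_bound * poly_exp_const P * 4 ^ Suc P / 1"
      using S(3) cocycle_bound_pos poly_exp_const_pos[of P] by (intro divide_left_mono) auto
    finally show ?thesis by (simp add: tail_const_def)
  qed
  show ?thesis using W pr total by blast
qed

lemma moment_le:
  assumes "controlled P y q" "0 < y" "y \<le> 1" "y \<le> 2 * B" "0 < p" "p \<le> real P" "0 \<le> t" "t * y \<le> 1"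
  shows "moment f \<omega> \<theta> p t \<le> (real q + 2) powr p + 9 * tail_const P"
proof -
  obtain W where W: "\<And>n. 0 \<le> W n" "\<And>n t. int q + 1 < \<bar>n\<bar> \<Longrightarrow> 0 \<le> t \<Longrightarrow> prob f \<omega> \<theta> n t \<le> exp (2 * t * y) * W n"
    "\<And>G. finite G \<Longrightarrow> (\<Sum>n\<in>G. (1 + \<bar>real_of_int n\<bar>) powr p * W n) \<le> tail_const P"
    using controlled_tail[OF assms(1-4,6)] by blast
  show ?thesis
    unfolding moment_def
  proof (rule weighted_infsum_le[where W = "\<lambda>n. 9 * W n", OF prob_nonneg prob_sum_le assms(5)])
    fix n assume "int q + 1 < \<bar>n\<bar>"
    then have "prob f \<omega> \<theta> n t \<le> exp (2 * t * y) * W n" using W(2) assms(7) by blast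
    also have "exp (2 * t * y) \<le> 9"
    proof -
      have "exp (2 * t * y) \<le> exp (2 * 1)" using assms(8) by simp
      also have "\<dots> = exp 1 ^ 2" by (simp flip: exp_of_nat_mult)
      also have "\<dots> \<le> (3::real) ^ 2" using exp_le by (intro power_mono) auto
      finally show ?thesis by simp
    qed
    finally show "prob f \<omega> \<theta> n t \<le> 9 * W n" using W(1)[of n] by (simp add: mult_right_mono)
  next
    fix G :: "int set" assume "finite G"
    have "(\<Sum>n\<in>G. (1 + \<bar>real_of_int n\<bar>) powr p * (9 * W n)) = 9 * (\<Sum>n\<in>G. (1 + \<bar>real_of_int n\<bar>) powr p * W n)"
      by (simp add: sum_distrib_left mult_ac)
    then show "(\<Sum>n\<in>G. (1 + \<bar>real_of_int n\<bar>) powr p * (9 * W n)) \<le> 9 * tail_const P"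
      using W(3)[OF \<open>finite G\<close>] by simp
  qed (use W(1) in auto)
qed

text \<open>At height y = 1 / (2 T) the growth exp (2 t y) = exp (t / T) uses up half of the weight
  exp (- 2 t / T); the remaining half integrates to T.\<close>

lemma moment_avg_le:
  assumes "controlled P (1 / (2 * T)) q" "1 \<le> T" "1 / (2 * T) \<le> 2 * B" "0 < p" "p \<le> real P"
  shows "moment_avg f \<omega> \<theta> p T \<le> (real q + 2) powr p + 9 * tail_const P"
proof -
  have T: "T > 0" using assms(2) by simp
  obtain W where W: "\<And>n. 0 \<le> W n"
    "\<And>n t. int q + 1 < \<bar>n\<bar> \<Longrightarrow> 0 \<le> t \<Longrightarrow> prob f \<omega> \<theta> n t \<le> exp (2 * t * (1 / (2 * T))) * W n"
    "\<And>G. finite G \<Longrightarrow> (\<Sum>n\<in>G. (1 + \<bar>real_of_int n\<bar>) powr p * W n) \<le> tail_const P"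
    using controlled_tail[OF assms(1) _ _ assms(3,5)] assms(2) by (auto simp: field_simps)
  show ?thesis
    unfolding moment_avg_def
  proof (rule weighted_infsum_le[where W = "\<lambda>n. 9 * W n", OF prob_avg_nonneg[OF T] prob_avg_sum_le[OF T] assms(4)])
    fix n assume n: "int q + 1 < \<bar>n\<bar>"
    have "(LBINT t:{0..}. exp (- 2 * t / T) * prob f \<omega> \<theta> n t) \<le> (LBINT t:{0..}. W n * exp (- (1 / T) * t))"
    proof (rule set_integral_mono)
      show "set_integrable lborel {0..} (\<lambda>t. exp (- 2 * t / T) * prob f \<omega> \<theta> n t)"
        by (intro weighted_integrable T continuous_prob prob_nonneg prob_le_1)
      show "set_integrable lborel {0..} (\<lambda>t. W n * exp (- (1 / T) * t))"
        using T by (intro set_integrable_mult_right exp_integral) auto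
      fix t :: real assume "t \<in> {0..}"
      then have "exp (- 2 * t / T) * prob f \<omega> \<theta> n t \<le> exp (- 2 * t / T) * (exp (2 * t * (1 / (2 * T))) * W n)"
        using W(2)[OF n, of t] by (intro mult_left_mono) auto
      also have "\<dots> = W n * (exp (- 2 * t / T) * exp (2 * t * (1 / (2 * T))))" by simp
      also have "exp (- 2 * t / T) * exp (2 * t * (1 / (2 * T))) = exp (- (1 / T) * t)"
        using T by (simp add: field_simps flip: exp_add)
      finally show "exp (- 2 * t / T) * prob f \<omega> \<theta> n t \<le> W n * exp (- (1 / T) * t)" .
    qed
    also have "\<dots> = W n * T" using exp_integral(2)[of "1 / T"] T by simp
    finally have "prob_avg f \<omega> \<theta> n T \<le> 2 / T * (W n * T)"
      unfolding prob_avg_def using T by (intro mult_left_mono) auto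
    also have "\<dots> \<le> 9 * W n" using T W(1)[of n] by simp
    finally show "prob_avg f \<omega> \<theta> n T \<le> 9 * W n" .
  next
    fix G :: "int set" assume "finite G"
    have "(\<Sum>n\<in>G. (1 + \<bar>real_of_int n\<bar>) powr p * (9 * W n)) = 9 * (\<Sum>n\<in>G. (1 + \<bar>real_of_int n\<bar>) powr p * W n)"
      by (simp add: sum_distrib_left mult_ac)
    then show "(\<Sum>n\<in>G. (1 + \<bar>real_of_int n\<bar>) powr p * (9 * W n)) \<le> 9 * tail_const P"
      using W(3)[OF \<open>finite G\<close>] by simp
  qed (use W(1) in auto)
qed

end

section \<open>Choice of the scales as functions of time\<close>

locale localized_model = schroedinger_model f F \<omega> \<theta> B + piecewise_potential f F J \<gamma> C
  for f F \<omega> \<theta> B J \<gamma> C +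
  assumes irrational: "\<omega> \<notin> \<rat>"
    and lyapunov_continuous: "continuous_on UNIV (\<lambda>E::real. lyapunov f \<omega> (complex_of_real E))"
    and lyapunov_pos: "\<And>E::real. lyapunov f \<omega> (complex_of_real E) > 0"
begin

definition approximant :: "nat \<Rightarrow> bool" where
  "approximant q \<longleftrightarrow> 0 < q \<and> (\<exists>p. coprime p (int q) \<and> \<bar>\<omega> - real_of_int p / real q\<bar> \<le> 1 / real (q\<^sup>2))"

text \<open>The range of y contains the height 1 / T for a fixed time and 1 / (2 T) for the average.
  With n about (d / c) ln T, exp (c n) is at most T^d \<le> q, and at most T, so y is an admissible
  imaginary part.\<close>

lemma eventually_controlled:
  assumes d: "0 < d" "d \<le> 1"
  shows "\<forall>\<^sub>F T in at_top. \<forall>q y. approximant q \<longrightarrow> T powr d \<le> real q \<longrightarrow> 1 / (2 * T) \<le> y \<longrightarrow> y \<le> 1 / T \<longrightarrow>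
    controlled P y q"
proof -
  define K where "K = 2 * B"
  have K: "K \<ge> 0" using B_pos by (simp add: K_def)
  have cont: "continuous_on {-K..K} (\<lambda>E. lyapunov f \<omega> (complex_of_real E))"
    using lyapunov_continuous by (rule continuous_on_subset) simp
  obtain E0 where E0: "E0 \<in> {-K..K}" "\<And>E. E \<in> {-K..K} \<Longrightarrow> lyapunov f \<omega> (complex_of_real E0) \<le> lyapunov f \<omega> (complex_of_real E)"
    using continuous_attains_inf[OF compact_Icc _ cont] K by auto
  define l where "l = lyapunov f \<omega> (complex_of_real E0)"
  have l: "l > 0" using lyapunov_pos by (simp add: l_def)
  have l_le: "\<And>E. E \<in> {-K..K} \<Longrightarrow> l \<le> lyapunov f \<omega> (complex_of_real E)" using E0(2) by (simp add: l_def)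
  obtain c where c: "c > 0" and grow: "\<And>R. R \<ge> 1 \<Longrightarrow> \<exists>n0. \<forall>n\<ge>n0. \<forall>q p. 0 < q \<longrightarrow> coprime p (int q) \<longrightarrow>
    \<bar>\<omega> - real_of_int p / real q\<bar> \<le> 1 / real (q\<^sup>2) \<longrightarrow> exp (c * n) \<le> real q \<longrightarrow>
    (\<forall>\<theta> E y. \<bar>E\<bar> \<le> K \<longrightarrow> \<bar>y\<bar> \<le> exp (- (c * n)) \<longrightarrow> (\<exists>i. i + R * n \<le> q \<and>
      exp (real (R * n) * l / 2) \<le> opnorm (cocycle f \<omega> (Complex E y) (R * n) (\<theta> + real i * \<omega>))))"
    using cocycle_growth[OF irrational K cont l l_le] by metis
  \<comment> \<open>n is at least (d / (2 c)) ln T, so the chained norm exp (R n l / 2) is at least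
    T to the power R d l / (4 c), and this exponent has to reach P + 6.\<close>
  obtain R0 where R0: "4 * c * (P + 6) / (d * l) \<le> real R0" using real_arch_simple by blast
  define R where "R = max 1 R0"
  have R: "R \<ge> 1" "4 * c * (P + 6) \<le> real R * (d * l)"
  proof -
    have "4 * c * (P + 6) / (d * l) \<le> real R" using R0 by (simp add: R_def)
    then show "4 * c * (P + 6) \<le> real R * (d * l)" using d l by (simp add: field_simps)
  qed (simp add: R_def)
  obtain n0 where n0: "\<And>n q p \<theta> E y. n \<ge> n0 \<Longrightarrow> 0 < q \<Longrightarrow> coprime p (int q) \<Longrightarrow>
    \<bar>\<omega> - real_of_int p / real q\<bar> \<le> 1 / real (q\<^sup>2) \<Longrightarrow> exp (c * n) \<le> real q \<Longrightarrow>
    \<bar>E\<bar> \<le> K \<Longrightarrow> \<bar>y\<bar> \<le> exp (- (c * n)) \<Longrightarrow> \<exists>i. i + R * n \<le> q \<and>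
      exp (real (R * n) * l / 2) \<le> opnorm (cocycle f \<omega> (Complex E y) (R * n) (\<theta> + real i * \<omega>))"
    using grow[OF R(1)] by metis
  have "\<forall>\<^sub>F T in at_top. T \<ge> max (max 1 (exp (2 * c * (real n0 + 1) / d))) (max (2 ^ (P + 5)) (2 * cocycle_bound))"
    by (rule eventually_ge_at_top)
  then show ?thesis
  proof eventually_elim
    case (elim T)
    then have T: "T \<ge> 1" "exp (2 * c * (real n0 + 1) / d) \<le> T" "2 ^ (P + 5) \<le> T" "2 * cocycle_bound \<le> T" by auto
    define X where "X = d / c * ln T"
    define n where "n = nat \<lfloor>X\<rfloor>"
    have "2 * c * (real n0 + 1) / d \<le> ln T" using T(1,2) by (subst ln_ge_iff) auto
    then have big: "2 * (real n0 + 1) \<le> X" using c d by (simp add: X_def field_simps)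
    then have n: "real n \<le> X" "X - 1 < real n" by (auto simp: n_def)
    have n_half: "X / 2 \<le> real n" using n big of_nat_0_le_iff[of n0, where 'a = real] by argo
    have n0_le: "n0 \<le> n" "1 \<le> n"
    proof -
      have "real n0 \<le> real n" "1 \<le> real n"
        using n big of_nat_0_le_iff[of n0, where 'a = real] by argo+
      then show "n0 \<le> n" "1 \<le> n" by simp_all
    qed
    have cn: "c * n \<le> d * ln T"
    proof -
      have "c * n \<le> c * X" using n(1) c by (intro mult_left_mono) auto
      then show ?thesis using c by (simp add: X_def)
    qed
    show ?case
    proof (intro allI impI)
      fix q y assume q: "approximant q" "T powr d \<le> real q" and y: "1 / (2 * T) \<le> y" "y \<le> 1 / T"
      obtain p where p: "0 < q" "coprime p (int q)" "\<bar>\<omega> - real_of_int p / real q\<bar> \<le> 1 / real (q\<^sup>2)"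
        using q(1) by (auto simp: approximant_def)
      have y0: "y > 0" using y(1) T(1) less_le_trans[of 0 "1 / (2 * T)" y] by simp
      have qn: "exp (c * n) \<le> real q"
        using q(2) cn T(1) by (simp add: powr_def) (meson exp_le_cancel_iff order_trans)
      have yn: "y \<le> exp (- (c * n))"
      proof -
        have "d * ln T \<le> 1 * ln T" using d T(1) by (intro mult_right_mono) auto
        then have "exp (- ln T) \<le> exp (- (c * n))" using cn by simp
        moreover have "exp (- ln T) = 1 / T" using T(1) by (simp add: exp_minus divide_inverse)
        ultimately show ?thesis using y(2) by linarith
      qed
      define S where "S = exp (real (R * n) * l / 2)"
      have S_large: "T ^ (P + 6) \<le> S"
      proof -
        have "(P + 6) * ln T \<le> real R * (d * l) / (4 * c) * ln T"
          using R(2) c T(1) by (intro mult_right_mono) (auto simp: field_simps)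
        also have "\<dots> = real R * l / 2 * (X / 2)" by (simp add: X_def)
        also have "\<dots> \<le> real R * l / 2 * real n" using n_half l by (intro mult_left_mono) auto
        finally have "exp ((P + 6) * ln T) \<le> S" by (simp add: S_def mult_ac)
        then show ?thesis using T(1) by (simp add: exp_of_nat_mult flip: of_nat_Suc of_nat_add)
      qed
      show "controlled P y q"
        unfolding controlled_def
      proof (rule exI[of _ "R * n"], rule exI[of _ S], intro conjI allI impI)
        show "1 \<le> R * n" using R(1) n0_le(2) by simp
        show "0 < S" by (simp add: S_def)
        show "1 \<le> S * y ^ (P + 5)"
        proof -
          \<comment> \<open>The power of T beyond P + 5 pays for the constant 2^(P + 5) coming from
            y \<ge> 1 / (2 T).\<close>
          have "1 \<le> T / 2 ^ (P + 5)" using T(3) by simp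
          also have "\<dots> = T ^ (P + 6) * (1 / (2 * T)) ^ (P + 5)"
          proof -
            have "T ^ (P + 6) = T * T ^ (P + 5)" by (simp add: eval_nat_numeral)
            then show ?thesis using T(1) by (simp add: power_divide power_mult_distrib)
          qed
          also have "\<dots> \<le> S * y ^ (P + 5)"
            using S_large y T(1) by (intro mult_mono power_mono) (auto simp: S_def)
          finally show ?thesis .
        qed
        show "cocycle_bound / y \<le> S\<^sup>2"
        proof -
          have "cocycle_bound / y \<le> cocycle_bound / (1 / (2 * T))"
            using y y0 T(1) cocycle_bound_pos by (intro divide_left_mono) auto
          also have "\<dots> = 2 * cocycle_bound * T" by simp
          also have "\<dots> \<le> T * T" using T by (intro mult_right_mono) auto
          also have "\<dots> \<le> T ^ (P + 6)"
            using T(1) power_increasing[of 2 "P + 6" T] by (simp add: power2_eq_square)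
          also have "\<dots> \<le> S" by (rule S_large)
          also have "\<dots> \<le> S\<^sup>2"
          proof -
            have "1 \<le> S" using l by (simp add: S_def)
            then show ?thesis by (simp add: power2_eq_square mult_le_cancel_left1)
          qed
          finally show ?thesis .
        qed
        fix \<theta>' E y' :: real assume E: "\<bar>E\<bar> \<le> 2 * B" and y': "\<bar>y'\<bar> = y"
        show "\<exists>i. i + R * n \<le> q \<and> S \<le> opnorm (cocycle f \<omega> (Complex E y') (R * n) (\<theta>' + real i * \<omega>))"
          unfolding S_def by (rule n0[OF n0_le(1) p qn]) (use E y' yn in \<open>auto simp: K_def\<close>)
      qed
    qed
  qed
qed

text \<open>The factor 3^p and the constant c cost at most another T^(d p) for large T, whence 2 d
  rather than d. M = 0 is covered by \<open>ln 0 = 0\<close>.\<close>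

lemma ln_ratio_le:
  fixes p d c :: real
  assumes p: "p > 0" and d: "d > 0" and c: "c \<ge> 0"
  shows "\<forall>\<^sub>F T in at_top. \<forall>M q. M \<le> (real q + 2) powr p + c \<longrightarrow> real q \<le> T powr d \<longrightarrow> 0 \<le> M \<longrightarrow>
    ln M / (p * ln T) \<le> 2 * d"
proof -
  define A where "A = 3 powr p + c"
  have A: "A > 0" using c by (simp add: A_def add_pos_nonneg)
  have "\<forall>\<^sub>F T in at_top. T \<ge> max 2 (A powr (1 / (d * p)))" by (rule eventually_ge_at_top)
  then show ?thesis
  proof eventually_elim
    case (elim T)
    then have T: "T \<ge> 2" "A powr (1 / (d * p)) \<le> T" by auto
    show ?case
    proof (intro allI impI)
      fix M q assume M: "M \<le> (real q + 2) powr p + c" and q: "real q \<le> T powr d" and M0: "0 \<le> M"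
      have Td: "1 \<le> T powr d" using T(1) d by (intro ge_one_powr_ge_zero) auto
      have Tdp: "1 \<le> T powr (d * p)" using T(1) d p by (intro ge_one_powr_ge_zero) auto
      have "(real q + 2) powr p \<le> (3 * T powr d) powr p" using q Td p by (intro powr_mono2) auto
      also have "\<dots> = 3 powr p * T powr (d * p)" by (simp add: powr_mult powr_powr)
      finally have "M \<le> 3 powr p * T powr (d * p) + c" using M by linarith
      also have "\<dots> \<le> 3 powr p * T powr (d * p) + c * T powr (d * p)"
        using c Tdp by (simp add: mult_le_cancel_left1)
      also have "\<dots> = A * T powr (d * p)" by (simp add: A_def distrib_right)
      also have "A \<le> T powr (d * p)"
      proof -
        have "A = (A powr (1 / (d * p))) powr (d * p)" using A d p by (simp add: powr_powr)
        also have "\<dots> \<le> T powr (d * p)" using T(2) d p by (intro powr_mono2) auto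
        finally show ?thesis .
      qed
      finally have M': "M \<le> T powr (d * p) * T powr (d * p)" using Tdp by (simp add: mult_right_mono)
      have lnT: "ln T > 0" using T(1) by simp
      have "ln M \<le> 2 * (d * p) * ln T"
      proof (cases "M > 0")
        case True
        then have "ln M \<le> ln (T powr (d * p) * T powr (d * p))" using M' by (intro ln_mono) auto
        also have "\<dots> = 2 * (d * p) * ln T" using T(1) by (simp add: ln_mult ln_powr)
        finally show ?thesis .
      next
        case False
        then have "ln M = 0" using M0 by simp
        then show ?thesis using d p lnT by simp
      qed
      then show "ln M / (p * ln T) \<le> 2 * d" using p lnT by (simp add: field_simps)
    qed
  qed
qed

lemma approximant_cf_denom: "approximant (nat (cf_denom \<omega> n))"
proof -
  have pos: "cf_denom \<omega> n \<ge> 1" using cf_denom_pos[OF irrational] by blast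
  then have eq: "int (nat (cf_denom \<omega> n)) = cf_denom \<omega> n" "real (nat (cf_denom \<omega> n)) = real_of_int (cf_denom \<omega> n)" by auto
  show ?thesis
    unfolding approximant_def
  proof (intro conjI exI[of _ "cf_numer \<omega> n"])
    show "0 < nat (cf_denom \<omega> n)" using pos by simp
    show "coprime (cf_numer \<omega> n) (int (nat (cf_denom \<omega> n)))" unfolding eq by (rule cf_coprime[OF irrational])
    show "\<bar>\<omega> - real_of_int (cf_numer \<omega> n) / real (nat (cf_denom \<omega> n))\<bar> \<le> 1 / real ((nat (cf_denom \<omega> n))\<^sup>2)"
      using cf_error[OF irrational, of n] by (simp add: eq)
  qed
qed

lemma eventually_inverse_le: "\<forall>\<^sub>F T in at_top. 1 \<le> T \<and> 1 / T \<le> 2 * B"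
proof -
  have "\<forall>\<^sub>F T in at_top. T \<ge> max 1 (1 / (2 * B))" by (rule eventually_ge_at_top)
  then show ?thesis
  proof eventually_elim
    case (elim T)
    then show ?case using B_pos by (simp add: field_simps)
  qed
qed

lemma moment_nonneg: "0 \<le> moment f \<omega> \<theta> p t"
  unfolding moment_def by (intro infsum_nonneg) (simp add: prob_nonneg)

lemma moment_avg_nonneg: "T > 0 \<Longrightarrow> 0 \<le> moment_avg f \<omega> \<theta> p T"
  unfolding moment_avg_def by (intro infsum_nonneg) (simp add: prob_avg_nonneg)

text \<open>A lower limit asks only for a sequence of times. Each large denominator q supplies T =
  q^(1 / d), where T^d = q meets both the lower bound on q needed for control and the upper bound on
  q for the moment.\<close>

lemma beta_minus_zero:
  assumes p: "p > 0"
  shows "beta_minus f \<omega> \<theta> p = 0"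
proof (rule antisym)
  have "\<forall>\<^sub>F T in at_top. 0 \<le> ereal (ln (moment_avg f \<omega> \<theta> p T) / (p * ln T))"
    using eventually_ge_at_top[of 1]
  proof eventually_elim
    case (elim T)
    then show ?case using p ln_moment_avg_nonneg[OF p, of T] by simp
  qed
  then show "0 \<le> beta_minus f \<omega> \<theta> p" unfolding beta_minus_def by (rule Liminf_bounded)
next
  obtain P where P: "p \<le> real P" using real_arch_simple by blast
  show "beta_minus f \<omega> \<theta> p \<le> 0"
  proof (rule ereal_le_epsilon2)
    fix e :: real assume e: "0 < e"
    define d where "d = min 1 (e / 2)"
    have d: "0 < d" "d \<le> 1" "2 * d \<le> e" using e by (auto simp: d_def)
    show "beta_minus f \<omega> \<theta> p \<le> 0 + ereal e"
    proof (rule ccontr)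
      assume "\<not> beta_minus f \<omega> \<theta> p \<le> 0 + ereal e"
      then have "ereal e < beta_minus f \<omega> \<theta> p" by simp
      then have "\<forall>\<^sub>F T in at_top. ereal e < ereal (ln (moment_avg f \<omega> \<theta> p T) / (p * ln T))"
        unfolding beta_minus_def by (rule less_LiminfD)
      then have "\<forall>\<^sub>F T in at_top. ereal e < ereal (ln (moment_avg f \<omega> \<theta> p T) / (p * ln T))
          \<and> (\<forall>q y. approximant q \<longrightarrow> T powr d \<le> real q \<longrightarrow> 1 / (2 * T) \<le> y \<longrightarrow> y \<le> 1 / T \<longrightarrow> controlled P y q)
          \<and> (\<forall>M q. M \<le> (real q + 2) powr p + 9 * tail_const P \<longrightarrow> real q \<le> T powr d \<longrightarrow> 0 \<le> M \<longrightarrow> ln M / (p * ln T) \<le> 2 * d)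
          \<and> (1 \<le> T \<and> 1 / T \<le> 2 * B)"
        by (intro eventually_conj[OF _ eventually_conj[OF eventually_controlled[OF d(1,2)]
              eventually_conj[OF ln_ratio_le[OF p d(1)] eventually_inverse_le]]]) (simp_all add: tail_const_nonneg)
      then obtain T0 where T0: "\<And>T. T \<ge> T0 \<Longrightarrow> ereal e < ereal (ln (moment_avg f \<omega> \<theta> p T) / (p * ln T))"
        "\<And>T q y. T \<ge> T0 \<Longrightarrow> approximant q \<Longrightarrow> T powr d \<le> real q \<Longrightarrow> 1 / (2 * T) \<le> y \<Longrightarrow> y \<le> 1 / T \<Longrightarrow> controlled P y q"
        "\<And>T M q. T \<ge> T0 \<Longrightarrow> M \<le> (real q + 2) powr p + 9 * tail_const P \<Longrightarrow> real q \<le> T powr d \<Longrightarrow> 0 \<le> M \<Longrightarrow> ln M / (p * ln T) \<le> 2 * d"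
        "\<And>T. T \<ge> T0 \<Longrightarrow> 1 \<le> T" "\<And>T. T \<ge> T0 \<Longrightarrow> 1 / T \<le> 2 * B"
        unfolding eventually_at_top_linorder by blast
      define T1 where "T1 = max 1 T0"
      obtain N where N: "T1 powr d \<le> real N" using real_arch_simple by blast
      define q where "q = nat (cf_denom \<omega> N)"
      have "cf_denom \<omega> N \<ge> int N" using cf_denom_ge[OF irrational] by blast
      then have qN: "N \<le> q" by (simp add: q_def)
      have q: "approximant q" unfolding q_def by (rule approximant_cf_denom)
      have q0: "q > 0" using q by (simp add: approximant_def)
      define T where "T = real q powr (1 / d)"
      have Td: "T powr d = real q" using d q0 by (simp add: T_def powr_powr)
      have "T1 = (T1 powr d) powr (1 / d)" using d by (simp add: powr_powr T1_def)
      also have "\<dots> \<le> T" unfolding T_def using N qN d by (intro powr_mono2) auto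
      finally have T: "T \<ge> T0" by (simp add: T1_def)
      have T1: "T \<ge> 1" "1 / T \<le> 2 * B" using T0(4,5) T by auto
      have half: "1 / (2 * T) \<le> 1 / T" using T1(1) by (simp add: frac_le)
      have "controlled P (1 / (2 * T)) q"
        using half Td by (intro T0(2)[OF T q]) auto
      then have "moment_avg f \<omega> \<theta> p T \<le> (real q + 2) powr p + 9 * tail_const P"
        using T1 half by (intro moment_avg_le p P) linarith+
      then have "ln (moment_avg f \<omega> \<theta> p T) / (p * ln T) \<le> 2 * d"
        using Td moment_avg_nonneg[of T p] T1(1) by (intro T0(3)[OF T]) auto
      then show False using T0(1)[OF T] d(3) by simp
    qed
  qed
qed

text \<open>The least denominator reaching T^d' has a predecessor below T^d', so the Diophantine
  condition places it below T^(d' (1 + \<kappa>)) = T^d. T is large enough to put the predecessor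
  into the range where the condition holds.\<close>

lemma diophantine_approximants:
  assumes dio: "diophantine \<omega>" and d: "0 < d"
  shows "\<exists>d'>0. d' \<le> d \<and> (\<forall>\<^sub>F T in at_top. \<exists>q. approximant q \<and> T powr d' \<le> real q \<and> real q \<le> T powr d)"
proof -
  obtain \<kappa> where \<kappa>: "\<kappa> > 0"
    and ev: "\<forall>\<^sub>F n in sequentially. real_of_int (cf_denom \<omega> (Suc n)) < real_of_int (cf_denom \<omega> n) powr (1 + \<kappa>)"
    using dio unfolding diophantine_def by blast
  obtain N where N: "\<And>n. n \<ge> N \<Longrightarrow> real_of_int (cf_denom \<omega> (Suc n)) < real_of_int (cf_denom \<omega> n) powr (1 + \<kappa>)"
    using ev unfolding eventually_sequentially by blast
  define d' where "d' = d / (1 + \<kappa>)"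
  have d': "d' > 0" "d' \<le> d" "d' * (1 + \<kappa>) = d" using d \<kappa> by (auto simp: d'_def field_simps)
  have mono: "cf_denom \<omega> m \<le> cf_denom \<omega> n" if "m \<le> n" for m n
    by (rule lift_Suc_mono_le[OF _ that]) (use cf_denom_pos[OF irrational] in blast)
  have "\<forall>\<^sub>F T in at_top. T \<ge> max 1 ((real_of_int (cf_denom \<omega> N) + 1) powr (1 / d'))" by (rule eventually_ge_at_top)
  then have "\<forall>\<^sub>F T in at_top. \<exists>q. approximant q \<and> T powr d' \<le> real q \<and> real q \<le> T powr d"
  proof eventually_elim
    case (elim T)
    then have T: "T \<ge> 1" "(real_of_int (cf_denom \<omega> N) + 1) powr (1 / d') \<le> T" by auto
    have posN: "cf_denom \<omega> n \<ge> 1" for n using cf_denom_pos[OF irrational] by blast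
    have "real_of_int (cf_denom \<omega> N) + 1 = ((real_of_int (cf_denom \<omega> N) + 1) powr (1 / d')) powr d'"
      using d'(1) posN[of N] by (simp add: powr_powr)
    also have "\<dots> \<le> T powr d'" using T(2) d'(1) by (intro powr_mono2) auto
    finally have TN: "real_of_int (cf_denom \<omega> N) < T powr d'" by simp
    obtain n1 where "T powr d' \<le> real n1" using real_arch_simple by blast
    moreover have "real n1 \<le> real_of_int (cf_denom \<omega> n1)" using cf_denom_ge[OF irrational, of n1] by linarith
    ultimately have ex: "\<exists>n. T powr d' \<le> real_of_int (cf_denom \<omega> n)" by (meson order_trans)
    define m where "m = (LEAST n. T powr d' \<le> real_of_int (cf_denom \<omega> n))"
    have m: "T powr d' \<le> real_of_int (cf_denom \<omega> m)" unfolding m_def using ex by (rule LeastI_ex)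
    have "m > N"
    proof (rule ccontr)
      assume "\<not> m > N"
      then have "real_of_int (cf_denom \<omega> m) \<le> real_of_int (cf_denom \<omega> N)" using mono[of m N] by simp
      then show False using m TN by simp
    qed
    then obtain m' where m': "m = Suc m'" "m' \<ge> N" by (cases m) auto
    have "\<not> T powr d' \<le> real_of_int (cf_denom \<omega> m')" 
      using not_less_Least[of m' "\<lambda>n. T powr d' \<le> real_of_int (cf_denom \<omega> n)"] m'(1) unfolding m_def by simp
    then have "real_of_int (cf_denom \<omega> m') powr (1 + \<kappa>) \<le> (T powr d') powr (1 + \<kappa>)"
      using posN[of m'] \<kappa> by (intro powr_mono2) auto
    also have "\<dots> = T powr d" by (simp add: powr_powr d'(3))
    finally have "real_of_int (cf_denom \<omega> m) \<le> T powr d" using N[OF m'(2)] m'(1) by simp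
    moreover have "real (nat (cf_denom \<omega> m)) = real_of_int (cf_denom \<omega> m)" using posN[of m] by simp
    ultimately show ?case using m approximant_cf_denom[of m] by (intro exI[of _ "nat (cf_denom \<omega> m)"]) simp
  qed
  then show ?thesis using d'(1,2) by blast
qed

text \<open>Every large time T has a denominator between T^d' and T^d: the lower bound gives control
  at height 1 / T, the upper bound keeps the exponent of the moment at most 2 d.\<close>

lemma beta_plus_zero:
  assumes dio: "diophantine \<omega>" and p: "p > 0"
  shows "beta_plus f \<omega> \<theta> p = 0"
proof (rule antisym)
  have "\<forall>\<^sub>F t in at_top. 0 \<le> ereal (ln (moment f \<omega> \<theta> p t) / (p * ln t))"
    using eventually_ge_at_top[of 1]
  proof eventually_elim
    case (elim t)
    then show ?case using p ln_moment_nonneg[OF p, of t] by simp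
  qed
  then have "0 \<le> Liminf at_top (\<lambda>t. ereal (ln (moment f \<omega> \<theta> p t) / (p * ln t)))" by (rule Liminf_bounded)
  also have "\<dots> \<le> beta_plus f \<omega> \<theta> p" unfolding beta_plus_def by (rule Liminf_le_Limsup) simp
  finally show "0 \<le> beta_plus f \<omega> \<theta> p" .
next
  obtain P where P: "p \<le> real P" using real_arch_simple by blast
  show "beta_plus f \<omega> \<theta> p \<le> 0"
  proof (rule ereal_le_epsilon2)
    fix e :: real assume e: "0 < e"
    define d where "d = min 1 (e / 2)"
    have d: "0 < d" "d \<le> 1" "2 * d \<le> e" using e by (auto simp: d_def)
    obtain d' where d': "d' > 0" "d' \<le> d"
      and ev: "\<forall>\<^sub>F T in at_top. \<exists>q. approximant q \<and> T powr d' \<le> real q \<and> real q \<le> T powr d"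
      using diophantine_approximants[OF dio d(1)] by blast
    have "d' \<le> 1" using d d' by simp
    have c0: "0 \<le> 9 * tail_const P" using tail_const_nonneg by simp
    have "\<forall>\<^sub>F T in at_top. ereal (ln (moment f \<omega> \<theta> p T) / (p * ln T)) \<le> ereal e"
      using ev eventually_controlled[OF d'(1) \<open>d' \<le> 1\<close>, of P]
        ln_ratio_le[OF p d(1) c0] eventually_inverse_le
    proof eventually_elim
      case (elim T)
      then have T: "T \<ge> 1" "1 / T \<le> 2 * B" by auto
      obtain q where q: "approximant q" "T powr d' \<le> real q" "real q \<le> T powr d" using elim(1) by blast
      have "1 / (2 * T) \<le> 1 / T" using T(1) by (simp add: frac_le)
      then have "controlled P (1 / T) q" using elim(2) q by blast
      then have "moment f \<omega> \<theta> p T \<le> (real q + 2) powr p + 9 * tail_const P"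
        using T by (intro moment_le[where y = "1 / T"] p P) auto
      then have "ln (moment f \<omega> \<theta> p T) / (p * ln T) \<le> 2 * d"
        using elim(3) q(3) moment_nonneg[of p T] by blast
      then show ?case using d(3) by simp
    qed
    then show "beta_plus f \<omega> \<theta> p \<le> 0 + ereal e" unfolding beta_plus_def by (simp add: Limsup_bounded)
  qed
qed

end

text \<open>\<open>PL_norm\<close> bounds quotients for positive h at base points farther than h
  from the jumps, so the left one of the two points serves as base. Being within 3 s of x, it is at
  least 4 s away from every jump, which exceeds h \<le> 3 s.\<close>

lemma piecewise_hoelder_potential:
  assumes per: "periodic1 f" and pw: "piecewise_hoelder f"
  shows "\<exists>F J \<gamma> C. piecewise_potential f F J \<gamma> C"
proof -
  have per': "\<And>x. f (x + 1) = f x" using per by (simp add: periodic1_def)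
  obtain \<gamma> where \<gamma>: "\<gamma> > 0" "PL_norm \<gamma> f < \<infinity>" using pw by (auto simp: piecewise_hoelder_def)
  define J where "J = jumps f \<inter> {0..<1}"
  have finJ: "finite J" using pw by (simp add: piecewise_hoelder_def J_def)
  define M where "M = enn2real (PL_norm \<gamma> f)"
  have M: "PL_norm \<gamma> f = ennreal M" "M \<ge> 0" using \<gamma>(2) by (auto simp: M_def)
  have bound: "\<bar>f x\<bar> \<le> M" for x
  proof -
    have "ennreal \<bar>f x\<bar> \<le> (SUP t. ennreal \<bar>f t\<bar>)" by (rule SUP_upper) simp
    also have "\<dots> \<le> PL_norm \<gamma> f" unfolding PL_norm_def by simp
    finally show ?thesis using M by (simp add: ennreal_le_iff)
  qed
  have quot: "\<bar>f (t + h) - f t\<bar> \<le> M * h powr \<gamma>" if "h > 0" "jumps f = {} \<or> infdist t (jumps f) > \<bar>h\<bar>" for t h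
  proof -
    have "ennreal (\<bar>f (t + h) - f t\<bar> / \<bar>h\<bar> powr \<gamma>)
      \<le> (SUP h\<in>{0<..}. SUP t\<in>{t. jumps f = {} \<or> infdist t (jumps f) > \<bar>h\<bar>}. ennreal (\<bar>f (t + h) - f t\<bar> / \<bar>h\<bar> powr \<gamma>))"
      using that by (intro SUP_upper2[of h] SUP_upper2[of t]) auto
    also have "\<dots> \<le> PL_norm \<gamma> f" unfolding PL_norm_def by simp
    finally have "\<bar>f (t + h) - f t\<bar> / \<bar>h\<bar> powr \<gamma> \<le> M" using M by (simp add: ennreal_le_iff)
    then show ?thesis using that(1) by (simp add: field_simps)
  qed
  have jumpJ: "\<exists>a\<in>J. \<exists>m::int. t = a + of_int m" if "t \<in> jumps f" for t
  proof -
    have "isCont f t" if "isCont f (frac t)"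
    proof -
      have "isCont (\<lambda>x. f (x + of_int (- \<lfloor>t\<rfloor>))) t"
        using that by (intro isCont_o2[of t "\<lambda>x. x + of_int (- \<lfloor>t\<rfloor>)" f]) (auto simp: frac_def)
      then show ?thesis by (simp only: periodic_add_of_int[of f, OF per'])
    qed
    then have "\<not> isCont f (frac t)" using that unfolding jumps_def by blast
    then have "frac t \<in> J" using frac_lt_1[of t] by (simp add: J_def jumps_def)
    then show ?thesis by (intro bexI[of _ "frac t"] exI[of _ "\<lfloor>t\<rfloor>"]) (simp_all add: frac_def)
  qed
  have "piecewise_potential f M J \<gamma> M"
  proof
    show "\<bar>f x\<bar> \<le> M" for x by (rule bound)
    show "f (x + 1) = f x" for x by (rule per')
    show "finite J" "\<gamma> > 0" "M \<ge> 0" using finJ \<gamma> M by auto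
    have "jumps f \<subseteq> (\<Union>a\<in>J. range (\<lambda>m::int. a + of_int m))" using jumpJ by blast
    moreover have "countable (\<Union>a\<in>J. range (\<lambda>m::int. a + of_int m))"
      using finJ by (simp add: countable_finite)
    ultimately show "countable (jumps f)" by (rule countable_subset)
    fix s x x' :: real
    assume s: "0 < s" and close: "\<bar>x - x'\<bar> \<le> 3 * s" and away: "\<And>a m. a \<in> J \<Longrightarrow> 7 * s < \<bar>x - a - of_int m\<bar>"
    define t where "t = min x x'"
    define h where "h = \<bar>x - x'\<bar>"
    show "\<bar>f x - f x'\<bar> \<le> M * (3 * s) powr \<gamma>"
    proof (cases "x = x'")
      case True
      then show ?thesis using M by simp
    next
      case False
      then have h: "h > 0" "h \<le> 3 * s" using close by (auto simp: h_def)
      have "infdist t (jumps f) > \<bar>h\<bar>" if ne: "jumps f \<noteq> {}"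
      proof -
        have "4 * s \<le> dist t d" if d: "d \<in> jumps f" for d
        proof -
          obtain a m where "a \<in> J" "d = a + of_int m" using jumpJ[OF d] by blast
          then have "7 * s < \<bar>x - d\<bar>" using away[of a m] by (simp add: algebra_simps)
          then show ?thesis using close by (auto simp: t_def dist_real_def min_def)
        qed
        then have "4 * s \<le> infdist t (jumps f)"
          unfolding infdist_def using ne by (auto intro: cINF_greatest)
        then show ?thesis using h s by simp
      qed
      then have "\<bar>f (t + h) - f t\<bar> \<le> M * h powr \<gamma>" using h by (intro quot) auto
      also have "\<dots> \<le> M * (3 * s) powr \<gamma>" using h M \<gamma> by (intro mult_left_mono powr_mono2) auto
      finally show ?thesis by (cases "x \<le> x'") (auto simp: t_def h_def abs_minus_commute)
    qed
  qed
  then show ?thesis by blast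
qed

theorem theorem1p7:
  fixes f :: "real \<Rightarrow> real" and \<omega> :: real
  assumes "periodic1 f"
    and "piecewise_hoelder f"
    and "\<omega> \<notin> \<rat>"
    and "continuous_on UNIV (\<lambda>E::real. lyapunov f \<omega> (complex_of_real E))"
    and "\<forall>E::real. lyapunov f \<omega> (complex_of_real E) > 0"
  shows "(\<forall>\<theta> p. p > 0 \<longrightarrow> beta_minus f \<omega> \<theta> p = 0)
    \<and> (diophantine \<omega> \<longrightarrow> (\<forall>\<theta> p. p > 0 \<longrightarrow> beta_plus f \<omega> \<theta> p = 0))"
proof -
  obtain F J \<gamma> C where pot: "piecewise_potential f F J \<gamma> C"
    using piecewise_hoelder_potential[OF assms(1,2)] by blast
  interpret piecewise_potential f F J \<gamma> C by (rule pot)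
  have "bounded (range f)" using f_bound by (auto simp: bounded_iff)
  have "\<exists>B. localized_model f F \<omega> \<theta> B J \<gamma> C" for \<theta>
  proof -
    obtain B where "bounded_selfadjoint (schroedinger f \<omega> \<theta>) B"
      using schroedinger_selfadjoint[OF \<open>bounded (range f)\<close>] by blast
    then have "localized_model f F \<omega> \<theta> B J \<gamma> C"
      using assms(3-5) pot bounded_potential_axioms
      by (intro localized_model.intro schroedinger_model.intro localized_model_axioms.intro) auto
    then show ?thesis by blast
  qed
  then show ?thesis using localized_model.beta_minus_zero localized_model.beta_plus_zero by metis
qed

end
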